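(* Let $d\ge2$, $d-2\le s<d$, $\alpha=d-s$, regard $\mathbb{R}^d$ as $\mathbb{R}^d\times\{0\}\subset\mathbb{R}^{d+1}$, let $y_1=(0,\dots,0,y_{1,d+1})$, $y_2=(0,\dots,0,y_{2,d+1})$ with $y_{1,d+1},y_{2,d+1}>0$, let $\gamma>0$ and $$Q(x)=-\frac{1+\gamma}{(|x|^2+y_{1,d+1}^2)^{s/2}}+\frac{\gamma}{(|x|^2+y_{2,d+1}^2)^{s/2}},\qquad x\in\mathbb{R}^d.$$ Set $$g=\frac{\gamma}{1+\gamma},\qquad\rho=\Bigl[g\Bigl(\frac{y_{2,d+1}}{y_{1,d+1}}\Bigr)^{\alpha}\Bigr]^{2/(2d-s)},\qquad R=\Bigl(\frac{\rho\,y_{1,d+1}^2-y_{2,d+1}^2}{1-\rho}\Bigr)^{1/2}$$ (whenever the argument of the square root is nonnegative). For the Riesz $s$-equilibrium problem on $\mathbb{R}^d$ in the external field $Q$, with equilibrium measure $\mu_Q$: (i) if $y_{2,d+1}/y_{1,d+1}\in(0,g^{1/d})$, then $S_{\mu_Q}\subset B_R^c$, the complement of the ball $B_R=\{|x|\le R\}$; (ii) if $y_{2,d+1}/y_{1,d+1}\in[g^{1/d},g^{-1/\alpha}]$, then $S_{\mu_Q}=\mathbb{R}^d$ and $\mu_Q=\eta_{Q,\mathbb{R}^d}$; (iii) if $y_{2,d+1}/y_{1,d+1}\in(g^{-1/\alpha},\infty)$, then $S_{\mu_Q}\subset B_R$.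
   Context: $U^\sigma(x)=\int|x-t|^{-s}d\sigma(t)$, $I(\sigma)=\iint|x-t|^{-s}d\sigma d\sigma$. The equilibrium measure $\mu_Q$ is the probability measure on $\mathbb{R}^d$ minimizing $I(\sigma)+2\int Q\,d\sigma$ over probability measures on $\mathbb{R}^d$; $S_\mu$ is the support. The signed equilibrium measure $\eta_{Q,\mathbb{R}^d}$ is the finite signed measure of finite $s$-energy on $\mathbb{R}^d$ with total mass $1$ such that $U^{\eta_{Q,\mathbb{R}^d}}+Q$ equals a finite constant quasi-everywhere on $\mathbb{R}^d$.
   Formalization: The formal theorem assumes s > 0, which excludes only d = 2, s = 0; there the kernel |x-t|^{-s} and the field Q are constant, so every probability measure is a minimizer and "the equilibrium measure" is undefined. *)

theory Defs
  imports "HOL-Probability.Probability"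
begin

definition riesz_kernel :: "real \<Rightarrow> 'a::metric_space \<Rightarrow> 'a \<Rightarrow> ennreal" where
  "riesz_kernel s x t = (if x = t then top else ennreal (dist x t powr (-s)))"

definition riesz_potential :: "real \<Rightarrow> 'a::metric_space measure \<Rightarrow> 'a \<Rightarrow> ennreal" where
  "riesz_potential s \<sigma> x = (\<integral>\<^sup>+ t. riesz_kernel s x t \<partial>\<sigma>)"

definition riesz_energy :: "real \<Rightarrow> 'a::metric_space measure \<Rightarrow> ennreal" where
  "riesz_energy s \<sigma> = (\<integral>\<^sup>+ x. (\<integral>\<^sup>+ t. riesz_kernel s x t \<partial>\<sigma>) \<partial>\<sigma>)"

definition borel_prob :: "'a::topological_space measure \<Rightarrow> bool" where
  "borel_prob \<sigma> \<longleftrightarrow> prob_space \<sigma> \<and> sets \<sigma> = sets borel"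

definition weighted_energy :: "real \<Rightarrow> ('a::metric_space \<Rightarrow> real) \<Rightarrow> 'a measure \<Rightarrow> ereal" where
  "weighted_energy s Q \<sigma> = enn2ereal (riesz_energy s \<sigma>) + ereal (2 * (\<integral> x. Q x \<partial>\<sigma>))"

definition riesz_equilibrium :: "real \<Rightarrow> ('a::metric_space \<Rightarrow> real) \<Rightarrow> 'a measure \<Rightarrow> bool" where
  "riesz_equilibrium s Q \<mu> \<longleftrightarrow> borel_prob \<mu> \<and>
     (\<forall>\<sigma>. borel_prob \<sigma> \<longrightarrow> weighted_energy s Q \<mu> \<le> weighted_energy s Q \<sigma>)"

definition msupport :: "'a::metric_space measure \<Rightarrow> 'a set" where
  "msupport \<mu> = {x. \<forall>e>0. emeasure \<mu> (ball x e) > 0}"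

definition cap_zero :: "real \<Rightarrow> 'a::metric_space set \<Rightarrow> bool" where
  "cap_zero s E \<longleftrightarrow> E \<in> sets borel \<and>
     (\<forall>\<sigma>. borel_prob \<sigma> \<and> emeasure \<sigma> E = 1 \<longrightarrow> riesz_energy s \<sigma> = top)"

definition qe_on :: "real \<Rightarrow> 'a::metric_space set \<Rightarrow> ('a \<Rightarrow> bool) \<Rightarrow> bool" where
  "qe_on s A P \<longleftrightarrow> (\<exists>E. cap_zero s E \<and> (\<forall>x\<in>A - E. P x))"

text \<open>The signed measure eta = nu_p - nu_n (nu_p, nu_n finite Borel measures of finite energy)
  is the signed equilibrium measure on the whole space: total mass 1 and
  U^eta + Q equals a finite constant quasi-everywhere.\<close>
definition signed_equilibrium ::
  "real \<Rightarrow> ('a::metric_space \<Rightarrow> real) \<Rightarrow> 'a measure \<Rightarrow> 'a measure \<Rightarrow> bool" where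
  "signed_equilibrium s Q \<nu>p \<nu>n \<longleftrightarrow>
     finite_measure \<nu>p \<and> finite_measure \<nu>n \<and>
     sets \<nu>p = sets borel \<and> sets \<nu>n = sets borel \<and>
     riesz_energy s \<nu>p < top \<and> riesz_energy s \<nu>n < top \<and>
     measure \<nu>p UNIV - measure \<nu>n UNIV = 1 \<and>
     (\<exists>C::real. qe_on s UNIV (\<lambda>x. riesz_potential s \<nu>p x < top \<and> riesz_potential s \<nu>n x < top \<and>
        enn2real (riesz_potential s \<nu>p x) - enn2real (riesz_potential s \<nu>n x) + Q x = C))"

end

(* With K_y(x) = (|x|^2 + y^2)^(-s/2), the probability density k_y proportional to
   y^(d-s) (|x|^2 + y^2)^(-(d - s/2)) satisfies |x|^(-s) * k_y = K_y; writing both factors as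
   superpositions of Gaussians makes this elementary. Hence Q = - U^eta with
   eta = (1 + gamma) k_a - gamma k_b, and the three regimes describe where this density is negative.

   Moving mass of mu along k_y shows that U^mu - U^eta >= F everywhere, with equality mu-almost
   everywhere. Since s >= d - 2, the kernel |x|^(-s) - K_y >= 0, suitably normalised, concentrates at 0
   as y -> 0. So if mu - eta' is bounded below by a positive constant near x, then
   U^mu - U^eta' at x exceeds its k_y-average around x by a definite amount. This excludes support
   where eta is negative, which is (iii), and it yields a minimum principle. For (i), eta is changed by a
   small combination of k_(R/2) and k_R so that it becomes negative on a ball slightly larger than B_R while
   its potential decreases outside that ball and increases inside; the minimum principle then shows that
   there is no contact on the larger ball. In (ii), eta is a probability measure, minimality
   forces I(mu - eta) <= 0, and strict positive definiteness gives mu = eta. *)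

theory Submission
  imports Defs
begin

section \<open>Gaussian representation of the Riesz kernel\<close>

text \<open>k_y is the balayage onto the hyperplane of a unit charge at height y. Outside (ii),
  minimality of mu is tested only against these densities: their potentials are bounded, so all
  energies stay finite. This gives inequalities between averages of potentials, and since K_y
  increases to |x|^(-s) as y -> 0, they pass to every point, without an exceptional set of capacity
  zero. The bound s >= d - 2 enters as a divergence. For |w| >= y the gap |w|^(-s) - K_y(w) is of
  order y^2 |w|^(-s-2), and |w|^(-s-2) fails to be integrable at 0 exactly when s + 2 >= d. So the
  mass of the gap near 0 outweighs every multiple of y^2, while charge at a fixed distance
  contributes only O(y^2). The obstacle in (i) is the boundary: B_R is closed, but the density of
  eta vanishes on |x| = R, so its negativity alone excludes only the open ball. The two-bubble
  barrier is there for the sphere. Potentials live in \<open>ennreal\<close>, where subtraction is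
  truncated; comparisons are therefore stated with sums, or through real-valued versions of bounded
  potentials.\<close>

definition gamma_weight :: "real \<Rightarrow> real \<Rightarrow> real" where
  "gamma_weight p u = (if 0 < u then u powr (p - 1) else 0)"

lemma gamma_weight_nonneg [simp]: "0 \<le> gamma_weight p u"
  by (simp add: gamma_weight_def)

lemma gamma_weight_measurable [measurable]: "gamma_weight p \<in> borel_measurable borel"
  unfolding gamma_weight_def by measurable

text \<open>Euler's integral after the substitution t = r * u. It turns negative powers into
  mixtures of exponentials. The weight is cut off at 0 so that all integrals run over the whole
  line, where affine substitution and Tonelli apply directly.\<close>

lemma nn_integral_gamma_weight_exp:
  assumes "0 < p" "0 < r"
  shows "(\<integral>\<^sup>+u. ennreal (gamma_weight p u * exp (- (u * r))) \<partial>lborel) = ennreal (Gamma p * r powr (- p))"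
proof -
  have *: "((\<lambda>t. if t \<in> {0..} then t powr (p - 1) / exp t else 0) has_integral Gamma p) UNIV"
    using Gamma_integral_real[OF assms(1)] unfolding has_integral_restrict_UNIV .
  have "((\<lambda>t. gamma_weight p t * exp (- t)) has_integral Gamma p) UNIV"
    by (rule has_integral_spike_finite[OF _ _ *, of "{0}"])
       (auto simp: gamma_weight_def exp_minus field_simps)
  then have G: "(\<integral>\<^sup>+t. ennreal (gamma_weight p t * exp (- t)) \<partial>lborel) = ennreal (Gamma p)"
    by (intro nn_integral_has_integral_lborel) auto
  have "(\<integral>\<^sup>+t. ennreal (gamma_weight p t * exp (- t)) \<partial>lborel)
      = ennreal r * (\<integral>\<^sup>+u. ennreal (gamma_weight p (r * u) * exp (- (r * u))) \<partial>lborel)"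
    using assms by (subst nn_integral_real_affine[of _ r 0]) auto
  also have "\<dots> = ennreal r * (\<integral>\<^sup>+u. ennreal (r powr (p - 1)) * ennreal (gamma_weight p u * exp (- (u * r))) \<partial>lborel)"
    using assms by (intro arg_cong2[where f="(*)"] nn_integral_cong refl)
      (auto simp: gamma_weight_def powr_mult ennreal_mult[symmetric] zero_less_mult_iff mult_ac)
  also have "\<dots> = ennreal (r powr p) * (\<integral>\<^sup>+u. ennreal (gamma_weight p u * exp (- (u * r))) \<partial>lborel)"
    using assms by (subst nn_integral_cmult)
      (auto simp: mult.assoc[symmetric] ennreal_mult[symmetric] powr_mult_base)
  finally have "ennreal (r powr p) * (\<integral>\<^sup>+u. ennreal (gamma_weight p u * exp (- (u * r))) \<partial>lborel) = ennreal (Gamma p)"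
    using G by simp
  then have "ennreal (r powr (-p)) * (ennreal (r powr p) * (\<integral>\<^sup>+u. ennreal (gamma_weight p u * exp (- (u * r))) \<partial>lborel))
     = ennreal (r powr (-p)) * ennreal (Gamma p)" by simp
  then show ?thesis
    using assms by (simp add: mult.assoc[symmetric] ennreal_mult[symmetric] powr_add[symmetric] mult.commute)
qed

lemma nn_integral_gaussian:
  fixes c :: "'a::euclidean_space"
  assumes "0 < t"
  shows "(\<integral>\<^sup>+x. ennreal (exp (- (t * (norm (x - c))\<^sup>2))) \<partial>lborel) = ennreal ((pi / t) powr (DIM('a) / 2))"
proof -
  have 1: "(\<integral>\<^sup>+x. ennreal (exp (- (t * (x - m)\<^sup>2))) \<partial>lborel) = ennreal (sqrt (pi / t))" for m :: real
  proof -
    \<comment> \<open>With this deviation the normal density is a constant multiple of the Gaussian,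
      and its total mass 1 evaluates the integral in dimension one.\<close>
    define \<sigma> where "\<sigma> = sqrt (1 / (2 * t))"
    have s: "0 < \<sigma>" "\<sigma>\<^sup>2 = 1 / (2 * t)" using assms by (auto simp: \<sigma>_def)
    have e: "exp (- (t * (x - m)\<^sup>2)) = sqrt (pi / t) * normal_density m \<sigma> x" for x
      using assms by (simp add: normal_density_def s)
    interpret prob_space "density lborel (normal_density m \<sigma>)" using s(1) by (rule prob_space_normal_density)
    have "(\<integral>\<^sup>+x. ennreal (normal_density m \<sigma> x) \<partial>lborel) = 1"
      using emeasure_space_1 by (simp add: emeasure_density)
    then show ?thesis unfolding e using assms
      by (simp add: ennreal_mult' nn_integral_cmult)
  qed
  have "(norm y)\<^sup>2 = (\<Sum>b\<in>Basis. (y \<bullet> b)\<^sup>2)" for y :: 'a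
    unfolding power2_norm_eq_inner euclidean_inner[of y y] by (simp only: power2_eq_square)
  then have "t * (norm (x - c))\<^sup>2 = (\<Sum>b\<in>Basis. t * (x \<bullet> b - c \<bullet> b)\<^sup>2)" for x :: 'a
    by (simp only: sum_distrib_left inner_diff_left)
  then have e: "exp (- (t * (norm (x - c))\<^sup>2)) = (\<Prod>b\<in>Basis. exp (- (t * (x \<bullet> b - c \<bullet> b)\<^sup>2)))" for x :: 'a
    by (simp add: exp_sum[OF finite_Basis, symmetric] sum_negf)
  have "(\<integral>\<^sup>+x. ennreal (exp (- (t * (norm (x - c))\<^sup>2))) \<partial>lborel)
     = (\<integral>\<^sup>+x. (\<Prod>b\<in>(Basis::'a set). ennreal (exp (- (t * (x \<bullet> b - c \<bullet> b)\<^sup>2)))) \<partial>lborel)"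
    unfolding e by (simp add: prod_ennreal)
  also have "\<dots> = (\<Prod>b\<in>(Basis::'a set). ennreal (sqrt (pi / t)))"
    by (subst nn_integral_lborel_prod[where f="\<lambda>b x. ennreal (exp (- (t * (x - c \<bullet> b)\<^sup>2)))"]) (auto simp: 1)
  also have "\<dots> = ennreal (sqrt (pi / t) ^ DIM('a))"
    using assms by (simp add: ennreal_power)
  also have "sqrt (pi / t) ^ DIM('a) = (pi / t) powr (DIM('a) / 2)"
    using assms by (simp add: powr_half_sqrt[symmetric] powr_powr powr_power)
  finally show ?thesis .
qed

text \<open>Completing the square in z: the product is a Gaussian in z around a weighted mean of 0
  and x, times a Gaussian in x alone. Integrating out z is then immediate.\<close>

lemma gaussian_mult:
  fixes x z :: "'a::real_inner"
  assumes "0 < u" "0 < v"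
  shows "exp (- (v * (norm (x - z))\<^sup>2)) * exp (- (u * (norm z)\<^sup>2))
    = exp (- (u * v / (u + v) * (norm x)\<^sup>2)) * exp (- ((u + v) * (norm (z - (v / (u + v)) *\<^sub>R x))\<^sup>2))"
proof -
  define k where "k = v / (u + v)"
  have k: "(u + v) * k = v" "u * v / (u + v) = u * k" using assms by (auto simp: k_def)
  have 1: "(norm (x - z))\<^sup>2 = (norm x)\<^sup>2 - 2 * (x \<bullet> z) + (norm z)\<^sup>2"
    "(norm (z - k *\<^sub>R x))\<^sup>2 = (norm z)\<^sup>2 - 2 * k * (x \<bullet> z) + k\<^sup>2 * (norm x)\<^sup>2"
    unfolding power2_norm_eq_inner by (simp_all add: inner_diff_left inner_diff_right inner_commute power2_eq_square)
  have "(u + v) * (norm (z - k *\<^sub>R x))\<^sup>2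
      = (u + v) * (norm z)\<^sup>2 - 2 * ((u + v) * k) * (x \<bullet> z) + ((u + v) * k) * k * (norm x)\<^sup>2"
    unfolding 1 by (simp add: algebra_simps power2_eq_square)
  also have "\<dots> = (u + v) * (norm z)\<^sup>2 - 2 * v * (x \<bullet> z) + v * k * (norm x)\<^sup>2" by (simp only: k)
  finally have 2: "(u + v) * (norm (z - k *\<^sub>R x))\<^sup>2 = (u + v) * (norm z)\<^sup>2 - 2 * v * (x \<bullet> z) + v * k * (norm x)\<^sup>2" .
  have "u * k * (norm x)\<^sup>2 + v * k * (norm x)\<^sup>2 = ((u + v) * k) * (norm x)\<^sup>2" by (simp add: algebra_simps)
  also have "\<dots> = v * (norm x)\<^sup>2" by (simp only: k)
  finally have "v * (norm (x - z))\<^sup>2 + u * (norm z)\<^sup>2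
     = u * v / (u + v) * (norm x)\<^sup>2 + (u + v) * (norm (z - (v / (u + v)) *\<^sub>R x))\<^sup>2"
    unfolding k_def[symmetric] k(2) 1(1) 2 by (simp add: algebra_simps)
  then show ?thesis by (simp add: exp_add[symmetric])
qed

lemma nn_integral_gaussian_mult:
  fixes x :: "'a::euclidean_space"
  assumes "0 < u" "0 < v"
  shows "(\<integral>\<^sup>+z. ennreal (exp (- (v * (norm (x - z))\<^sup>2)) * exp (- (u * (norm z)\<^sup>2))) \<partial>lborel)
    = ennreal ((pi / (u + v)) powr (DIM('a) / 2) * exp (- (u * v / (u + v) * (norm x)\<^sup>2)))"
  unfolding gaussian_mult[OF assms] using assms
  by (simp add: ennreal_mult' nn_integral_cmult nn_integral_gaussian mult.commute)

lemma riesz_kernel_eq: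
  "x \<noteq> t \<Longrightarrow> riesz_kernel s x t = ennreal (norm (x - t) powr (- s))"
  for x t :: "'a::real_normed_vector"
  by (simp add: riesz_kernel_def dist_norm)

lemma riesz_kernel_commute: "riesz_kernel s x t = riesz_kernel s t x"
  by (simp add: riesz_kernel_def dist_commute)

lemma riesz_kernel_measurable [measurable]:
  assumes [measurable]: "f \<in> borel_measurable M" "g \<in> borel_measurable M"
  shows "(\<lambda>w. riesz_kernel s (f w) (g w :: 'a::euclidean_space)) \<in> borel_measurable M"
  unfolding riesz_kernel_def by measurable

text \<open>Off the diagonal this is Euler's integral with r = |x - t|^2. On the diagonal the
  integral of v^(s/2 - 1) over the half line diverges, which matches the value \<open>top\<close>;
  so Tonelli can be used later without setting the diagonal aside.\<close>

lemma riesz_kernel_gaussian: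
  fixes x t :: "'a::real_normed_vector"
  assumes "0 < s"
  shows "ennreal (Gamma (s / 2)) * riesz_kernel s x t
    = (\<integral>\<^sup>+v. ennreal (gamma_weight (s / 2) v * exp (- (v * (norm (x - t))\<^sup>2))) \<partial>lborel)"
proof (cases "x = t")
  case False
  have "((norm (x - t))\<^sup>2) powr (- (s / 2)) = norm (x - t) powr (- s)"
    using False powr_powr[of "norm (x - t)" 2 "- (s / 2)"] by simp
  then show ?thesis using assms False
    by (simp add: nn_integral_gamma_weight_exp riesz_kernel_eq ennreal_mult[symmetric] less_imp_le[OF Gamma_real_pos])
next
  case True
  have G: "0 < Gamma (s / 2)" using assms by simp
  let ?I = "\<integral>\<^sup>+v. ennreal (gamma_weight (s / 2) v) \<partial>lborel"
  have le: "gamma_weight (s / 2) v * exp (- (v * r)) \<le> gamma_weight (s / 2) v" if "r > 0" for v r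
    using that by (cases "0 < v") (auto simp: gamma_weight_def intro!: mult_left_le)
  have *: "ennreal (Gamma (s / 2) * r powr (- (s / 2))) \<le> ?I" if "r > 0" for r
    using that assms by (subst nn_integral_gamma_weight_exp[symmetric]) (auto intro!: nn_integral_mono ennreal_leI le)
  have "of_nat n \<le> ?I" for n
  proof (cases "n = 0")
    case False
    \<comment> \<open>The lower bound Gamma(s/2) * r^(-s/2) holds for every r > 0; this r solves the
      equation that makes it equal to n.\<close>
    have "Gamma (s / 2) * ((real n / Gamma (s / 2)) powr (-2 / s)) powr (- (s / 2)) = real n"
      using False assms G less_imp_neq[OF G] by (simp add: powr_powr)
    moreover have "(real n / Gamma (s / 2)) powr (-2 / s) > 0" using False G by simp
    ultimately show ?thesis
      using *[of "(real n / Gamma (s / 2)) powr (-2 / s)"] by (simp add: ennreal_of_nat_eq_real_of_nat)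
  qed simp
  then have "?I = top"
    using ennreal_Ex_less_of_nat[of ?I] by (metis leD less_top)
  with True G show ?thesis by (simp add: riesz_kernel_def ennreal_mult_top)
qed

section \<open>Potentials of bubbles\<close>

lemma nn_integral_swap:
  assumes "sigma_finite_measure M" "sigma_finite_measure N" "case_prod f \<in> borel_measurable (M \<Otimes>\<^sub>M N)"
  shows "(\<integral>\<^sup>+x. (\<integral>\<^sup>+y. f x y \<partial>N) \<partial>M) = (\<integral>\<^sup>+y. (\<integral>\<^sup>+x. f x y \<partial>M) \<partial>N)"
proof -
  interpret pair_sigma_finite M N using assms by (simp add: pair_sigma_finite_def)
  show ?thesis using Fubini'[OF assms(3)] by simp
qed

text \<open>The Riesz kernel of the space with one more dimension between (x, 0) and (0, y): the
  field of a unit charge at height y above the origin.\<close>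

definition lifted_kernel :: "real \<Rightarrow> real \<Rightarrow> 'a::real_normed_vector \<Rightarrow> real" where
  "lifted_kernel s y x = ((norm x)\<^sup>2 + y\<^sup>2) powr (- s / 2)"

text \<open>The balayage of a unit charge at height y onto the hyperplane; for s = d - 1 it is the
  Poisson kernel of the half space. The constant makes the total mass 1 when 0 < s < d.\<close>

definition bubble :: "real \<Rightarrow> real \<Rightarrow> 'a::euclidean_space \<Rightarrow> real" where
  "bubble s y z = Gamma (real DIM('a) - s / 2) / (pi powr (real DIM('a) / 2) * Gamma ((real DIM('a) - s) / 2))
     * y powr (real DIM('a) - s) * ((norm z)\<^sup>2 + y\<^sup>2) powr (- (real DIM('a) - s / 2))"

lemma lifted_kernel_measurable [measurable]: "lifted_kernel s y \<in> borel_measurable borel"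
  unfolding lifted_kernel_def by measurable

lemma bubble_measurable [measurable]: "bubble s y \<in> borel_measurable borel"
  unfolding bubble_def by measurable

lemma lifted_kernel_minus [simp]: "lifted_kernel s y (- x) = lifted_kernel s y x"
  by (simp add: lifted_kernel_def)

lemma lifted_kernel_nonneg [simp]: "0 \<le> lifted_kernel s y x"
  by (simp add: lifted_kernel_def)

text \<open>The Gamma factor on the left lets the power be written as a mixture of Gaussians.
  Integrating z first leaves an Euler integral with parameter (d - s)/2, which converges because s <
  d.\<close>

lemma nn_integral_Gamma_powr:
  fixes c :: "'a::euclidean_space"
  assumes "0 < s" "s < real DIM('a)" "0 < y"
  shows "ennreal (Gamma (real DIM('a) - s / 2)) * (\<integral>\<^sup>+z. ennreal (((norm (z - c))\<^sup>2 + y\<^sup>2) powr (- (real DIM('a) - s / 2))) \<partial>lborel)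
    = ennreal (pi powr (real DIM('a) / 2) * Gamma ((real DIM('a) - s) / 2) * y powr (- (real DIM('a) - s)))"
proof -
  define d where "d = real DIM('a)"
  define p where "p = d - s / 2"
  have p: "0 < p" using assms by (simp add: p_def d_def)
  have pos: "0 < (norm (z - c))\<^sup>2 + y\<^sup>2" for z using assms by (simp add: add_nonneg_pos)
  have "ennreal (Gamma p) * (\<integral>\<^sup>+z. ennreal (((norm (z - c))\<^sup>2 + y\<^sup>2) powr (- p)) \<partial>lborel)
    = (\<integral>\<^sup>+z. (\<integral>\<^sup>+u. ennreal (gamma_weight p u * exp (- (u * ((norm (z - c))\<^sup>2 + y\<^sup>2)))) \<partial>lborel) \<partial>lborel)"
    using p by (simp add: nn_integral_cmult[symmetric] nn_integral_gamma_weight_exp[OF p pos] ennreal_mult[symmetric])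
  also have "\<dots> = (\<integral>\<^sup>+u. (\<integral>\<^sup>+z. ennreal (gamma_weight p u * exp (- (u * ((norm (z - c))\<^sup>2 + y\<^sup>2)))) \<partial>lborel) \<partial>lborel)"
    by (rule nn_integral_swap) (auto intro: lborel.sigma_finite_measure_axioms)
  also have "\<dots> = (\<integral>\<^sup>+u. ennreal (pi powr (d / 2)) * ennreal (gamma_weight (p - d / 2) u * exp (- (u * y\<^sup>2))) \<partial>lborel)"
  proof (rule nn_integral_cong)
    fix u :: real
    show "(\<integral>\<^sup>+z. ennreal (gamma_weight p u * exp (- (u * ((norm (z - c))\<^sup>2 + y\<^sup>2)))) \<partial>lborel)
      = ennreal (pi powr (d / 2)) * ennreal (gamma_weight (p - d / 2) u * exp (- (u * y\<^sup>2)))"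
    proof (cases "0 < u")
      case True
      have "(\<integral>\<^sup>+z. ennreal (gamma_weight p u * exp (- (u * ((norm (z - c))\<^sup>2 + y\<^sup>2)))) \<partial>lborel)
        = (\<integral>\<^sup>+z. ennreal (gamma_weight p u * exp (- (u * y\<^sup>2))) * ennreal (exp (- (u * (norm (z - c))\<^sup>2))) \<partial>lborel)"
        by (intro nn_integral_cong) (simp add: ennreal_mult[symmetric] exp_add[symmetric] algebra_simps)
      also have "\<dots> = ennreal (gamma_weight p u * exp (- (u * y\<^sup>2))) * ennreal ((pi / u) powr (d / 2))"
        using True by (simp add: nn_integral_cmult nn_integral_gaussian d_def)
      also have "\<dots> = ennreal (pi powr (d / 2)) * ennreal (gamma_weight (p - d / 2) u * exp (- (u * y\<^sup>2)))"
        using True by (simp add: ennreal_mult[symmetric] gamma_weight_def powr_divide powr_diff mult_ac)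
      finally show ?thesis .
    qed (simp add: gamma_weight_def)
  qed
  also have "\<dots> = ennreal (pi powr (d / 2)) * ennreal (Gamma (p - d / 2) * (y\<^sup>2) powr (- (p - d / 2)))"
    using assms by (subst nn_integral_cmult) (auto simp: nn_integral_gamma_weight_exp p_def d_def)
  also have "p - d / 2 = (d - s) / 2" by (simp add: p_def field_simps)
  also have "(y\<^sup>2) powr (- ((d - s) / 2)) = y powr (- (d - s))"
  proof -
    have "2 * - ((d - s) / 2) = - (d - s)" by (simp add: field_simps)
    with assms show ?thesis using powr_powr[of y 2 "- ((d - s) / 2)"] by simp
  qed
  finally show ?thesis using assms unfolding p_def d_def
    by (simp add: ennreal_mult[symmetric] mult_ac)
qed

lemma nn_integral_bubble:
  fixes c :: "'a::euclidean_space"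
  assumes "0 < s" "s < real DIM('a)" "0 < y"
  shows "(\<integral>\<^sup>+z. ennreal (bubble s y (z - c)) \<partial>lborel) = 1"
proof -
  define p where "p = real DIM('a) - s / 2"
  define k where "k = pi powr (real DIM('a) / 2) * Gamma ((real DIM('a) - s) / 2)"
  define Y where "Y = y powr (real DIM('a) - s)"
  have pos: "0 < p" "0 < k" "0 < Y" "0 < Gamma p" using assms by (auto simp: p_def k_def Y_def)
  have "(\<integral>\<^sup>+z. ennreal (bubble s y (z - c)) \<partial>lborel)
    = ennreal (Y / k) * (ennreal (Gamma p) * (\<integral>\<^sup>+z. ennreal (((norm (z - c))\<^sup>2 + y\<^sup>2) powr (- p)) \<partial>lborel))"
    using pos by (simp add: nn_integral_cmult[symmetric] ennreal_mult[symmetric] bubble_def p_def[symmetric] k_def[symmetric] Y_def[symmetric] mult_ac)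
  also have "\<dots> = ennreal (Y / k) * ennreal (k * y powr (- (real DIM('a) - s)))"
    unfolding p_def k_def using assms by (subst nn_integral_Gamma_powr) auto
  also have "\<dots> = 1"
    using pos assms by (simp add: ennreal_mult[symmetric] Y_def powr_minus field_simps powr_diff)
  finally show ?thesis .
qed

text \<open>The effect of replacing u by k * u. It serves to absorb the denominator 1 + w in the
  convolution of the Riesz kernel with a bubble.\<close>

lemma nn_integral_gamma_weight_scaled:
  assumes "0 < p" "0 < k" "0 < r"
  shows "(\<integral>\<^sup>+u. ennreal (k powr (- p)) * ennreal (gamma_weight p u * exp (- (u * (r / k)))) \<partial>lborel)
    = (\<integral>\<^sup>+u. ennreal (gamma_weight p u * exp (- (u * r))) \<partial>lborel)"
proof -
  have "0 < r / k" using assms by simp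
  then have "(\<integral>\<^sup>+u. ennreal (k powr (- p)) * ennreal (gamma_weight p u * exp (- (u * (r / k)))) \<partial>lborel)
     = ennreal (k powr (- p)) * ennreal (Gamma p * (r / k) powr (- p))"
    using assms by (subst nn_integral_cmult) (auto simp only: nn_integral_gamma_weight_exp, auto)
  also have "k powr (- p) * (Gamma p * (r / k) powr (- p)) = Gamma p * r powr (- p)"
    using assms by (simp add: powr_divide powr_minus field_simps)
  then have "ennreal (k powr (- p)) * ennreal (Gamma p * (r / k) powr (- p)) = ennreal (Gamma p * r powr (- p))"
    using assms by (simp add: ennreal_mult[symmetric])
  finally show ?thesis using assms by (simp add: nn_integral_gamma_weight_exp)
qed

text \<open>The kernel is a mixture of Gaussians over v, the power one over u. Integrating out z and
  substituting v = u * w makes the exponent linear in u; rescaling u by 1 + w turns it into u * (y^2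
  + w * A) with A = |x|^2 + y^2. Then the w-integral produces the power of A, that is K_y(x), and
  the u-integral the power of y.\<close>

lemma nn_integral_riesz_kernel_powr:
  fixes x :: "'a::euclidean_space"
  assumes s: "0 < s" "s < real DIM('a)" and y: "0 < y"
  shows "ennreal (Gamma (s / 2)) * (ennreal (Gamma (real DIM('a) - s / 2)) *
      (\<integral>\<^sup>+z. riesz_kernel s x z * ennreal (((norm z)\<^sup>2 + y\<^sup>2) powr (- (real DIM('a) - s / 2))) \<partial>lborel))
    = ennreal (pi powr (real DIM('a) / 2) * Gamma (s / 2) * Gamma ((real DIM('a) - s) / 2)
        * y powr (- (real DIM('a) - s)) * lifted_kernel s y x)"
proof -
  define d where "d = real DIM('a)"
  define p where "p = d - s / 2"
  define A where "A = (norm x)\<^sup>2 + y\<^sup>2"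
  have d: "0 < d" "0 < p" "0 < s / 2" "0 < d / 2" "0 < (d - s) / 2" using s by (auto simp: p_def d_def)
  have pos: "0 < (norm z)\<^sup>2 + y\<^sup>2" for z :: 'a using y by (simp add: add_nonneg_pos)
  then have A: "0 < A" by (simp add: A_def)
  note sf = lborel.sigma_finite_measure_axioms
  let ?g = "\<lambda>v u z. ennreal (gamma_weight (s / 2) v * gamma_weight p u * exp (- (u * y\<^sup>2)))
      * ennreal (exp (- (v * (norm (x - z))\<^sup>2)) * exp (- (u * (norm z)\<^sup>2)))"
  let ?h = "\<lambda>w u. ennreal (pi powr (d / 2) * gamma_weight (s / 2) w) *
      (ennreal ((1 + w) powr (- (d / 2))) * ennreal (gamma_weight (d / 2) u * exp (- (u * ((y\<^sup>2 + w * A) / (1 + w))))))"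
  let ?k = "\<lambda>w u. ennreal (pi powr (d / 2) * gamma_weight (s / 2) w) *
      ennreal (gamma_weight (d / 2) u * exp (- (u * (y\<^sup>2 + w * A))))"
  have "ennreal (Gamma (s / 2)) * (ennreal (Gamma p) *
      (\<integral>\<^sup>+z. riesz_kernel s x z * ennreal (((norm z)\<^sup>2 + y\<^sup>2) powr (- p)) \<partial>lborel))
    = (\<integral>\<^sup>+z. (ennreal (Gamma (s / 2)) * riesz_kernel s x z) * ennreal (Gamma p * ((norm z)\<^sup>2 + y\<^sup>2) powr (- p)) \<partial>lborel)"
    using d by (simp add: nn_integral_cmult[symmetric] ennreal_mult mult_ac)
  also have "\<dots> = (\<integral>\<^sup>+z. (\<integral>\<^sup>+v. (\<integral>\<^sup>+u. ?g v u z \<partial>lborel) \<partial>lborel) \<partial>lborel)"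
  proof (rule nn_integral_cong)
    fix z :: 'a
    have "ennreal (Gamma (s / 2)) * riesz_kernel s x z * ennreal (Gamma p * ((norm z)\<^sup>2 + y\<^sup>2) powr (- p))
      = (\<integral>\<^sup>+v. ennreal (gamma_weight (s / 2) v * exp (- (v * (norm (x - z))\<^sup>2))) \<partial>lborel)
       * (\<integral>\<^sup>+u. ennreal (gamma_weight p u * exp (- (u * ((norm z)\<^sup>2 + y\<^sup>2)))) \<partial>lborel)"
      by (simp only: riesz_kernel_gaussian[OF s(1)] nn_integral_gamma_weight_exp[OF d(2) pos])
    also have "\<dots> = (\<integral>\<^sup>+v. (\<integral>\<^sup>+u. ennreal (gamma_weight (s / 2) v * exp (- (v * (norm (x - z))\<^sup>2)))
        * ennreal (gamma_weight p u * exp (- (u * ((norm z)\<^sup>2 + y\<^sup>2)))) \<partial>lborel) \<partial>lborel)"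
      by (subst nn_integral_cmult, simp, subst nn_integral_multc) auto
    also have "\<dots> = (\<integral>\<^sup>+v. (\<integral>\<^sup>+u. ?g v u z \<partial>lborel) \<partial>lborel)"
      by (intro nn_integral_cong) (simp add: ennreal_mult[symmetric] distrib_left exp_add[symmetric] mult_ac add_ac)
    finally show "ennreal (Gamma (s / 2)) * riesz_kernel s x z * ennreal (Gamma p * ((norm z)\<^sup>2 + y\<^sup>2) powr (- p))
      = (\<integral>\<^sup>+v. (\<integral>\<^sup>+u. ?g v u z \<partial>lborel) \<partial>lborel)" .
  qed
  also have "\<dots> = (\<integral>\<^sup>+v. (\<integral>\<^sup>+z. (\<integral>\<^sup>+u. ?g v u z \<partial>lborel) \<partial>lborel) \<partial>lborel)"
    by (rule nn_integral_swap[OF sf sf]) measurable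
  also have "\<dots> = (\<integral>\<^sup>+v. (\<integral>\<^sup>+u. (\<integral>\<^sup>+z. ?g v u z \<partial>lborel) \<partial>lborel) \<partial>lborel)"
    by (intro nn_integral_cong nn_integral_swap[OF sf sf]) measurable
  also have "\<dots> = (\<integral>\<^sup>+u. (\<integral>\<^sup>+v. (\<integral>\<^sup>+z. ?g v u z \<partial>lborel) \<partial>lborel) \<partial>lborel)"
    by (rule nn_integral_swap[OF sf sf]) measurable
  also have "\<dots> = (\<integral>\<^sup>+u. (\<integral>\<^sup>+w. ?h w u \<partial>lborel) \<partial>lborel)"
  proof (rule nn_integral_cong)
    fix u :: real
    show "(\<integral>\<^sup>+v. (\<integral>\<^sup>+z. ?g v u z \<partial>lborel) \<partial>lborel) = (\<integral>\<^sup>+w. ?h w u \<partial>lborel)"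
    proof (cases "0 < u")
      case u: True
      have "(\<integral>\<^sup>+v. (\<integral>\<^sup>+z. ?g v u z \<partial>lborel) \<partial>lborel)
         = ennreal u * (\<integral>\<^sup>+w. (\<integral>\<^sup>+z. ?g (u * w) u z \<partial>lborel) \<partial>lborel)"
        using u by (subst nn_integral_real_affine[of _ u 0]) auto
      also have "\<dots> = (\<integral>\<^sup>+w. ennreal u * (\<integral>\<^sup>+z. ?g (u * w) u z \<partial>lborel) \<partial>lborel)"
        by (rule nn_integral_cmult[symmetric]) measurable
      also have "\<dots> = (\<integral>\<^sup>+w. ?h w u \<partial>lborel)"
      proof (rule nn_integral_cong)
        fix w :: real
        show "ennreal u * (\<integral>\<^sup>+z. ?g (u * w) u z \<partial>lborel) = ?h w u"
        proof (cases "0 < w")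
          case w: True
          have uw: "0 < u * w" using u w by simp
          have e: "exp (- (u * y\<^sup>2)) * exp (- (u * (u * w) / (u + u * w) * (norm x)\<^sup>2))
              = exp (- (u * ((y\<^sup>2 + w * A) / (1 + w))))"
          proof -
            have "u + u * w = u * (1 + w)" by (simp add: algebra_simps)
            then have "u * (u * w) / (u + u * w) = u * w / (1 + w)" using u w by simp
            moreover have "u * y\<^sup>2 + u * w / (1 + w) * (norm x)\<^sup>2 = u * ((y\<^sup>2 + w * A) / (1 + w))"
              using w by (simp add: A_def field_simps)
            ultimately show ?thesis by (simp add: exp_add[symmetric])
          qed
          have q: "u * (gamma_weight (s / 2) (u * w) * gamma_weight p u * (pi / (u + u * w)) powr (d / 2))
             = pi powr (d / 2) * gamma_weight (s / 2) w * ((1 + w) powr (- (d / 2)) * gamma_weight (d / 2) u)"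
          proof -
            have "u + u * w = u * (1 + w)" by (simp add: algebra_simps)
            then have 1: "(pi / (u + u * w)) powr (d / 2) = pi powr (d / 2) * (u powr (- (d / 2)) * (1 + w) powr (- (d / 2)))"
              using u w by (simp add: powr_divide powr_mult powr_minus divide_simps)
            \<comment> \<open>This is where the exponent p = d - s/2 of the bubble matters: the
              powers of u combine to d/2 - 1, for which rescaling u by 1 + w absorbs exactly the
              factor (1 + w)^(-d/2).\<close>
            have 2: "u * (u powr (s / 2 - 1) * u powr (p - 1) * u powr (- (d / 2))) = u powr (d / 2 - 1)"
            proof -
              have "u * (u powr (s / 2 - 1) * u powr (p - 1) * u powr (- (d / 2)))
                = u powr (1 + (s / 2 - 1) + (p - 1) + - (d / 2))" unfolding powr_add using u by simp
              also have "1 + (s / 2 - 1) + (p - 1) + - (d / 2) = d / 2 - 1" by (simp add: p_def)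
              finally show ?thesis .
            qed
            have "u * (gamma_weight (s / 2) (u * w) * gamma_weight p u * (pi / (u + u * w)) powr (d / 2))
              = (u * (u powr (s / 2 - 1) * u powr (p - 1) * u powr (- (d / 2)))) * pi powr (d / 2) * w powr (s / 2 - 1) * (1 + w) powr (- (d / 2))"
              unfolding 1 using u w uw by (simp add: gamma_weight_def powr_mult)
            then show ?thesis unfolding 2 using u w by (simp add: gamma_weight_def)
          qed
          have "ennreal u * (\<integral>\<^sup>+z. ?g (u * w) u z \<partial>lborel)
            = ennreal u * (ennreal (gamma_weight (s / 2) (u * w) * gamma_weight p u * exp (- (u * y\<^sup>2)))
               * ennreal ((pi / (u + u * w)) powr (d / 2) * exp (- (u * (u * w) / (u + u * w) * (norm x)\<^sup>2))))"
            using u uw by (subst nn_integral_cmult) (auto simp: nn_integral_gaussian_mult[OF u uw] d_def)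
          also have "\<dots> = ennreal ((u * (gamma_weight (s / 2) (u * w) * gamma_weight p u * (pi / (u + u * w)) powr (d / 2)))
              * (exp (- (u * y\<^sup>2)) * exp (- (u * (u * w) / (u + u * w) * (norm x)\<^sup>2))))"
            using u w by (simp add: ennreal_mult[symmetric] mult_ac)
          also have "\<dots> = ?h w u"
            unfolding q e using u w by (simp add: ennreal_mult[symmetric] mult_ac)
          finally show ?thesis .
        next
          case False
          then have "\<not> 0 < u * w" using u by (simp add: zero_less_mult_iff)
          with False show ?thesis by (simp add: gamma_weight_def)
        qed
      qed
      finally show ?thesis .
    next
      case False
      then have "gamma_weight p u = 0" "gamma_weight (d / 2) u = 0" by (auto simp: gamma_weight_def)
      then show ?thesis by simp
    qed
  qed
  also have "\<dots> = (\<integral>\<^sup>+w. (\<integral>\<^sup>+u. ?h w u \<partial>lborel) \<partial>lborel)"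
    by (rule nn_integral_swap[OF sf sf]) measurable
  also have "\<dots> = (\<integral>\<^sup>+w. (\<integral>\<^sup>+u. ?k w u \<partial>lborel) \<partial>lborel)"
  proof (rule nn_integral_cong)
    fix w :: real
    show "(\<integral>\<^sup>+u. ?h w u \<partial>lborel) = (\<integral>\<^sup>+u. ?k w u \<partial>lborel)"
    proof (cases "0 < w")
      case True
      have B: "0 < y\<^sup>2 + w * A" using True A y by (simp add: add_pos_pos)
      have w1: "0 < 1 + w" using True by simp
      show ?thesis
        using nn_integral_gamma_weight_scaled[OF d(4) w1 B] by (simp add: nn_integral_cmult)
    qed (simp add: gamma_weight_def)
  qed
  also have "\<dots> = (\<integral>\<^sup>+u. (\<integral>\<^sup>+w. ?k w u \<partial>lborel) \<partial>lborel)"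
    by (rule nn_integral_swap[OF sf sf]) measurable
  also have "\<dots> = (\<integral>\<^sup>+u. ennreal (pi powr (d / 2) * Gamma (s / 2) * A powr (- s / 2)) *
      ennreal (gamma_weight ((d - s) / 2) u * exp (- (u * y\<^sup>2))) \<partial>lborel)"
  proof (rule nn_integral_cong)
    fix u :: real
    show "(\<integral>\<^sup>+w. ?k w u \<partial>lborel) = ennreal (pi powr (d / 2) * Gamma (s / 2) * A powr (- s / 2)) *
      ennreal (gamma_weight ((d - s) / 2) u * exp (- (u * y\<^sup>2)))"
    proof (cases "0 < u")
      case True
      then have uA: "0 < u * A" using A by simp
      have "(\<integral>\<^sup>+w. ?k w u \<partial>lborel) = (\<integral>\<^sup>+w. ennreal (pi powr (d / 2) * gamma_weight (d / 2) u * exp (- (u * y\<^sup>2)))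
          * ennreal (gamma_weight (s / 2) w * exp (- (w * (u * A)))) \<partial>lborel)"
        by (intro nn_integral_cong) (simp add: ennreal_mult[symmetric] distrib_left exp_add[symmetric] mult_ac)
      also have "\<dots> = ennreal (pi powr (d / 2) * gamma_weight (d / 2) u * exp (- (u * y\<^sup>2)))
          * ennreal (Gamma (s / 2) * (u * A) powr (- (s / 2)))"
        by (subst nn_integral_cmult) (auto simp only: nn_integral_gamma_weight_exp[OF d(3) uA], auto)
      also have "\<dots> = ennreal (pi powr (d / 2) * gamma_weight (d / 2) u * exp (- (u * y\<^sup>2))
          * (Gamma (s / 2) * (u * A) powr (- (s / 2))))"
        using s by (simp add: ennreal_mult[symmetric])
      also have "pi powr (d / 2) * gamma_weight (d / 2) u * exp (- (u * y\<^sup>2))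
          * (Gamma (s / 2) * (u * A) powr (- (s / 2)))
         = (pi powr (d / 2) * Gamma (s / 2) * A powr (- s / 2)) * (gamma_weight ((d - s) / 2) u * exp (- (u * y\<^sup>2)))"
      proof -
        have "u powr (d / 2 - 1) * u powr (- (s / 2)) = u powr ((d - s) / 2 - 1)"
        proof -
          have "d / 2 - 1 + - (s / 2) = (d - s) / 2 - 1" by (simp add: field_simps)
          then show ?thesis by (simp only: powr_add[symmetric])
        qed
        then show ?thesis using True A by (simp add: gamma_weight_def powr_mult)
      qed
      finally show ?thesis using s by (simp add: ennreal_mult)
    qed (simp add: gamma_weight_def)
  qed
  also have "\<dots> = ennreal (pi powr (d / 2) * Gamma (s / 2) * A powr (- s / 2)) *
      ennreal (Gamma ((d - s) / 2) * (y\<^sup>2) powr (- ((d - s) / 2)))"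
    using y d by (simp add: nn_integral_cmult nn_integral_gamma_weight_exp)
  also have "(y\<^sup>2) powr (- ((d - s) / 2)) = y powr (- (d - s))"
  proof -
    have "2 * - ((d - s) / 2) = - (d - s)" by (simp add: field_simps)
    with y show ?thesis using powr_powr[of y 2 "- ((d - s) / 2)"] by simp
  qed
  finally show ?thesis using d
    by (simp add: ennreal_mult[symmetric] p_def d_def A_def lifted_kernel_def mult_ac)
qed

section \<open>Averages of potentials over bubbles\<close>

lemma nn_integral_lborel_translate:
  fixes c :: "'a::euclidean_space"
  assumes [measurable]: "f \<in> borel_measurable borel"
  shows "(\<integral>\<^sup>+z. f (z + c) \<partial>lborel) = (\<integral>\<^sup>+z. f z \<partial>lborel)"
proof -
  have "(\<integral>\<^sup>+z. f z \<partial>lborel) = (\<integral>\<^sup>+z. f z \<partial>distr lborel borel ((+) c))" by (simp add: lborel_distr_plus)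
  also have "\<dots> = (\<integral>\<^sup>+z. f (z + c) \<partial>lborel)" by (subst nn_integral_distr) (auto simp: add.commute)
  finally show ?thesis by simp
qed

lemma nn_integral_lborel_affine:
  fixes t :: "'a::euclidean_space"
  assumes [measurable]: "f \<in> borel_measurable borel" and "c \<noteq> 0"
  shows "(\<integral>\<^sup>+z. f z \<partial>lborel) = ennreal (\<bar>c\<bar> ^ DIM('a)) * (\<integral>\<^sup>+z. f (t + c *\<^sub>R z) \<partial>lborel)"
  using assms(2)
  by (subst lborel_affine[of c t]) (auto simp: nn_integral_density nn_integral_distr nn_integral_cmult)

lemma riesz_kernel_diff:
  fixes x t :: "'a::real_normed_vector"
  shows "riesz_kernel s x t = riesz_kernel s (x - t) 0"
  by (simp add: riesz_kernel_def dist_norm)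

definition bubble_measure :: "real \<Rightarrow> real \<Rightarrow> 'a::euclidean_space \<Rightarrow> 'a measure" where
  "bubble_measure s y c = density lborel (\<lambda>z. ennreal (bubble s y (z - c)))"

text \<open>The potential of the charge at the point of height y above x. By
  \<open>nn_integral_potential_bubble_measure\<close> it is also the average of the potential over
  the bubble centred at x.\<close>

definition lifted_potential :: "real \<Rightarrow> real \<Rightarrow> 'a::real_normed_vector measure \<Rightarrow> 'a \<Rightarrow> ennreal" where
  "lifted_potential s y \<sigma> x = (\<integral>\<^sup>+t. ennreal (lifted_kernel s y (x - t)) \<partial>\<sigma>)"

text \<open>The kernel minus its average over a bubble of height y. By
  \<open>lifted_kernel_le\<close> the truncated subtraction is a true one; at 0 the value is
  \<open>top\<close>.\<close>

definition kernel_gap :: "real \<Rightarrow> real \<Rightarrow> 'a::real_normed_vector \<Rightarrow> ennreal" where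
  "kernel_gap s y w = riesz_kernel s w 0 - ennreal (lifted_kernel s y w)"

lemma kernel_gap_measurable [measurable]:
  "kernel_gap s y \<in> borel_measurable (borel :: 'a::euclidean_space measure)"
  unfolding kernel_gap_def by measurable

lemma sets_bubble_measure [simp, measurable_cong]: "sets (bubble_measure s y c) = sets borel"
  by (simp add: bubble_measure_def)

text \<open>Mean value theorem for (1 + x)^(-a): the derivative has modulus at most a for x >= 0 and
  at least a * 2^(-a-1) for x in [0, 1]. With a = s/2 and q = y^2 / |w|^2 this bounds the gap kernel
  from both sides.\<close>

lemma powr_ineq:
  assumes "0 < (a::real)" "0 < q"
  shows "1 - (1 + q) powr (- a) \<le> a * q"
    and "q \<le> 1 \<Longrightarrow> a * 2 powr (- a - 1) * q \<le> 1 - (1 + q) powr (- a)"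
proof -
  have "\<exists>z>0. z < q \<and> (\<lambda>x. (1 + x) powr (- a)) q - (\<lambda>x. (1 + x) powr (- a)) 0
      = (q - 0) * (- a * (1 + z) powr (- a - 1))"
    using assms by (intro MVT2) (auto intro!: derivative_eq_intros)
  then obtain z where z: "0 < z" "z < q" "1 - (1 + q) powr (- a) = q * a * (1 + z) powr (- a - 1)"
    by auto
  have "(1 + z) powr (- a - 1) \<le> 1 powr (- a - 1)"
    using z assms by (intro powr_mono2') auto
  then show "1 - (1 + q) powr (- a) \<le> a * q"
    using assms z mult_left_le[of "(1 + z) powr (- a - 1)" "q * a"] by (simp add: mult_ac)
  assume "q \<le> 1"
  then have "2 powr (- a - 1) \<le> (1 + z) powr (- a - 1)"
    using z assms by (intro powr_mono2') auto
  then show "a * 2 powr (- a - 1) * q \<le> 1 - (1 + q) powr (- a)"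
    unfolding z(3) using assms by (simp add: mult_ac mult_left_mono)
qed

locale riesz =
  fixes s :: real and T :: "'a::euclidean_space itself"
  assumes s_pos: "0 < s" and s_less: "s < real DIM('a)"
begin

lemma lifted_kernel_le: "ennreal (lifted_kernel s y (x - t)) \<le> riesz_kernel s x (t :: 'a)"
proof (cases "x = t")
  case False
  have "((norm (x - t))\<^sup>2) powr (- (s / 2)) = norm (x - t) powr (- s)"
    using False powr_powr[of "norm (x - t)" 2 "- (s / 2)"] by simp
  moreover have "lifted_kernel s y (x - t) \<le> ((norm (x - t))\<^sup>2) powr (- (s / 2))"
    unfolding lifted_kernel_def using False s_pos by (auto intro!: powr_mono2')
  ultimately show ?thesis using False by (simp add: riesz_kernel_eq ennreal_leI)
qed (simp add: riesz_kernel_def)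

lemma riesz_kernel_split:
  "riesz_kernel s x t = ennreal (lifted_kernel s y (x - t)) + kernel_gap s y (x - t :: 'a)"
  using lifted_kernel_le[of y x t] unfolding kernel_gap_def riesz_kernel_diff[symmetric]
  by (metis add.commute diff_add_cancel_ennreal)

lemma lifted_kernel_bound: "0 < y \<Longrightarrow> lifted_kernel s y x \<le> y powr (- s)"
proof -
  assume "0 < y"
  moreover have "lifted_kernel s y x \<le> (y\<^sup>2) powr (- s / 2)"
    unfolding lifted_kernel_def using s_pos \<open>0 < y\<close> by (intro powr_mono2') auto
  ultimately show ?thesis using powr_powr[of y 2 "- s / 2"] by simp
qed

lemma nn_integral_riesz_kernel_bubble:
  fixes x c :: 'a
  assumes y: "0 < y"
  shows "(\<integral>\<^sup>+z. riesz_kernel s x z * ennreal (bubble s y (z - c)) \<partial>lborel) = ennreal (lifted_kernel s y (x - c))"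
proof -
  define p where "p = real DIM('a) - s / 2"
  define k where "k = pi powr (real DIM('a) / 2) * Gamma ((real DIM('a) - s) / 2)"
  define Y where "Y = y powr (real DIM('a) - s)"
  have pos: "0 < p" "0 < k" "0 < Y" "0 < Gamma p" "0 < Gamma (s / 2)"
    using s_pos s_less y by (auto simp: p_def k_def Y_def)
  have Yi: "y powr (- (real DIM('a) - s)) = inverse Y" using y by (simp add: Y_def powr_minus[symmetric])
  have "(\<integral>\<^sup>+z. riesz_kernel s x z * ennreal (bubble s y (z - c)) \<partial>lborel)
      = (\<integral>\<^sup>+z. riesz_kernel s x (z + c) * ennreal (bubble s y (z + c - c)) \<partial>lborel)"
    by (rule nn_integral_lborel_translate[symmetric]) measurable
  also have "\<dots> = (\<integral>\<^sup>+z. ennreal (Gamma p * Y / k) * (riesz_kernel s (x - c) z * ennreal (((norm z)\<^sup>2 + y\<^sup>2) powr (- p))) \<partial>lborel)"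
  proof (rule nn_integral_cong)
    fix z :: 'a
    have "riesz_kernel s x (z + c) = riesz_kernel s (x - c) z"
      by (subst (1 2) riesz_kernel_diff) (simp add: algebra_simps)
    then show "riesz_kernel s x (z + c) * ennreal (bubble s y (z + c - c)) =
       ennreal (Gamma p * Y / k) * (riesz_kernel s (x - c) z * ennreal (((norm z)\<^sup>2 + y\<^sup>2) powr (- p)))"
      using pos by (simp add: bubble_def p_def[symmetric] k_def[symmetric] Y_def[symmetric] ennreal_mult[symmetric] mult_ac)
  qed
  also have "\<dots> = ennreal (Gamma p * Y / k) * (\<integral>\<^sup>+z. riesz_kernel s (x - c) z * ennreal (((norm z)\<^sup>2 + y\<^sup>2) powr (- p)) \<partial>lborel)"
    (is "_ = _ * ?I") by (rule nn_integral_cmult) measurable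
  also have "\<dots> = ennreal (Y / (k * Gamma (s / 2))) * (ennreal (Gamma (s / 2)) * (ennreal (Gamma p) * ?I))"
    using pos by (simp add: mult.assoc[symmetric] ennreal_mult[symmetric]) (simp add: mult.commute)
  also have "\<dots> = ennreal (Y / (k * Gamma (s / 2))) * ennreal (k * Gamma (s / 2) * inverse Y * lifted_kernel s y (x - c))"
    using nn_integral_riesz_kernel_powr[OF s_pos s_less y, of "x - c"]
    unfolding p_def[symmetric] k_def Yi by (simp add: mult_ac)
  also have "\<dots> = ennreal (lifted_kernel s y (x - c))"
    using pos by (simp add: ennreal_mult[symmetric])
  finally show ?thesis .
qed

lemma prob_space_bubble_measure: "0 < y \<Longrightarrow> prob_space (bubble_measure s y (c :: 'a))"
  using nn_integral_bubble[OF s_pos s_less, of y c]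
  by (intro prob_spaceI) (simp add: bubble_measure_def emeasure_density)

lemma nn_integral_bubble_measure:
  assumes [measurable]: "f \<in> borel_measurable borel"
  shows "(\<integral>\<^sup>+z. f z \<partial>bubble_measure s y (c :: 'a)) = (\<integral>\<^sup>+z. f z * ennreal (bubble s y (z - c)) \<partial>lborel)"
  unfolding bubble_measure_def by (subst nn_integral_density) (auto simp: mult.commute)

lemma riesz_potential_bubble_measure:
  "0 < y \<Longrightarrow> riesz_potential s (bubble_measure s y (c :: 'a)) x = ennreal (lifted_kernel s y (x - c))"
  unfolding riesz_potential_def
  by (subst nn_integral_bubble_measure) (auto simp: nn_integral_riesz_kernel_bubble)

lemma riesz_potential_measurable [measurable]:
  assumes "sigma_finite_measure \<sigma>" "sets \<sigma> = sets (borel :: 'a measure)"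
  shows "riesz_potential s \<sigma> \<in> borel_measurable borel"
proof -
  interpret sigma_finite_measure \<sigma> by fact
  note [measurable_cong] = assms(2)
  show ?thesis unfolding riesz_potential_def[abs_def] by measurable
qed

text \<open>Tonelli and the symmetry of the kernel: averaging the potential of the measure over a
  bubble is integrating the potential of the bubble, a lifted kernel, against the measure.\<close>

lemma nn_integral_potential_bubble_measure:
  assumes "sigma_finite_measure \<sigma>" "sets \<sigma> = sets (borel :: 'a measure)" "0 < y"
  shows "(\<integral>\<^sup>+x. riesz_potential s \<sigma> x \<partial>bubble_measure s y c) = lifted_potential s y \<sigma> c"
proof -
  note [measurable_cong] = assms(2)
  have "(\<integral>\<^sup>+x. riesz_potential s \<sigma> x \<partial>bubble_measure s y c)
     = (\<integral>\<^sup>+t. (\<integral>\<^sup>+x. riesz_kernel s x t \<partial>bubble_measure s y c) \<partial>\<sigma>)"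
    unfolding riesz_potential_def
    by (intro nn_integral_swap assms prob_space_imp_sigma_finite prob_space_bubble_measure) measurable
  also have "(\<lambda>t. \<integral>\<^sup>+x. riesz_kernel s x t \<partial>bubble_measure s y c) = (\<lambda>t. ennreal (lifted_kernel s y (c - t)))"
  proof
    fix t
    have "(\<integral>\<^sup>+x. riesz_kernel s x t \<partial>bubble_measure s y c) = riesz_potential s (bubble_measure s y c) t"
      unfolding riesz_potential_def by (subst riesz_kernel_commute) simp
    also have "\<dots> = ennreal (lifted_kernel s y (c - t))"
      using lifted_kernel_minus[of s y "c - t"] by (simp add: riesz_potential_bubble_measure assms(3))
    finally show "(\<integral>\<^sup>+x. riesz_kernel s x t \<partial>bubble_measure s y c) = ennreal (lifted_kernel s y (c - t))" .
  qed
  finally show ?thesis by (simp add: lifted_potential_def)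
qed

lemma lifted_potential_le: "lifted_potential s y \<sigma> x \<le> riesz_potential s \<sigma> (x :: 'a)"
  unfolding lifted_potential_def riesz_potential_def by (intro nn_integral_mono lifted_kernel_le)

lemma riesz_potential_split:
  assumes "sets \<sigma> = sets borel"
  shows "riesz_potential s \<sigma> x = lifted_potential s y \<sigma> x + (\<integral>\<^sup>+t. kernel_gap s y (x - t :: 'a) \<partial>\<sigma>)"
proof -
  note [measurable_cong] = assms
  show ?thesis unfolding lifted_potential_def riesz_potential_def
    by (subst nn_integral_add[symmetric]) (auto simp: riesz_kernel_split[of x _ y, symmetric])
qed

lemma lifted_potential_bound:
  assumes "0 < y" "sets \<sigma> = sets (borel :: 'a measure)"
  shows "lifted_potential s y \<sigma> x \<le> ennreal (y powr (- s)) * emeasure \<sigma> UNIV"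
proof -
  have "space \<sigma> = UNIV" using sets_eq_imp_space_eq[OF assms(2)] by simp
  moreover have "lifted_potential s y \<sigma> x \<le> (\<integral>\<^sup>+t. ennreal (y powr (- s)) \<partial>\<sigma>)"
    unfolding lifted_potential_def by (intro nn_integral_mono ennreal_leI lifted_kernel_bound assms)
  ultimately show ?thesis by simp
qed

end

section \<open>The gap between the kernel and its bubble average\<close>

lemma sets_ball [measurable]: "ball c r \<in> sets borel"
  by (rule borel_open) simp

lemma sets_cball [measurable]: "cball c r \<in> sets borel"
  by (rule borel_closed) simp

lemma emeasure_lborel_open_pos:
  assumes "open A" "x \<in> A"
  shows "0 < emeasure lborel (A :: 'a::euclidean_space set)"
proof -
  obtain r where r: "0 < r" "ball x r \<subseteq> A" using assms openE by blast
  then have "0 < measure lborel (ball x r)" by (simp add: content_ball_pos)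
  then have "0 < emeasure lborel (ball x r)" by (metis measure_def enn2real_0 less_irrefl not_gr_zero)
  also have "\<dots> \<le> emeasure lborel A" using r assms by (intro emeasure_mono) auto
  finally show ?thesis .
qed

context riesz
begin

lemma kernel_gap_eq:
  fixes w :: 'a
  assumes "w \<noteq> 0" "0 < y"
  shows "kernel_gap s y w = ennreal (norm w powr (- s) * (1 - (1 + y\<^sup>2 / (norm w)\<^sup>2) powr (- (s / 2))))"
proof -
  have "(norm w)\<^sup>2 + y\<^sup>2 = (norm w)\<^sup>2 * (1 + y\<^sup>2 / (norm w)\<^sup>2)" using assms by (simp add: field_simps)
  then have "lifted_kernel s y w = ((norm w)\<^sup>2) powr (- (s / 2)) * (1 + y\<^sup>2 / (norm w)\<^sup>2) powr (- (s / 2))"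
    using assms by (simp add: lifted_kernel_def powr_mult)
  also have "((norm w)\<^sup>2) powr (- (s / 2)) = norm w powr (- s)"
    using assms powr_powr[of "norm w" 2 "- (s / 2)"] by simp
  finally show ?thesis using assms
    by (simp add: kernel_gap_def riesz_kernel_eq ennreal_minus right_diff_distrib)
qed

lemma norm_powr_split: "w \<noteq> 0 \<Longrightarrow> norm w powr (- s) / (norm w)\<^sup>2 = norm (w :: 'a) powr (- s - 2)"
  by (simp add: powr_diff)

lemma kernel_gap_le:
  fixes w :: 'a
  assumes "w \<noteq> 0" "0 < y"
  shows "kernel_gap s y w \<le> ennreal (s / 2 * y\<^sup>2 * norm w powr (- s - 2))"
proof -
  have "1 - (1 + y\<^sup>2 / (norm w)\<^sup>2) powr (- (s / 2)) \<le> s / 2 * (y\<^sup>2 / (norm w)\<^sup>2)"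
    using s_pos assms by (intro powr_ineq) auto
  then have "norm w powr (- s) * (1 - (1 + y\<^sup>2 / (norm w)\<^sup>2) powr (- (s / 2)))
      \<le> norm w powr (- s) * (s / 2 * (y\<^sup>2 / (norm w)\<^sup>2))"
    by (intro mult_left_mono) auto
  also have "\<dots> = s / 2 * y\<^sup>2 * norm w powr (- s - 2)"
    using assms by (simp add: norm_powr_split[symmetric])
  finally show ?thesis using assms by (simp add: kernel_gap_eq ennreal_leI)
qed

lemma kernel_gap_le_far:
  fixes w :: 'a
  assumes "\<delta> \<le> norm w" "0 < \<delta>" "0 < y"
  shows "kernel_gap s y w \<le> ennreal (s / 2 * y\<^sup>2 * \<delta> powr (- s - 2))"
proof -
  have "norm w powr (- s - 2) \<le> \<delta> powr (- s - 2)" using assms s_pos by (intro powr_mono2') auto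
  then have "s / 2 * y\<^sup>2 * norm w powr (- s - 2) \<le> s / 2 * y\<^sup>2 * \<delta> powr (- s - 2)"
    using s_pos by (intro mult_left_mono) auto
  moreover have "w \<noteq> 0" using assms by auto
  ultimately show ?thesis using kernel_gap_le[OF _ assms(3)] by (meson ennreal_leI order_trans)
qed

text \<open>The condition y <= |w| puts q = y^2 / |w|^2 into [0, 1], the range of the lower bound in
  \<open>powr_ineq\<close>. Together with \<open>kernel_gap_le\<close> it shows that the gap has
  exact order y^2 |w|^(-s-2) there.\<close>

lemma kernel_gap_ge:
  fixes w :: 'a
  assumes "y \<le> norm w" "0 < y"
  shows "ennreal (s / 2 * 2 powr (- (s / 2) - 1) * y\<^sup>2) * ennreal (norm w powr (- s - 2)) \<le> kernel_gap s y w"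
proof -
  have w: "w \<noteq> 0" using assms by auto
  have "y\<^sup>2 / (norm w)\<^sup>2 \<le> 1" using assms w by (simp add: power_mono)
  then have "s / 2 * 2 powr (- (s / 2) - 1) * (y\<^sup>2 / (norm w)\<^sup>2) \<le> 1 - (1 + y\<^sup>2 / (norm w)\<^sup>2) powr (- (s / 2))"
    using s_pos assms w by (intro powr_ineq) auto
  then have "norm w powr (- s) * (s / 2 * 2 powr (- (s / 2) - 1) * (y\<^sup>2 / (norm w)\<^sup>2))
     \<le> norm w powr (- s) * (1 - (1 + y\<^sup>2 / (norm w)\<^sup>2) powr (- (s / 2)))"
    by (intro mult_left_mono) auto
  moreover have "norm w powr (- s) * (s / 2 * 2 powr (- (s / 2) - 1) * (y\<^sup>2 / (norm w)\<^sup>2))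
     = s / 2 * 2 powr (- (s / 2) - 1) * y\<^sup>2 * norm w powr (- s - 2)"
    using w by (simp add: norm_powr_split[symmetric])
  moreover have "kernel_gap s y w = ennreal (norm w powr (- s) * (1 - (1 + y\<^sup>2 / (norm w)\<^sup>2) powr (- (s / 2))))"
    using w assms(2) by (rule kernel_gap_eq)
  moreover have "ennreal (s / 2 * 2 powr (- (s / 2) - 1) * y\<^sup>2) * ennreal (norm w powr (- s - 2))
     = ennreal (s / 2 * 2 powr (- (s / 2) - 1) * y\<^sup>2 * norm w powr (- s - 2))"
    using s_pos by (intro ennreal_mult[symmetric]) auto
  ultimately show ?thesis by (metis ennreal_leI)
qed

definition gap_mass :: "real \<Rightarrow> real \<Rightarrow> ennreal" where
  "gap_mass y \<delta> = (\<integral>\<^sup>+w. kernel_gap s y w * indicator (ball 0 \<delta>) (w :: 'a) \<partial>lborel)"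

lemma bubble_pos: "0 < y \<Longrightarrow> 0 < bubble s y (z :: 'a)"
proof -
  assume y: "0 < y"
  then have "(norm z)\<^sup>2 + y\<^sup>2 \<noteq> 0" using zero_less_power2[of y] zero_le_power2[of "norm z"] by linarith
  moreover have "0 < Gamma (real DIM('a) - s / 2)" "0 < Gamma ((real DIM('a) - s) / 2)"
    using s_pos s_less by auto
  ultimately show ?thesis using y by (simp add: bubble_def zero_less_mult_iff)
qed

lemma bubble_antimono:
  assumes "0 < y" "norm z \<le> norm w"
  shows "bubble s y (w :: 'a) \<le> bubble s y (z :: 'a)"
proof -
  have "((norm w)\<^sup>2 + y\<^sup>2) powr (- (real DIM('a) - s / 2)) \<le> ((norm z)\<^sup>2 + y\<^sup>2) powr (- (real DIM('a) - s / 2))"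
    using s_pos s_less assms by (intro powr_mono2') (auto simp: power_mono add_nonneg_pos)
  then show ?thesis unfolding bubble_def using s_pos s_less by (intro mult_left_mono) auto
qed

text \<open>On the ball the bubble of height 1 is at least its value m on the bounding sphere, and
  the kernel integrated against that bubble gives the finite number
  \<open>lifted_kernel s 1 0\<close>. So the kernel itself is integrable on the ball.\<close>

lemma gap_mass_finite: "gap_mass y \<delta> < top"
proof -
  obtain e :: 'a where e: "norm e = max \<delta> 0" using vector_choose_size[of "max \<delta> 0"] by auto
  define m where "m = bubble s 1 e"
  have m: "0 < m" by (simp add: m_def bubble_pos)
  have "kernel_gap s y w * indicator (ball 0 \<delta>) w \<le> ennreal (1 / m) * (riesz_kernel s 0 w * ennreal (bubble s 1 (w - 0)))" for w :: 'a
  proof (cases "w \<in> ball 0 \<delta>")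
    case True
    then have "m \<le> bubble s 1 w" unfolding m_def using e by (intro bubble_antimono) auto
    then have "1 \<le> ennreal (1 / m * bubble s 1 w)" using m by simp
    then have "riesz_kernel s w 0 * 1 \<le> riesz_kernel s w 0 * ennreal (1 / m * bubble s 1 w)"
      by (intro mult_left_mono) auto
    moreover have "kernel_gap s y w \<le> riesz_kernel s w 0" by (simp add: kernel_gap_def diff_le_self_ennreal)
    moreover have "ennreal (1 / m) * (riesz_kernel s 0 w * ennreal (bubble s 1 w)) = riesz_kernel s w 0 * ennreal (1 / m * bubble s 1 w)"
      using m by (subst ennreal_mult) (auto simp: riesz_kernel_commute[of s 0 w] less_imp_le bubble_pos mult_ac)
    ultimately show ?thesis using True by simp
  qed simp
  then have "gap_mass y \<delta> \<le> (\<integral>\<^sup>+w. ennreal (1 / m) * (riesz_kernel s 0 w * ennreal (bubble s 1 (w - 0 :: 'a))) \<partial>lborel)"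
    unfolding gap_mass_def by (intro nn_integral_mono) blast
  also have "\<dots> = ennreal (1 / m) * ennreal (lifted_kernel s 1 (0 - 0 :: 'a))"
    by (subst nn_integral_cmult) (measurable, simp only: nn_integral_riesz_kernel_bubble zero_less_one)
  finally show ?thesis by (simp add: ennreal_mult_less_top le_less_trans)
qed

end

section \<open>Divergence of the gap mass relative to the squared height\<close>

locale superharmonic_riesz = riesz s T for s and T :: "'a::euclidean_space itself" +
  assumes s_ge: "real DIM('a) - 2 \<le> s"
begin

text \<open>Scaling: halving the variable gives J(\<delta>) = 2^(s+2-d) * J(2\<delta>), which is at
  least J(2\<delta>) because s >= d - 2. If J(\<delta>) were finite, the shell between the radii
  \<delta> and 2\<delta> would carry no integral, although the integrand is positive there.\<close>

lemma nn_integral_norm_powr_infinite: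
  assumes "0 < \<delta>"
  shows "(\<integral>\<^sup>+w. ennreal (norm w powr (- s - 2)) * indicator (ball 0 \<delta>) (w :: 'a) \<partial>lborel) = top"
proof (rule ccontr)
  define J where "J r = (\<integral>\<^sup>+w. ennreal (norm w powr (- s - 2)) * indicator (ball 0 r) (w :: 'a) \<partial>lborel)" for r
  assume "\<not> ?thesis"
  then have fin: "J \<delta> < top" by (simp add: J_def less_top)
  have "J \<delta> = (\<integral>\<^sup>+w. ennreal ((1 / 2) ^ DIM('a)) * (ennreal (norm ((1/2) *\<^sub>R w :: 'a) powr (- s - 2)) * indicator (ball 0 \<delta>) ((1/2) *\<^sub>R w)) \<partial>lborel)"
  proof -
    let ?f = "\<lambda>w :: 'a. ennreal (norm w powr (- s - 2)) * indicator (ball 0 \<delta>) w"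
    have [measurable]: "?f \<in> borel_measurable borel"
      by (intro borel_measurable_times_ennreal borel_measurable_indicator) auto
    have "J \<delta> = ennreal (\<bar>1/2\<bar> ^ DIM('a)) * (\<integral>\<^sup>+w. ?f (0 + (1/2) *\<^sub>R w) \<partial>lborel)"
      unfolding J_def by (rule nn_integral_lborel_affine) auto
    also have "\<dots> = (\<integral>\<^sup>+w. ennreal (\<bar>1/2\<bar> ^ DIM('a)) * ?f (0 + (1/2) *\<^sub>R w) \<partial>lborel)"
      by (rule nn_integral_cmult[symmetric]) measurable
    finally show ?thesis by simp
  qed
  also have "\<dots> = (\<integral>\<^sup>+w. ennreal (2 powr (s + 2 - real DIM('a))) * (ennreal (norm (w :: 'a) powr (- s - 2)) * indicator (ball 0 (2 * \<delta>)) w) \<partial>lborel)"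
  proof (rule nn_integral_cong)
    fix w :: 'a
    have "(1 / 2) ^ DIM('a) * norm ((1/2) *\<^sub>R w) powr (- s - 2) = 2 powr (s + 2 - real DIM('a)) * norm w powr (- s - 2)"
    proof -
      have "(1 / 2 :: real) ^ DIM('a) = 2 powr (- real DIM('a))" by (simp add: powr_minus powr_realpow power_one_over inverse_eq_divide)
      moreover have "norm ((1/2) *\<^sub>R w) powr (- s - 2) = 2 powr (s + 2) * norm w powr (- s - 2)"
      proof -
        have "norm ((1/2) *\<^sub>R w) = norm w / 2" by simp
        then have A: "norm ((1/2) *\<^sub>R w) powr (- s - 2) = norm w powr (- s - 2) / 2 powr (- s - 2)"
          by (simp only: powr_divide)
        have B: "2 powr (s + 2) = 1 / 2 powr (- s - 2)"
          using powr_minus_divide[of 2 "- s - 2"] by (simp add: add.commute)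
        show ?thesis unfolding A B by simp
      qed
      moreover have "2 powr (- real DIM('a)) * 2 powr (s + 2) = 2 powr (s + 2 - real DIM('a))"
        unfolding powr_add[symmetric] by (simp add: algebra_simps)
      ultimately show ?thesis by simp
    qed
    moreover have "indicator (ball 0 \<delta>) ((1/2) *\<^sub>R w) = (indicator (ball 0 (2 * \<delta>)) w :: ennreal)"
      by (auto simp: indicator_def)
    ultimately show "ennreal ((1 / 2) ^ DIM('a)) * (ennreal (norm ((1/2) *\<^sub>R w :: 'a) powr (- s - 2)) * indicator (ball 0 \<delta>) ((1/2) *\<^sub>R w))
      = ennreal (2 powr (s + 2 - real DIM('a))) * (ennreal (norm w powr (- s - 2)) * indicator (ball 0 (2 * \<delta>)) w)"
      by (simp add: mult.assoc[symmetric] ennreal_mult[symmetric] del: norm_scaleR)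
  qed
  also have "\<dots> = ennreal (2 powr (s + 2 - real DIM('a))) * J (2 * \<delta>)"
    unfolding J_def by (rule nn_integral_cmult) measurable
  also have "\<dots> \<ge> 1 * J (2 * \<delta>)"
    using s_ge powr_mono[of 0 "s + 2 - real DIM('a)" 2] by (intro mult_right_mono) auto
  finally have le: "J (2 * \<delta>) \<le> J \<delta>" by simp
  define A where "A = ball (0 :: 'a) (2 * \<delta>) - cball 0 \<delta>"
  have "J \<delta> + (\<integral>\<^sup>+w. ennreal (norm w powr (- s - 2)) * indicator A (w :: 'a) \<partial>lborel) \<le> J (2 * \<delta>)"
    unfolding J_def A_def
    using assms by (subst nn_integral_add[symmetric]) (auto intro!: nn_integral_mono simp: indicator_def)
  with le fin have "(\<integral>\<^sup>+w. ennreal (norm w powr (- s - 2)) * indicator A (w :: 'a) \<partial>lborel) = 0"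
    by (metis (no_types, lifting) add.right_neutral add_left_mono ennreal_add_left_cancel_le le_zero_eq order_trans less_irrefl infinity_ennreal_def)
  then have "AE w in lborel. ennreal (norm w powr (- s - 2)) * indicator A (w :: 'a) = 0"
    by (subst (asm) nn_integral_0_iff_AE) (auto simp: A_def)
  then have "AE w in lborel. w \<notin> A"
    by eventually_elim (use assms in \<open>auto simp: A_def indicator_def split: if_splits\<close>)
  then have "emeasure lborel A = 0" by (subst (asm) AE_iff_measurable[of A]) (auto simp: A_def)
  moreover have "open A" unfolding A_def by auto
  moreover have "A \<noteq> {}"
  proof -
    obtain e :: 'a where "norm e = 3 / 2 * \<delta>" using vector_choose_size[of "3 / 2 * \<delta>"] assms by auto
    then have "e \<in> A" using assms by (simp add: A_def)
    then show ?thesis by auto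
  qed
  ultimately show False using emeasure_lborel_open_pos by (metis ex_in_conv less_irrefl)
qed

text \<open>By \<open>kernel_gap_ge\<close>, the quotient of gap mass and y^2 is at least a constant
  times the integral of |w|^(-s-2) over y <= |w| < \<delta>, and this diverges as y tends to 0. It
  is the quantitative form of concentration at 0, since \<open>kernel_gap_le_far\<close> bounds the
  gap by a multiple of y^2 away from 0.\<close>

lemma gap_mass_dominates:
  assumes "0 < \<delta>"
  obtains y where "0 < y" "ennreal (B * y\<^sup>2) < gap_mass y \<delta>"
proof -
  define c where "c = s / 2 * 2 powr (- (s / 2) - 1)"
  have c: "0 < c" using s_pos by (simp add: c_def)
  define e where "e n = 1 / real (Suc n)" for n
  have e: "0 < e n" for n by (simp add: e_def)
  \<comment> \<open>The removed ball is the region where the lower bound for the gap fails. The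
    removed balls shrink to the origin, where the convention \<open>0 powr _ = 0\<close> makes both
    sides of the limit vanish.\<close>
  define f where "f n w = ennreal (norm w powr (- s - 2)) * indicator (ball 0 \<delta> - ball 0 (e n)) (w :: 'a)" for n w
  have [measurable]: "f n \<in> borel_measurable borel" for n
    unfolding f_def by (intro borel_measurable_times_ennreal borel_measurable_indicator) auto
  have "incseq f"
  proof (intro incseq_SucI le_funI)
    fix n and w :: 'a
    have "e (Suc n) \<le> e n" by (simp add: e_def field_simps)
    then show "f n w \<le> f (Suc n) w" by (auto simp: f_def indicator_def)
  qed
  then have "(\<integral>\<^sup>+w. (SUP n. f n w) \<partial>lborel) = (SUP n. \<integral>\<^sup>+w. f n w \<partial>lborel)"
    by (intro nn_integral_monotone_convergence_SUP) auto
  moreover have "(SUP n. f n w) = ennreal (norm w powr (- s - 2)) * indicator (ball 0 \<delta>) w" for w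
  proof (cases "w = 0")
    case False
    obtain N where N: "e N < norm w" using reals_Archimedean[of "norm w"] False by (auto simp: e_def inverse_eq_divide)
    show ?thesis
    proof (rule antisym)
      show "(SUP n. f n w) \<le> ennreal (norm w powr (- s - 2)) * indicator (ball 0 \<delta>) w"
        by (intro SUP_least) (auto simp: f_def indicator_def)
      have "ennreal (norm w powr (- s - 2)) * indicator (ball 0 \<delta>) w = f N w" using N by (simp add: f_def indicator_def)
      then show "ennreal (norm w powr (- s - 2)) * indicator (ball 0 \<delta>) w \<le> (SUP n. f n w)"
        using SUP_upper[of N UNIV "\<lambda>n. f n w"] by simp
    qed
  qed (simp add: f_def)
  ultimately have "(SUP n. \<integral>\<^sup>+w. f n w \<partial>lborel) = top" using nn_integral_norm_powr_infinite[OF assms] by simp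
  then have "ennreal (max B 0 / c) < (SUP n. \<integral>\<^sup>+w. f n w \<partial>lborel)" by (simp only: ennreal_less_top)
  then obtain n where n: "ennreal (max B 0 / c) < (\<integral>\<^sup>+w. f n w \<partial>lborel)" by (auto simp: less_SUP_iff)
  have pos: "0 < c * (e n)\<^sup>2" using c e[of n] by simp
  have "B * (e n)\<^sup>2 \<le> max B 0 * (e n)\<^sup>2" by (intro mult_right_mono) auto
  also have "\<dots> = c * (e n)\<^sup>2 * (max B 0 / c)" using c by simp
  finally have "ennreal (B * (e n)\<^sup>2) \<le> ennreal (c * (e n)\<^sup>2 * (max B 0 / c))" by (rule ennreal_leI)
  also have "\<dots> = ennreal (c * (e n)\<^sup>2) * ennreal (max B 0 / c)" using pos c by (intro ennreal_mult) auto
  also have "\<dots> < ennreal (c * (e n)\<^sup>2) * (\<integral>\<^sup>+w. f n w \<partial>lborel)"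
    using n pos by (intro ennreal_mult_strict_left_mono) auto
  also have "\<dots> = (\<integral>\<^sup>+w. ennreal (c * (e n)\<^sup>2) * f n w \<partial>lborel)" by (rule nn_integral_cmult[symmetric]) measurable
  also have "\<dots> \<le> gap_mass (e n) \<delta>"
    unfolding gap_mass_def
  proof (rule nn_integral_mono)
    fix w :: 'a
    show "ennreal (c * (e n)\<^sup>2) * f n w \<le> kernel_gap s (e n) w * indicator (ball 0 \<delta>) w"
      using kernel_gap_ge[OF _ e, of n w] by (auto simp: f_def c_def indicator_def)
  qed
  finally show ?thesis using that e by blast
qed

end

section \<open>Bounded potentials as real functions\<close>

context riesz
begin

text \<open>Pairs a measure with a real-valued version of its potential, so that differences of
  potentials and their integrals can be formed in the reals instead of
  \<open>ennreal\<close>.\<close>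

definition bounded_potential :: "'a measure \<Rightarrow> ('a \<Rightarrow> real) \<Rightarrow> bool" where
  "bounded_potential P u \<longleftrightarrow> finite_measure P \<and> sets P = sets borel \<and> u \<in> borel_measurable borel
     \<and> (\<exists>B. \<forall>x. 0 \<le> u x \<and> u x \<le> B) \<and> (\<forall>x. riesz_potential s P x = ennreal (u x))"

lemma bounded_potentialD:
  assumes "bounded_potential P u"
  shows "finite_measure P" "sets P = sets borel" "u \<in> borel_measurable borel" "0 \<le> u x"
    "riesz_potential s P x = ennreal (u x)" "sigma_finite_measure P"
  using assms finite_measure.axioms(1) by (auto simp: bounded_potential_def)

lemma bounded_potential_integrable:
  assumes "bounded_potential P u" "prob_space M" "sets M = sets borel"
  shows "integrable M u"
proof -
  obtain B where "\<And>x. 0 \<le> u x \<and> u x \<le> B" using assms(1) by (auto simp: bounded_potential_def)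
  then have B: "\<And>x. \<bar>u x\<bar> \<le> B" by auto
  interpret prob_space M by fact
  note [measurable_cong] = assms(3) and [measurable] = bounded_potentialD(3)[OF assms(1)]
  show ?thesis by (rule integrable_const_bound[of _ B]) (auto simp: B)
qed

lemma lifted_potential_bounded_potential:
  assumes "bounded_potential P u" "0 < y"
  shows "lifted_potential s y P x = ennreal (\<integral>z. u z \<partial>bubble_measure s y x)"
proof -
  have "lifted_potential s y P x = (\<integral>\<^sup>+z. ennreal (u z) \<partial>bubble_measure s y x)"
    using nn_integral_potential_bubble_measure[of P y x] bounded_potentialD[OF assms(1)] assms(2) by simp
  also have "\<dots> = ennreal (\<integral>z. u z \<partial>bubble_measure s y x)"
    using assms bounded_potentialD[OF assms(1)]
    by (intro nn_integral_eq_integral bounded_potential_integrable[OF assms(1)] prob_space_bubble_measure) auto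
  finally show ?thesis .
qed

lemma bounded_potential_integral_nonneg:
  "bounded_potential P u \<Longrightarrow> 0 \<le> (\<integral>z. u z \<partial>M)"
  using bounded_potentialD(4) by (intro Bochner_Integration.integral_nonneg) auto

end

context superharmonic_riesz
begin

text \<open>Near a point the gap kernel carries far more mass than the \<open>O(y\<^sup>2)\<close> it can pick up elsewhere.\<close>

lemma source_estimate:
  fixes p n :: "'a \<Rightarrow> real"
  assumes [measurable]: "p \<in> borel_measurable borel" "n \<in> borel_measurable borel"
    and nonneg: "\<And>z. 0 \<le> p z" "\<And>z. 0 \<le> n z"
    and fin: "(\<integral>\<^sup>+z. ennreal (p z) \<partial>lborel) < top"
    and \<delta>: "0 < \<delta>" and m: "0 < m"
  obtains y e where "0 < y" "0 < e"
    "\<And>x. (\<And>z. z \<in> ball x \<delta> \<Longrightarrow> p z + m \<le> n z) \<Longrightarrow>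
       riesz_potential s (density lborel p) x + lifted_potential s y (density lborel n) x + ennreal e
        \<le> riesz_potential s (density lborel n) x + lifted_potential s y (density lborel p) x"
proof -
  define C where "C = enn2real (\<integral>\<^sup>+z. ennreal (p z) \<partial>lborel)"
  have C: "(\<integral>\<^sup>+z. ennreal (p z) \<partial>lborel) = ennreal C" "0 \<le> C" using fin by (simp_all add: C_def)
  \<comment> \<open>By \<open>kernel_gap_le_far\<close>, m * B * y^2 bounds what p collects through
    the gap kernel outside the ball of radius \<delta>. The height y is chosen so that m times the
    gap mass near x exceeds this, and e is the surplus.\<close>
  define B where "B = s / 2 * \<delta> powr (- s - 2) * C / m"
  obtain y where y: "0 < y" "ennreal (B * y\<^sup>2) < gap_mass y \<delta>" using gap_mass_dominates[OF \<delta>] by blast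
  define G where "G = enn2real (gap_mass y \<delta>)"
  have G: "gap_mass y \<delta> = ennreal G" "0 \<le> G" using gap_mass_finite by (simp_all add: G_def)
  have B0: "0 \<le> B" using s_pos m C by (simp add: B_def)
  define e where "e = m * G - m * (B * y\<^sup>2)"
  have "B * y\<^sup>2 < G" using y(2) B0 unfolding G(1) by (simp add: ennreal_less_iff)
  then have e: "0 < e" using m by (simp add: e_def)
  show ?thesis
  proof (rule that[OF y(1) e])
    fix x :: 'a
    assume src: "\<And>z. z \<in> ball x \<delta> \<Longrightarrow> p z + m \<le> n z"
    let ?k = "\<lambda>z. kernel_gap s y (x - z)"
    let ?b = "indicator (ball x \<delta>) :: 'a \<Rightarrow> ennreal"
    have [measurable]: "?b \<in> borel_measurable borel" by (intro borel_measurable_indicator) auto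
    have near: "(\<integral>\<^sup>+z. ennreal m * (?k z * ?b z) \<partial>lborel) = ennreal (m * G)"
    proof -
      have "gap_mass y \<delta> = (\<integral>\<^sup>+z. kernel_gap s y (x + (-1) *\<^sub>R z) * indicator (ball 0 \<delta>) (x + (-1) *\<^sub>R z) \<partial>lborel)"
        unfolding gap_mass_def
        by (subst nn_integral_lborel_affine[of _ "-1" x])
          (auto intro!: borel_measurable_times_ennreal borel_measurable_indicator)
      also have "\<dots> = (\<integral>\<^sup>+z. ?k z * ?b z \<partial>lborel)"
        by (intro nn_integral_cong) (auto simp: indicator_def dist_norm norm_minus_commute)
      finally show ?thesis using m G by (simp add: nn_integral_cmult ennreal_mult)
    qed
    have "(\<integral>\<^sup>+z. ennreal (p z) * ?k z \<partial>lborel) \<le>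
       (\<integral>\<^sup>+z. ennreal (p z) * ?k z * ?b z + ennreal (s / 2 * y\<^sup>2 * \<delta> powr (- s - 2)) * ennreal (p z) \<partial>lborel)"
    proof (rule nn_integral_mono)
      fix z
      show "ennreal (p z) * ?k z \<le> ennreal (p z) * ?k z * ?b z + ennreal (s / 2 * y\<^sup>2 * \<delta> powr (- s - 2)) * ennreal (p z)"
      proof (cases "z \<in> ball x \<delta>")
        case False
        then have "?k z \<le> ennreal (s / 2 * y\<^sup>2 * \<delta> powr (- s - 2))"
          by (intro kernel_gap_le_far \<delta> y) (auto simp: dist_norm)
        then show ?thesis using False by (simp add: mult.commute[of _ "ennreal (p z)"] mult_left_mono)
      qed simp
    qed
    also have "\<dots> = (\<integral>\<^sup>+z. ennreal (p z) * ?k z * ?b z \<partial>lborel) + ennreal (m * (B * y\<^sup>2))"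
    proof -
      have "m * (B * y\<^sup>2) = (s / 2 * y\<^sup>2 * \<delta> powr (- s - 2)) * C" using m by (simp add: B_def)
      then have "ennreal (m * (B * y\<^sup>2)) = ennreal (s / 2 * y\<^sup>2 * \<delta> powr (- s - 2)) * ennreal C"
        using s_pos C by (simp only: ennreal_mult[symmetric] ennreal_mult'')
      then show ?thesis
        by (subst nn_integral_add) (simp_all add: nn_integral_cmult C(1) del: times_divide_eq_left)
    qed
    finally have "(\<integral>\<^sup>+z. ennreal (p z) * ?k z \<partial>lborel) + ennreal e
      \<le> (\<integral>\<^sup>+z. ennreal (p z) * ?k z * ?b z \<partial>lborel) + ennreal (m * (B * y\<^sup>2)) + ennreal e"
      by (rule add_right_mono)
    also have "\<dots> = (\<integral>\<^sup>+z. ennreal (p z) * ?k z * ?b z \<partial>lborel) + ennreal (m * G)"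
      using e m B0 by (simp add: add.assoc ennreal_plus[symmetric] e_def del: ennreal_plus)
    also have "\<dots> = (\<integral>\<^sup>+z. ennreal (p z) * ?k z * ?b z + ennreal m * (?k z * ?b z) \<partial>lborel)"
      unfolding near[symmetric] by (rule nn_integral_add[symmetric]) measurable
    also have "\<dots> \<le> (\<integral>\<^sup>+z. ennreal (n z) * ?k z \<partial>lborel)"
    proof (rule nn_integral_mono)
      fix z
      show "ennreal (p z) * ?k z * ?b z + ennreal m * (?k z * ?b z) \<le> ennreal (n z) * ?k z"
      proof (cases "z \<in> ball x \<delta>")
        case True
        then have "ennreal (p z) + ennreal m \<le> ennreal (n z)"
          using src[OF True] m nonneg by (simp add: ennreal_plus[symmetric] ennreal_leI del: ennreal_plus)
        then have "(ennreal (p z) + ennreal m) * ?k z \<le> ennreal (n z) * ?k z" by (intro mult_right_mono) auto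
        then show ?thesis using True by (simp add: distrib_right)
      qed simp
    qed
    finally have *: "(\<integral>\<^sup>+z. ?k z \<partial>density lborel p) + ennreal e \<le> (\<integral>\<^sup>+z. ?k z \<partial>density lborel n)"
      by (simp add: nn_integral_density)
    \<comment> \<open>Adding both lifted potentials to the inequality between gap integrals turns it
      into one between potentials, without any subtraction in \<open>ennreal\<close>.\<close>
    show "riesz_potential s (density lborel p) x + lifted_potential s y (density lborel n) x + ennreal e
        \<le> riesz_potential s (density lborel n) x + lifted_potential s y (density lborel p) x"
      using add_left_mono[OF *, of "lifted_potential s y (density lborel p) x + lifted_potential s y (density lborel n) x"]
      by (subst (1 2) riesz_potential_split[of _ _ y]) (simp_all add: add_ac)
  qed
qed

end

section \<open>First variation of the energy\<close>

text \<open>The convex combination (1 - t) \<mu> + t \<sigma>, built as a Bernoulli mixture: that it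
  is a probability measure and how it integrates then come from the Giry monad.\<close>

lemma bind_bernoulli:
  fixes \<mu> \<sigma> :: "'a::topological_space measure"
  assumes \<mu>: "borel_prob \<mu>" and \<sigma>: "borel_prob \<sigma>" and t: "0 \<le> t" "t \<le> 1"
  defines "\<nu> \<equiv> measure_pmf (bernoulli_pmf t) \<bind> (\<lambda>b. if b then \<sigma> else \<mu>)"
  shows "borel_prob \<nu>"
    and "f \<in> borel_measurable borel \<Longrightarrow>
      (\<integral>\<^sup>+x. f x \<partial>\<nu>) = ennreal (1 - t) * (\<integral>\<^sup>+x. f x \<partial>\<mu>) + ennreal t * (\<integral>\<^sup>+x. f x \<partial>\<sigma>)"
proof -
  have K: "(\<lambda>b. if b then \<sigma> else \<mu>) \<in> measure_pmf (bernoulli_pmf t) \<rightarrow>\<^sub>M prob_algebra borel"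
    using \<mu> \<sigma> by (auto simp: space_prob_algebra borel_prob_def)
  have "prob_space \<nu>" unfolding \<nu>_def
    by (rule prob_space_bind'[OF _ K]) (simp add: space_prob_algebra measure_pmf.prob_space_axioms)
  moreover have "sets \<nu> = sets borel" unfolding \<nu>_def
    by (rule sets_bind) (use \<mu> \<sigma> in \<open>auto simp: borel_prob_def\<close>)
  ultimately show "borel_prob \<nu>" by (simp add: borel_prob_def)
  assume f: "f \<in> borel_measurable borel"
  show "(\<integral>\<^sup>+x. f x \<partial>\<nu>) = ennreal (1 - t) * (\<integral>\<^sup>+x. f x \<partial>\<mu>) + ennreal t * (\<integral>\<^sup>+x. f x \<partial>\<sigma>)"
    unfolding \<nu>_def
    by (subst nn_integral_bind[OF f measurable_prob_algebraD[OF K]])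
      (use t in \<open>simp add: mult.commute add.commute\<close>)
qed

lemma quadratic_perturbation_nonneg:
  fixes D E :: real
  assumes "\<And>t. 0 < t \<Longrightarrow> t \<le> 1 \<Longrightarrow> 0 \<le> t * (2 * D + t * E)"
  shows "0 \<le> D"
proof -
  have "0 \<le> 2 * D + t * E" if "0 < t" "t \<le> 1" for t
    using assms[OF that] that by (simp add: zero_le_mult_iff)
  then have "eventually (\<lambda>t. 0 \<le> 2 * D + t * E) (at_right 0)"
    unfolding eventually_at_right[OF zero_less_one] by (intro exI[of _ 1]) auto
  moreover have "((\<lambda>t. 2 * D + t * E) \<longlongrightarrow> 2 * D + 0 * E) (at_right 0)" by (intro tendsto_intros)
  ultimately have "0 \<le> 2 * D + 0 * E" by (intro tendsto_lowerbound[where F="at_right 0"]) auto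
  then show ?thesis by simp
qed

lemma borel_probD:
  assumes "borel_prob \<sigma>"
  shows "prob_space \<sigma>" "sets \<sigma> = sets borel" "finite_measure \<sigma>" "sigma_finite_measure \<sigma>" "emeasure \<sigma> UNIV = 1"
    "space \<sigma> = UNIV"
proof -
  show 1: "prob_space \<sigma>" "sets \<sigma> = sets borel" using assms by (auto simp: borel_prob_def)
  then interpret prob_space \<sigma> by simp
  show "finite_measure \<sigma>" "sigma_finite_measure \<sigma>" by unfold_locales
  show "space \<sigma> = UNIV" using sets_eq_imp_space_eq[OF 1(2)] by simp
  then show "emeasure \<sigma> UNIV = 1" using emeasure_space_1 by simp
qed

context riesz
begin

lemma riesz_energy_eq: "riesz_energy s \<sigma> = (\<integral>\<^sup>+x. riesz_potential s \<sigma> x \<partial>\<sigma>)"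
  by (simp add: riesz_energy_def riesz_potential_def)

lemma mutual_energy_commute:
  assumes "sigma_finite_measure \<sigma>" "sets \<sigma> = sets borel" "sigma_finite_measure \<mu>" "sets \<mu> = sets (borel :: 'a measure)"
  shows "(\<integral>\<^sup>+x. riesz_potential s \<sigma> x \<partial>\<mu>) = (\<integral>\<^sup>+x. riesz_potential s \<mu> x \<partial>\<sigma>)"
proof -
  note [measurable_cong] = assms(2,4)
  have "(\<integral>\<^sup>+x. riesz_potential s \<sigma> x \<partial>\<mu>) = (\<integral>\<^sup>+t. (\<integral>\<^sup>+x. riesz_kernel s x t \<partial>\<mu>) \<partial>\<sigma>)"
    unfolding riesz_potential_def by (intro nn_integral_swap assms) measurable
  then show ?thesis unfolding riesz_potential_def by (simp add: riesz_kernel_commute)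
qed

text \<open>Along the segment from \<mu> to \<sigma> the weighted energy is a quadratic polynomial
  in t with a minimum over [0, 1] at t = 0. Its derivative at 0, twice the difference of the two
  sides, is therefore nonnegative. Finiteness of the three energies makes the coefficients
  real.\<close>

lemma first_variation:
  fixes Q :: "'a \<Rightarrow> real"
  assumes eq: "riesz_equilibrium s Q \<mu>" and \<sigma>: "borel_prob \<sigma>"
    and fin: "riesz_energy s \<mu> < top" "riesz_energy s \<sigma> < top" "(\<integral>\<^sup>+x. riesz_potential s \<mu> x \<partial>\<sigma>) < top"
    and Q [measurable]: "Q \<in> borel_measurable borel" and B: "\<And>x. \<bar>Q x\<bar> \<le> B"
  shows "enn2real (riesz_energy s \<mu>) + (\<integral>x. Q x \<partial>\<mu>)
    \<le> enn2real (\<integral>\<^sup>+x. riesz_potential s \<mu> x \<partial>\<sigma>) + (\<integral>x. Q x \<partial>\<sigma>)"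
proof -
  have \<mu>: "borel_prob \<mu>" using eq by (simp add: riesz_equilibrium_def)
  note sm = borel_probD[OF \<mu>] and ss = borel_probD[OF \<sigma>]
  have int: "integrable \<tau> Q" if "borel_prob \<tau>" for \<tau>
  proof -
    interpret prob_space \<tau> using borel_probD[OF that] by simp
    note [measurable_cong] = borel_probD(2)[OF that]
    show ?thesis by (rule integrable_const_bound[of _ B]) (use B in auto)
  qed
  define Im where "Im = enn2real (riesz_energy s \<mu>)"
  define Is where "Is = enn2real (riesz_energy s \<sigma>)"
  define C where "C = enn2real (\<integral>\<^sup>+x. riesz_potential s \<mu> x \<partial>\<sigma>)"
  have nn: "0 \<le> Im" "0 \<le> Is" "0 \<le> C" by (simp_all add: Im_def Is_def C_def)
  have I: "riesz_energy s \<mu> = ennreal Im" "riesz_energy s \<sigma> = ennreal Is"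
    "(\<integral>\<^sup>+x. riesz_potential s \<mu> x \<partial>\<sigma>) = ennreal C"
    using fin by (simp_all add: Im_def Is_def C_def)
  have C': "(\<integral>\<^sup>+x. riesz_potential s \<sigma> x \<partial>\<mu>) = ennreal C"
    using mutual_energy_commute[OF ss(4,2) sm(4,2)] I(3) by simp
  define qm where "qm = (\<integral>x. Q x \<partial>\<mu>)"
  define qs where "qs = (\<integral>x. Q x \<partial>\<sigma>)"
  have "0 \<le> t * (2 * (C + qs - Im - qm) + t * (Im - 2 * C + Is))" if t: "0 < t" "t \<le> 1" for t
  proof -
    define \<nu> where "\<nu> = measure_pmf (bernoulli_pmf t) \<bind> (\<lambda>b. if b then \<sigma> else \<mu>)"
    have t': "0 \<le> t" using t by simp
    have \<nu>: "borel_prob \<nu>" unfolding \<nu>_def using \<mu> \<sigma> t' t(2) by (rule bind_bernoulli)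
    have nu: "(\<integral>\<^sup>+x. f x \<partial>\<nu>) = ennreal (1 - t) * (\<integral>\<^sup>+x. f x \<partial>\<mu>) + ennreal t * (\<integral>\<^sup>+x. f x \<partial>\<sigma>)"
      if "f \<in> borel_measurable borel" for f
      unfolding \<nu>_def using \<mu> \<sigma> t' t(2) that by (rule bind_bernoulli)
    have [measurable]: "riesz_potential s \<mu> \<in> borel_measurable borel" "riesz_potential s \<sigma> \<in> borel_measurable borel"
      using sm ss by (auto intro: riesz_potential_measurable)
    have pot: "riesz_potential s \<nu> = (\<lambda>x. ennreal (1 - t) * riesz_potential s \<mu> x + ennreal t * riesz_potential s \<sigma> x)"
      unfolding riesz_potential_def by (intro ext nu) measurable
    have mix: "(\<integral>\<^sup>+x. riesz_potential s \<nu> x \<partial>\<tau>) = ennreal (1 - t) * (\<integral>\<^sup>+x. riesz_potential s \<mu> x \<partial>\<tau>) + ennreal t * (\<integral>\<^sup>+x. riesz_potential s \<sigma> x \<partial>\<tau>)"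
      if "sets \<tau> = sets borel" for \<tau>
    proof -
      note [measurable_cong] = that
      show ?thesis unfolding pot by (simp add: nn_integral_add nn_integral_cmult)
    qed
    have "riesz_energy s \<nu> = ennreal (1 - t) * (\<integral>\<^sup>+x. riesz_potential s \<nu> x \<partial>\<mu>) + ennreal t * (\<integral>\<^sup>+x. riesz_potential s \<nu> x \<partial>\<sigma>)"
      unfolding riesz_energy_eq by (rule nu) (simp add: pot)
    also have "\<dots> = ennreal ((1 - t) * ((1 - t) * Im + t * C) + t * ((1 - t) * C + t * Is))"
      unfolding mix[OF sm(2)] mix[OF ss(2)] C' I(3) riesz_energy_eq[symmetric] I(1,2)
      using t nn by (simp add: ennreal_mult[symmetric] ennreal_plus[symmetric] del: ennreal_plus)
    finally have E: "riesz_energy s \<nu> = ennreal ((1 - t) * ((1 - t) * Im + t * C) + t * ((1 - t) * C + t * Is))" .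
    have Qn: "(\<integral>x. Q x \<partial>\<nu>) = (1 - t) * qm + t * qs"
    proof -
      \<comment> \<open>The mixture formula is one for nonnegative integrals. Shifting Q by its
        bound B makes it applicable, and the shift cancels because all measures have mass 1.\<close>
      have eqn: "(\<integral>\<^sup>+x. ennreal (Q x + B) \<partial>\<tau>) = ennreal ((\<integral>x. Q x \<partial>\<tau>) + B) \<and> 0 \<le> (\<integral>x. Q x \<partial>\<tau>) + B" if "borel_prob \<tau>" for \<tau>
      proof -
        interpret prob_space \<tau> using borel_probD[OF that] by simp
        have pos: "0 \<le> Q x + B" for x using B[of x] by auto
        have "(\<integral>\<^sup>+x. ennreal (Q x + B) \<partial>\<tau>) = ennreal (\<integral>x. Q x + B \<partial>\<tau>)"
          using int[OF that] pos by (intro nn_integral_eq_integral) auto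
        moreover have "(\<integral>x. Q x + B \<partial>\<tau>) = (\<integral>x. Q x \<partial>\<tau>) + B"
          using int[OF that] by (simp add: prob_space)
        moreover have "0 \<le> (\<integral>x. Q x + B \<partial>\<tau>)" using pos by simp
        ultimately show ?thesis by simp
      qed
      have "ennreal ((\<integral>x. Q x \<partial>\<nu>) + B) = ennreal (1 - t) * ennreal (qm + B) + ennreal t * ennreal (qs + B)"
        using nu[of "\<lambda>x. ennreal (Q x + B)"] eqn[OF \<nu>] eqn[OF \<mu>] eqn[OF \<sigma>] by (simp add: qm_def qs_def)
      also have "\<dots> = ennreal ((1 - t) * (qm + B) + t * (qs + B))"
        using t eqn[OF \<mu>] eqn[OF \<sigma>]
        by (simp add: ennreal_mult[symmetric] ennreal_plus[symmetric] qm_def qs_def del: ennreal_plus)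
      finally have "(\<integral>x. Q x \<partial>\<nu>) + B = (1 - t) * (qm + B) + t * (qs + B)"
      proof (rule ennreal_inj[THEN iffD1, rotated 2])
        show "0 \<le> (\<integral>x. Q x \<partial>\<nu>) + B" using eqn[OF \<nu>] by simp
        show "0 \<le> (1 - t) * (qm + B) + t * (qs + B)"
        proof -
          have "0 \<le> qm + B" "0 \<le> qs + B" using eqn[OF \<mu>] eqn[OF \<sigma>] by (simp_all add: qm_def qs_def)
          then have "0 \<le> (1 - t) * (qm + B)" "0 \<le> t * (qs + B)" using t by simp_all
          then show ?thesis by linarith
        qed
      qed
      then show ?thesis by (simp add: algebra_simps)
    qed
    have "weighted_energy s Q \<mu> \<le> weighted_energy s Q \<nu>" using eq \<nu> by (simp add: riesz_equilibrium_def)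
    moreover define J where "J = (1 - t) * ((1 - t) * Im + t * C) + t * ((1 - t) * C + t * Is)"
    moreover have "0 \<le> J" unfolding J_def using t nn by simp
    ultimately have "Im + 2 * qm \<le> J + 2 * ((1 - t) * qm + t * qs)"
      unfolding weighted_energy_def E Qn I qm_def[symmetric] J_def[symmetric] using nn by (simp add: enn2ereal_ennreal)
    then show ?thesis by (simp add: J_def algebra_simps power2_eq_square)
  qed
  then have "0 \<le> C + qs - Im - qm" by (rule quadratic_perturbation_nonneg)
  then show ?thesis by (simp add: C_def qs_def Im_def qm_def)
qed

end

section \<open>Inequality and contact for the equilibrium potential\<close>

context riesz
begin

lemma borel_prob_bubble_measure: "0 < y \<Longrightarrow> borel_prob (bubble_measure s y (c :: 'a))"
  by (simp add: borel_prob_def prob_space_bubble_measure)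

lemma riesz_energy_bubble_measure:
  assumes "0 < y"
  shows "riesz_energy s (bubble_measure s y (c :: 'a)) < top"
proof -
  interpret prob_space "bubble_measure s y c" by (rule prob_space_bubble_measure[OF assms])
  have "riesz_energy s (bubble_measure s y c) \<le> (\<integral>\<^sup>+x. ennreal (y powr (- s)) \<partial>bubble_measure s y c)"
    unfolding riesz_energy_eq riesz_potential_bubble_measure[OF assms]
    by (intro nn_integral_mono ennreal_leI lifted_kernel_bound assms)
  also have "\<dots> < top" using emeasure_space_1 by simp
  finally show ?thesis .
qed

text \<open>A bubble is a competitor of finite weighted energy: its field term is a real number for
  every Q, since the Bochner integral of a non-integrable function is 0.\<close>

lemma equilibrium_energy_finite:
  assumes "riesz_equilibrium s Q (\<mu> :: 'a measure)"
  shows "riesz_energy s \<mu> < top"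
proof -
  have "weighted_energy s Q \<mu> \<le> weighted_energy s Q (bubble_measure s 1 0)"
    using assms borel_prob_bubble_measure[of 1 0] by (simp add: riesz_equilibrium_def)
  then show ?thesis
    using riesz_energy_bubble_measure[of 1 0]
    by (cases "riesz_energy s \<mu>"; cases "riesz_energy s (bubble_measure s 1 (0 :: 'a))")
      (auto simp: weighted_energy_def enn2ereal_ennreal top_ennreal.rep_eq)
qed

lemma lifted_potential_finite:
  assumes "finite_measure \<mu>" "sets \<mu> = sets (borel :: 'a measure)" "0 < y"
  shows "lifted_potential s y \<mu> x < top"
  using lifted_potential_bound[OF assms(3,2), of x] finite_measure.emeasure_finite[OF assms(1)]
  by (metis ennreal_less_top ennreal_mult_less_top le_less_trans less_top)

lemma lifted_kernel_tendsto:
  fixes w :: 'a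
  shows "(SUP n. ennreal (lifted_kernel s (1 / real (Suc n)) w)) = riesz_kernel s w 0"
proof (cases "w = 0")
  case True
  have "(SUP n. ennreal (lifted_kernel s (1 / real (Suc n)) (0 :: 'a))) = top"
  proof -
    have "filterlim (\<lambda>n. lifted_kernel s (1 / real (Suc n)) (0 :: 'a)) at_top sequentially"
    proof -
      have "lifted_kernel s (1 / real (Suc n)) (0 :: 'a) = real (Suc n) powr s" for n
      proof -
        have "((1 / real (Suc n))\<^sup>2) powr (- s / 2) = (1 / real (Suc n)) powr (- s)"
          using powr_powr[of "1 / real (Suc n)" 2 "- s / 2"] by simp
        then show ?thesis by (simp add: lifted_kernel_def powr_divide powr_minus_divide)
      qed
      moreover have "filterlim (\<lambda>n. real (Suc n) powr s) at_top sequentially"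
        using s_pos by (intro filterlim_compose[OF real_powr_at_top] filterlim_compose[OF filterlim_real_sequentially filterlim_Suc])
      ultimately show ?thesis by simp
    qed
    then have "\<exists>n. real k \<le> lifted_kernel s (1 / real (Suc n)) (0 :: 'a)" for k
      unfolding filterlim_at_top eventually_sequentially by blast
    then show ?thesis
      by (intro ennreal_SUP_eq_top) (simp add: ennreal_of_nat_eq_real_of_nat ennreal_leI Bex_def)
  qed
  then show ?thesis using True by (simp add: riesz_kernel_def)
next
  case False
  have "((norm w)\<^sup>2) powr (- (s / 2)) = norm w powr (- s)"
    using False powr_powr[of "norm w" 2 "- (s / 2)"] by simp
  moreover have "(\<lambda>n. lifted_kernel s (1 / real (Suc n)) w) \<longlonglongrightarrow> ((norm w)\<^sup>2 + 0\<^sup>2) powr (- s / 2)"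
    unfolding lifted_kernel_def using False LIMSEQ_inverse_real_of_nat
    by (intro tendsto_intros) (auto simp: inverse_eq_divide)
  ultimately have lim: "(\<lambda>n. ennreal (lifted_kernel s (1 / real (Suc n)) w)) \<longlonglongrightarrow> riesz_kernel s w 0"
    using False by (simp add: riesz_kernel_eq tendsto_ennrealI)
  show ?thesis
  proof (rule antisym)
    show "(SUP n. ennreal (lifted_kernel s (1 / real (Suc n)) w)) \<le> riesz_kernel s w 0"
      using lifted_kernel_le[of _ w 0] by (intro SUP_least) simp
    show "riesz_kernel s w 0 \<le> (SUP n. ennreal (lifted_kernel s (1 / real (Suc n)) w))"
      by (rule LIMSEQ_le_const2[OF lim]) (intro exI[of _ 0] allI impI SUP_upper UNIV_I)
  qed
qed

lemma lifted_kernel_mono_height: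
  fixes w :: 'a
  assumes "0 < y" "y \<le> y'"
  shows "lifted_kernel s y' w \<le> lifted_kernel s y w"
  unfolding lifted_kernel_def using assms s_pos
  by (intro powr_mono2') (auto simp: power_mono intro: add_nonneg_pos)

text \<open>Monotone convergence as the height decreases to 0. Inequalities proved for bubble
  averages thereby hold at every point in the limit.\<close>

lemma lifted_potential_SUP:
  assumes "sets \<sigma> = sets (borel :: 'a measure)"
  shows "(SUP n. lifted_potential s (1 / real (Suc n)) \<sigma> x) = riesz_potential s \<sigma> x"
proof -
  note [measurable_cong] = assms
  have "incseq (\<lambda>n t. ennreal (lifted_kernel s (1 / real (Suc n)) (x - t)))"
    by (intro incseq_SucI le_funI ennreal_leI lifted_kernel_mono_height) (auto simp: field_simps)
  then have "(\<integral>\<^sup>+t. (SUP n. ennreal (lifted_kernel s (1 / real (Suc n)) (x - t))) \<partial>\<sigma>)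
     = (SUP n. \<integral>\<^sup>+t. ennreal (lifted_kernel s (1 / real (Suc n)) (x - t)) \<partial>\<sigma>)"
    by (rule nn_integral_monotone_convergence_SUP) measurable
  then show ?thesis
    unfolding lifted_kernel_tendsto riesz_potential_def lifted_potential_def
    by (simp add: riesz_kernel_diff[symmetric])
qed

context
  fixes \<mu> P N :: "'a measure" and up un Q :: "'a \<Rightarrow> real" and F :: real
  assumes eq: "riesz_equilibrium s Q \<mu>"
    and P: "bounded_potential P up" and N: "bounded_potential N un"
    and Q: "Q = (\<lambda>x. un x - up x)"
    and F: "F = enn2real (riesz_energy s \<mu>) + (\<integral>x. Q x \<partial>\<mu>)"
begin

lemma equilibrium_prob: "borel_prob \<mu>"
  using eq by (simp add: riesz_equilibrium_def)

lemma field_integrable: "borel_prob \<sigma> \<Longrightarrow> integrable \<sigma> up \<and> integrable \<sigma> un"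
  using bounded_potential_integrable P N borel_probD by blast

text \<open>The first variation towards a bubble centred at x. The mutual energy is the lifted
  potential of \<mu>, finite even where the potential of \<mu> is \<open>top\<close>. F is the
  modified Robin constant, the value of the potential plus Q on the contact set.\<close>

lemma equilibrium_lifted_le:
  assumes y: "0 < y"
  shows "F + (\<integral>z. up z \<partial>bubble_measure s y x) \<le> enn2real (lifted_potential s y \<mu> x) + (\<integral>z. un z \<partial>bubble_measure s y x)"
proof -
  note [measurable] = bounded_potentialD(3)[OF P] bounded_potentialD(3)[OF N]
  note mu = borel_probD[OF equilibrium_prob]
  have L: "(\<integral>\<^sup>+z. riesz_potential s \<mu> z \<partial>bubble_measure s y x) = lifted_potential s y \<mu> x"
    using mu y by (intro nn_integral_potential_bubble_measure) auto
  obtain B1 where B1: "\<And>x. 0 \<le> up x \<and> up x \<le> B1" using P by (auto simp: bounded_potential_def)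
  obtain B2 where B2: "\<And>x. 0 \<le> un x \<and> un x \<le> B2" using N by (auto simp: bounded_potential_def)
  have "\<bar>Q x\<bar> \<le> B1 + B2" for x using B1[of x] B2[of x] by (auto simp: Q abs_le_iff)
  moreover have "Q \<in> borel_measurable borel" unfolding Q by measurable
  ultimately have "F \<le> enn2real (lifted_potential s y \<mu> x) + (\<integral>z. Q z \<partial>bubble_measure s y x)"
    unfolding F L[symmetric]
    by (intro first_variation[OF eq borel_prob_bubble_measure[OF y] equilibrium_energy_finite[OF eq] riesz_energy_bubble_measure[OF y]])
      (use lifted_potential_finite[OF mu(3,2) y] in \<open>auto simp: L\<close>)
  also have "(\<integral>z. Q z \<partial>bubble_measure s y x) = (\<integral>z. un z \<partial>bubble_measure s y x) - (\<integral>z. up z \<partial>bubble_measure s y x)"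
    unfolding Q using field_integrable[OF borel_prob_bubble_measure[OF y]] by (intro Bochner_Integration.integral_diff) auto
  finally show ?thesis by simp
qed

text \<open>Let y tend to 0 in \<open>equilibrium_lifted_le\<close>. The averages of the potentials
  of \<mu> and N are at most their values at x, which is the right direction on that side; on the
  other side the averages of \<open>up\<close> increase to \<open>up x\<close>.\<close>

lemma equilibrium_potential_ge: "ennreal (F + up x - un x) \<le> riesz_potential s \<mu> x"
proof (cases "riesz_potential s \<mu> x")
  case (real u)
  have le: "(\<integral>z. up z \<partial>bubble_measure s y x) \<le> u + un x - F" if y: "0 < y" for y
  proof -
    have "ennreal (\<integral>z. un z \<partial>bubble_measure s y x) \<le> ennreal (un x)"
      using lifted_potential_le[of y N x] lifted_potential_bounded_potential[OF N y] bounded_potentialD(5)[OF N] by simp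
    then have "(\<integral>z. un z \<partial>bubble_measure s y x) \<le> un x" using bounded_potentialD(4)[OF N] by simp
    moreover have "enn2real (lifted_potential s y \<mu> x) \<le> u"
      using lifted_potential_le[of y \<mu> x] real by (simp add: enn2real_leI)
    ultimately show ?thesis using equilibrium_lifted_le[OF y, of x] by linarith
  qed
  have "ennreal (up x) = (SUP n. lifted_potential s (1 / real (Suc n)) P x)"
    using lifted_potential_SUP bounded_potentialD[OF P] by simp
  also have "\<dots> \<le> ennreal (u + un x - F)"
    by (intro SUP_least) (simp add: lifted_potential_bounded_potential[OF P] le ennreal_leI)
  \<comment> \<open>Passing through \<open>ennreal\<close> loses the sign of the bound, hence the
    maximum with 0; the inequality at height 1 shows that the bound is nonnegative.\<close>
  finally have "up x \<le> max 0 (u + un x - F)"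
    using bounded_potentialD(4)[OF P, of x] by (metis ennreal_le_iff2 le_max_iff_disj)
  moreover have "0 \<le> u + un x - F"
    using le[of 1] bounded_potential_integral_nonneg[OF P, of "bubble_measure s 1 x"] by simp
  ultimately show ?thesis unfolding real by (intro ennreal_leI) auto
qed simp

text \<open>The difference of the two sides of \<open>equilibrium_potential_ge\<close> is
  nonnegative almost everywhere, and by the choice of F its integral against \<mu> is 0.\<close>

lemma equilibrium_potential_AE: "AE x in \<mu>. riesz_potential s \<mu> x = ennreal (F + up x - un x)"
proof -
  note mu = borel_probD[OF equilibrium_prob]
  note [measurable] = bounded_potentialD(3)[OF P] bounded_potentialD(3)[OF N] riesz_potential_measurable[OF mu(4,2)]
  note [measurable_cong] = mu(2)
  interpret prob_space \<mu> by (rule mu)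
  define v where "v x = enn2real (riesz_potential s \<mu> x)" for x
  have [measurable]: "v \<in> borel_measurable borel" unfolding v_def[abs_def] by measurable
  have fin: "(\<integral>\<^sup>+x. riesz_potential s \<mu> x \<partial>\<mu>) < top"
    using equilibrium_energy_finite[OF eq] by (simp add: riesz_energy_eq)
  then have ae: "AE x in \<mu>. riesz_potential s \<mu> x \<noteq> \<infinity>"
    by (intro nn_integral_PInf_AE) auto
  then have e: "AE x in \<mu>. riesz_potential s \<mu> x = ennreal (v x)"
    by eventually_elim (simp add: v_def less_top)
  have nv: "(\<integral>\<^sup>+x. ennreal (v x) \<partial>\<mu>) = riesz_energy s \<mu>"
    unfolding riesz_energy_eq using e by (intro nn_integral_cong_AE) auto
  have iv: "integrable \<mu> v"
    using nv fin by (intro integrableI_nonneg) (auto simp: v_def riesz_energy_eq)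
  have Iv: "(\<integral>x. v x \<partial>\<mu>) = enn2real (riesz_energy s \<mu>)"
    using nv by (subst integral_eq_nn_integral) (auto simp: v_def)
  note ii = field_integrable[OF equilibrium_prob]
  have "AE x in \<mu>. 0 \<le> v x - (F + up x - un x)"
    using e
  proof eventually_elim
    case (elim x)
    then have "ennreal (F + up x - un x) \<le> ennreal (v x)" using equilibrium_potential_ge[of x] by simp
    then show ?case by (simp add: ennreal_le_iff v_def)
  qed
  moreover have "(\<integral>x. v x - (F + up x - un x) \<partial>\<mu>) = 0"
    using ii iv by (simp add: prob_space Iv F Q)
  moreover have "integrable \<mu> (\<lambda>x. v x - (F + up x - un x))" using ii iv by simp
  ultimately have "AE x in \<mu>. v x - (F + up x - un x) = 0"
    using integral_nonneg_eq_0_iff_AE by blast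
  with e show ?thesis by eventually_elim simp
qed

text \<open>Equality is known only almost everywhere, so a support point itself may fail it. Each
  neighbourhood has positive mass and thus contains a contact point; this is why support is excluded
  on open sets.\<close>

lemma msupport_contact:
  assumes "x0 \<in> msupport \<mu>" "open A" "x0 \<in> A"
  obtains x where "x \<in> A" "riesz_potential s \<mu> x = ennreal (F + up x - un x)"
proof -
  note mu = borel_probD[OF equilibrium_prob]
  obtain r where r: "0 < r" "ball x0 r \<subseteq> A" using assms openE by blast
  have "\<exists>x\<in>A. riesz_potential s \<mu> x = ennreal (F + up x - un x)"
  proof (rule ccontr)
    assume no: "\<not> ?thesis"
    have "AE x in \<mu>. x \<notin> ball x0 r" using equilibrium_potential_AE by eventually_elim (use r no in auto)
    then have "emeasure \<mu> (ball x0 r) = 0"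
      by (subst (asm) AE_iff_measurable[of "ball x0 r"]) (auto simp: mu)
    then show False using assms(1) r(1) by (auto simp: msupport_def)
  qed
  then show ?thesis using that by blast
qed

end

end

section \<open>Minimum principle and barrier\<close>

context riesz
begin

lemma bounded_potential_two_bubbles:
  assumes "0 \<le> A" "0 \<le> B" "0 < y" "0 < y'"
  shows "bounded_potential (density lborel (\<lambda>z :: 'a. ennreal (A * bubble s y z + B * bubble s y' z)))
     (\<lambda>x. A * lifted_kernel s y x + B * lifted_kernel s y' x)"
proof -
  let ?p = "\<lambda>z :: 'a. ennreal (A * bubble s y z + B * bubble s y' z)"
  have nb: "0 \<le> bubble s y z" "0 \<le> bubble s y' z" for z :: 'a using assms bubble_pos by (auto intro: less_imp_le)
  have p: "?p z = ennreal A * ennreal (bubble s y z) + ennreal B * ennreal (bubble s y' z)" for z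
    using assms nb by (simp add: ennreal_mult)
  have "emeasure (density lborel ?p) (space (density lborel ?p)) = ennreal A + ennreal B"
    using nn_integral_bubble[OF s_pos s_less assms(3), of 0] nn_integral_bubble[OF s_pos s_less assms(4), of 0]
    by (simp add: emeasure_density p nn_integral_add nn_integral_cmult)
  then have "finite_measure (density lborel ?p)" by (intro finite_measureI) simp
  moreover have "riesz_potential s (density lborel ?p) x = ennreal (A * lifted_kernel s y x + B * lifted_kernel s y' x)" for x
  proof -
    have "riesz_potential s (density lborel ?p) x
      = (\<integral>\<^sup>+z. ennreal A * (riesz_kernel s x z * ennreal (bubble s y (z - 0))) + ennreal B * (riesz_kernel s x z * ennreal (bubble s y' (z - 0))) \<partial>lborel)"
      unfolding riesz_potential_def by (subst nn_integral_density) (auto simp: p distrib_left mult_ac intro!: nn_integral_cong)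
    also have "\<dots> = ennreal A * ennreal (lifted_kernel s y (x - 0)) + ennreal B * ennreal (lifted_kernel s y' (x - 0))"
      using nn_integral_riesz_kernel_bubble[OF assms(3), of x 0] nn_integral_riesz_kernel_bubble[OF assms(4), of x 0]
      by (simp add: nn_integral_add nn_integral_cmult)
    finally show ?thesis using assms by (simp add: ennreal_mult)
  qed
  moreover have "\<exists>C. \<forall>x. 0 \<le> A * lifted_kernel s y x + B * lifted_kernel s y' x \<and> A * lifted_kernel s y x + B * lifted_kernel s y' x \<le> C"
    using assms lifted_kernel_bound
    by (intro exI[of _ "A * y powr (- s) + B * y' powr (- s)"]) (auto intro!: add_mono mult_left_mono)
  ultimately show ?thesis unfolding bounded_potential_def by (intro conjI) auto
qed

end

context superharmonic_riesz
begin

text \<open>The potential of \<mu> at x dominates its own bubble average, hence the average of the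
  lower bound F + up - un, and \<open>source_estimate\<close> places that average above the value at
  x by e. The gain e depends neither on F nor on x, so it can be used repeatedly.\<close>

lemma potential_improvement:
  fixes p n up un :: "'a \<Rightarrow> real"
  assumes [measurable]: "p \<in> borel_measurable borel" "n \<in> borel_measurable borel"
    and nonneg: "\<And>z. 0 \<le> p z" "\<And>z. 0 \<le> n z"
    and P: "bounded_potential (density lborel p) up" and N: "bounded_potential (density lborel n) un"
    and \<mu>: "finite_measure \<mu>" "sets \<mu> = sets borel"
    and \<delta>: "0 < \<delta>" and m: "0 < m"
  obtains e where "0 < e"
    "\<And>F x. (\<And>z. ennreal (F + up z - un z) \<le> riesz_potential s \<mu> z) \<Longrightarrow>
       (\<And>z. z \<in> ball x \<delta> \<Longrightarrow> p z + m \<le> n z) \<Longrightarrow>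
       ennreal (F + up x - un x + e) \<le> riesz_potential s \<mu> x"
proof -
  have fin: "(\<integral>\<^sup>+z. ennreal (p z) \<partial>lborel) < top"
    using finite_measure.emeasure_finite[OF bounded_potentialD(1)[OF P], of UNIV]
    by (simp add: emeasure_density less_top)
  obtain y e where y: "0 < y" and e: "0 < e" and src:
    "\<And>x. (\<And>z. z \<in> ball x \<delta> \<Longrightarrow> p z + m \<le> n z) \<Longrightarrow>
       riesz_potential s (density lborel p) x + lifted_potential s y (density lborel n) x + ennreal e
        \<le> riesz_potential s (density lborel n) x + lifted_potential s y (density lborel p) x"
    using source_estimate[of p n \<delta> m] nonneg fin \<delta> m by auto
  show ?thesis
  proof (rule that[OF e])
    fix F x
    assume ge: "\<And>z. ennreal (F + up z - un z) \<le> riesz_potential s \<mu> z"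
      and "\<And>z. z \<in> ball x \<delta> \<Longrightarrow> p z + m \<le> n z"
    let ?M = "bubble_measure s y x"
    interpret prob_space ?M by (rule prob_space_bubble_measure[OF y])
    define LP where "LP = (\<integral>z. up z \<partial>?M)"
    define LN where "LN = (\<integral>z. un z \<partial>?M)"
    have nn: "0 \<le> LP" "0 \<le> LN" using bounded_potential_integral_nonneg P N by (auto simp: LP_def LN_def)
    have int: "integrable ?M up" "integrable ?M un"
      using bounded_potential_integrable[OF P prob_space_axioms] bounded_potential_integrable[OF N prob_space_axioms] by auto
    have "ennreal (up x) + ennreal LN + ennreal e \<le> ennreal (un x) + ennreal LP"
      using src[of x] \<open>\<And>z. z \<in> ball x \<delta> \<Longrightarrow> p z + m \<le> n z\<close>
      by (simp add: lifted_potential_bounded_potential[OF P y] lifted_potential_bounded_potential[OF N y]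
          bounded_potentialD(5)[OF P] bounded_potentialD(5)[OF N] LP_def LN_def)
    then have "up x + LN + e \<le> un x + LP"
      using nn e bounded_potentialD(4)[OF P, of x] bounded_potentialD(4)[OF N, of x]
      by (simp add: ennreal_plus[symmetric] del: ennreal_plus)
    then have "ennreal (F + up x - un x + e) \<le> ennreal (F + LP - LN)" by (intro ennreal_leI) simp
    also have "F + LP - LN = (\<integral>z. F + up z - un z \<partial>?M)"
      using int prob_space by (simp add: LP_def LN_def)
    \<comment> \<open>The lower bound under \<open>ennreal\<close> speaks only of the positive part;
      taking it makes the real and the nonnegative integral agree.\<close>
    also have "ennreal \<dots> \<le> ennreal (\<integral>z. max 0 (F + up z - un z) \<partial>?M)"
      using int by (intro ennreal_leI integral_mono) auto
    also have "\<dots> = (\<integral>\<^sup>+z. ennreal (max 0 (F + up z - un z)) \<partial>?M)"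
      using int by (intro nn_integral_eq_integral[symmetric]) auto
    also have "\<dots> \<le> (\<integral>\<^sup>+z. riesz_potential s \<mu> z \<partial>?M)"
      using ge by (intro nn_integral_mono) (auto simp: max_def)
    also have "\<dots> = lifted_potential s y \<mu> x"
      using \<mu> y finite_measure.axioms(1) by (intro nn_integral_potential_bubble_measure) auto
    also have "\<dots> \<le> riesz_potential s \<mu> x" by (rule lifted_potential_le)
    finally show "ennreal (F + up x - un x + e) \<le> riesz_potential s \<mu> x" .
  qed
qed

text \<open>Where the comparison density is negative, any gap below the potential can be improved
  by a fixed amount, so finitely many improvements close it.\<close>

lemma minimum_principle:
  fixes p n up un :: "'a \<Rightarrow> real"
  assumes "p \<in> borel_measurable borel" "n \<in> borel_measurable borel"
    and "\<And>z. 0 \<le> p z" "\<And>z. 0 \<le> n z"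
    and P: "bounded_potential (density lborel p) up" and N: "bounded_potential (density lborel n) un"
    and "finite_measure \<mu>" "sets \<mu> = sets borel" "0 < \<delta>" "0 < m"
    and src: "\<And>x z. x \<in> D \<Longrightarrow> z \<in> ball x \<delta> \<Longrightarrow> p z + m \<le> n z"
    and out: "\<And>x. x \<notin> D \<Longrightarrow> ennreal (F + up x - un x) \<le> riesz_potential s \<mu> x"
  shows "ennreal (F + up x - un x) \<le> riesz_potential s \<mu> x"
proof -
  obtain e where e: "0 < e" and improve:
    "\<And>F x. (\<And>z. ennreal (F + up z - un z) \<le> riesz_potential s \<mu> z) \<Longrightarrow>
       (\<And>z. z \<in> ball x \<delta> \<Longrightarrow> p z + m \<le> n z) \<Longrightarrow>
       ennreal (F + up x - un x + e) \<le> riesz_potential s \<mu> x"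
    using potential_improvement[OF assms(1-10)] by blast
  obtain B where B: "\<And>x. up x \<le> B" using P by (auto simp: bounded_potential_def)
  \<comment> \<open>Lowered by C, the bound is nonpositive everywhere, hence trivial under
    \<open>ennreal\<close>; the induction starts there and recovers e per step.\<close>
  define C where "C = \<bar>F\<bar> + B"
  have step: "ennreal (F - max 0 (C - real k * e) + up x - un x) \<le> riesz_potential s \<mu> x" for k x
  proof (induction k arbitrary: x)
    case 0
    have "F - max 0 (C - real 0 * e) + up x - un x \<le> 0"
      using B[of x] bounded_potentialD(4)[OF N, of x] by (auto simp: C_def)
    then show ?case by (simp only: ennreal_neg zero_le)
  next
    case (Suc k)
    show ?case
    proof (cases "x \<in> D")
      case True
      have "ennreal (F - max 0 (C - real (Suc k) * e) + up x - un x)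
        \<le> ennreal (F - max 0 (C - real k * e) + up x - un x + e)"
        using e by (intro ennreal_leI) (auto simp: algebra_simps)
      also have "\<dots> \<le> riesz_potential s \<mu> x" using Suc.IH src[OF True] by (rule improve)
      finally show ?thesis .
    next
      case False
      have "ennreal (F - max 0 (C - real (Suc k) * e) + up x - un x) \<le> ennreal (F + up x - un x)"
        by (intro ennreal_leI) auto
      then show ?thesis using out[OF False] by (rule order_trans)
    qed
  qed
  obtain k where "C < real k * e" using ex_less_of_nat_mult[OF e] by blast
  then show ?thesis using step[of k x] by simp
qed

end

text \<open>Where \<theta> is negative, h <= 0 already suffices. The remaining set L is compact and
  h is negative on it, so its maximum there is negative and a small enough c cannot spoil it. In the
  barrier, \<theta> tips the sphere on which h may vanish.\<close>

lemma negative_combination_on_compact: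
  fixes h \<theta> :: "'a::topological_space \<Rightarrow> real"
  assumes K: "compact K" and h: "continuous_on K h" and \<theta>: "continuous_on K \<theta>"
    and le: "\<And>z. z \<in> K \<Longrightarrow> h z \<le> 0" and zero: "\<And>z. z \<in> K \<Longrightarrow> h z = 0 \<Longrightarrow> \<theta> z < 0"
  obtains c where "0 < c" "\<And>z. z \<in> K \<Longrightarrow> h z + c * \<theta> z < 0"
proof -
  have "\<exists>M>0. \<forall>z\<in>K. \<bar>\<theta> z\<bar> \<le> M"
  proof -
    have "bounded (\<theta> ` K)" using compact_continuous_image[OF \<theta> K] by (rule compact_imp_bounded)
    then show ?thesis unfolding bounded_pos by auto
  qed
  then obtain M where M: "0 < M" "\<And>z. z \<in> K \<Longrightarrow> \<bar>\<theta> z\<bar> \<le> M" by auto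
  show ?thesis
  proof (cases "K = {}")
    case False
    define L where "L = {z \<in> K. 0 \<le> \<theta> z}"
    have L: "compact L"
    proof -
      have "closedin (top_of_set K) {z \<in> K. 0 \<le> \<theta> z}"
        using continuous_closedin_preimage[OF \<theta>, of "{0..}"] by (simp add: vimage_def Int_def)
      then show ?thesis using closedin_compact[OF K] by (simp add: L_def)
    qed
    show ?thesis
    proof (cases "L = {}")
      case True
      then have "\<theta> z < 0" if "z \<in> K" for z using that by (force simp: L_def)
      then show ?thesis using le by (intro that[of 1]) (auto intro: add_nonpos_neg)
    next
      case False
      have "continuous_on L h" using h by (rule continuous_on_subset) (auto simp: L_def)
      then obtain w where w: "w \<in> L" "\<And>z. z \<in> L \<Longrightarrow> h z \<le> h w"
        using continuous_attains_sup[OF L False] by blast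
      have hw: "h w < 0" using w le[of w] zero[of w] by (force simp: L_def)
      \<comment> \<open>Then c * \<theta> is at most half of -h(w), so h + c * \<theta> <= h(w) / 2
        < 0 on L.\<close>
      define c where "c = - h w / (2 * M)"
      have c: "0 < c" unfolding c_def using hw M(1) by (intro divide_pos_pos) auto
      show ?thesis
      proof (rule that[OF c])
        fix z assume z: "z \<in> K"
        show "h z + c * \<theta> z < 0"
        proof (cases "0 \<le> \<theta> z")
          case True
          then have "h z \<le> h w" using w(2) z by (simp add: L_def)
          moreover have "c * \<theta> z \<le> c * M" using M(2)[OF z] c by (intro mult_left_mono) auto
          moreover have "c * M = - h w / 2" using M by (simp add: c_def)
          ultimately show ?thesis using hw by linarith
        next
          case False
          then have "c * \<theta> z < 0" using c by (simp add: mult_pos_neg)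
          then show ?thesis using le[OF z] by linarith
        qed
      qed
    qed
  qed (use that[of 1] in auto)
qed

lemma negative_near_cball:
  fixes f :: "'a::euclidean_space \<Rightarrow> real"
  assumes f: "continuous_on UNIV f" and R: "0 < R" and neg: "\<And>z. norm z \<le> R \<Longrightarrow> f z < 0"
  obtains k m where "0 < k" "0 < m" "\<And>z. norm z \<le> R + k \<Longrightarrow> f z \<le> - m"
proof -
  have op: "open {z. f z < 0}" using f by (intro open_Collect_less) auto
  obtain e where e: "0 < e" "(\<Union>x\<in>cball 0 R. ball x e) \<subseteq> {z. f z < 0}"
  proof (rule compact_subset_open_imp_ball_epsilon_subset[OF compact_cball op])
    show "cball 0 R \<subseteq> {z. f z < 0}" using neg by auto
  qed auto
  have n: "f z < 0" if "norm z \<le> R + e / 2" for z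
  proof (cases "norm z \<le> R")
    case False
    then have z: "0 < norm z" "z \<noteq> 0" using R by auto
    \<comment> \<open>The radial projection of z to the sphere of radius R, at distance norm z - R,
      which is at most e / 2.\<close>
    let ?w = "(R / norm z) *\<^sub>R z"
    have "?w \<in> cball 0 R" using z R by simp
    moreover have "dist ?w z < e"
    proof -
      have "?w - z = (R / norm z - 1) *\<^sub>R z" by (simp add: scaleR_diff_left)
      then have "dist ?w z = \<bar>R / norm z - 1\<bar> * norm z" by (simp add: dist_norm)
      also have "\<dots> = \<bar>(R / norm z - 1) * norm z\<bar>" by (simp add: abs_mult)
      also have "(R / norm z - 1) * norm z = R - norm z" using z by (simp add: field_simps)
      finally show ?thesis using False that e by simp
    qed
    ultimately have "z \<in> (\<Union>x\<in>cball 0 R. ball x e)" by (intro UN_I[of ?w]) (simp_all only: mem_ball)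
    then show ?thesis using e(2) by blast
  qed (use neg in auto)
  have "compact (cball (0 :: 'a) (R + e / 2))" "cball (0 :: 'a) (R + e / 2) \<noteq> {}" using R e by auto
  then obtain w where w: "w \<in> cball 0 (R + e / 2)" "\<And>z. z \<in> cball 0 (R + e / 2) \<Longrightarrow> f z \<le> f w"
    using continuous_attains_sup continuous_on_subset[OF f] by (metis subset_UNIV)
  show ?thesis by (rule that[of "e / 2" "- f w"]) (use w n e in auto)
qed

lemma bubble_continuous: "0 < y \<Longrightarrow> continuous_on S (bubble s y)"
  unfolding bubble_def by (intro continuous_intros) (auto simp: add_nonneg_eq_0_iff)

context riesz
begin

lemma bubble_eq:
  "bubble s y (z :: 'a) = Gamma (real DIM('a) - s / 2) / (pi powr (real DIM('a) / 2) * Gamma ((real DIM('a) - s) / 2))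
    * (y powr (real DIM('a) - s) * ((norm z)\<^sup>2 + y\<^sup>2) powr (- (real DIM('a) - s / 2)))"
  by (simp add: bubble_def)

text \<open>Both bubbles carry the same exponent p = d - s/2, so taking p-th roots leaves an
  inequality linear in the squared norm of z. For the two charges of the field its coefficient is
  the rho of the theorem.\<close>

lemma bubble_less_iff:
  fixes z :: 'a
  assumes "0 < y" "0 < y'" "0 < A" "0 < B"
  shows "A * bubble s y z < B * bubble s y' z \<longleftrightarrow>
    (norm z)\<^sup>2 + y'\<^sup>2 < (B / A * (y' / y) powr (real DIM('a) - s)) powr (1 / (real DIM('a) - s / 2)) * ((norm z)\<^sup>2 + y\<^sup>2)"
proof -
  define p where "p = real DIM('a) - s / 2"
  define \<alpha> where "\<alpha> = real DIM('a) - s"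
  define k where "k = Gamma p / (pi powr (real DIM('a) / 2) * Gamma (\<alpha> / 2))"
  have p: "0 < p" "0 < \<alpha>" using s_pos s_less by (auto simp: p_def \<alpha>_def)
  then have k: "0 < k" by (simp add: k_def)
  define u where "u = (norm z)\<^sup>2 + y\<^sup>2"
  define v where "v = (norm z)\<^sup>2 + y'\<^sup>2"
  have uv: "0 < u" "0 < v" using assms by (auto simp: u_def v_def add_nonneg_pos)
  define q where "q = B / A * (y' / y) powr \<alpha>"
  have q: "0 < q" using assms by (simp add: q_def)
  have "A * bubble s y z < B * bubble s y' z \<longleftrightarrow> k * (A * (y powr \<alpha> * u powr (- p))) < k * (B * (y' powr \<alpha> * v powr (- p)))"
    unfolding bubble_eq u_def v_def k_def p_def \<alpha>_def by (simp add: mult_ac)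
  also have "\<dots> \<longleftrightarrow> A * (y powr \<alpha> * u powr (- p)) < B * (y' powr \<alpha> * v powr (- p))"
    using k by simp
  also have "\<dots> \<longleftrightarrow> v powr p < q * u powr p"
    using assms uv by (simp add: q_def powr_minus powr_divide divide_simps mult_ac)
  also have "q * u powr p = (q powr (1 / p) * u) powr p"
    using q p uv by (simp add: powr_mult powr_powr)
  also have "v powr p < (q powr (1 / p) * u) powr p \<longleftrightarrow> v < q powr (1 / p) * u"
  proof
    have "0 < q powr (1 / p) * u" using uv q by simp
    then show "v < q powr (1 / p) * u" if "v powr p < (q powr (1 / p) * u) powr p"
      using powr_less_cancel2[OF p(1) uv(2) _ that] by simp
    show "v powr p < (q powr (1 / p) * u) powr p" if "v < q powr (1 / p) * u"
      using powr_less_mono2[OF p(1) _ that] uv by simp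
  qed
  finally show ?thesis by (simp add: u_def v_def q_def p_def \<alpha>_def)
qed

text \<open>As \<open>ennreal\<close> sends nonpositive reals to 0, positivity is what guarantees
  that at a contact point the real value itself is positive, so that comparing
  \<open>ennreal\<close> images there compares reals.\<close>

lemma riesz_potential_pos:
  assumes "prob_space \<mu>" "sets \<mu> = sets borel"
  shows "0 < riesz_potential s \<mu> (x :: 'a)"
proof -
  interpret prob_space \<mu> by fact
  note [measurable_cong] = assms(2)
  have pos: "riesz_kernel s x t \<noteq> 0" for t by (simp add: riesz_kernel_def)
  have "riesz_potential s \<mu> x \<noteq> 0"
  proof
    assume "riesz_potential s \<mu> x = 0"
    then have "AE t in \<mu>. riesz_kernel s x t = 0"
      unfolding riesz_potential_def by (subst (asm) nn_integral_0_iff_AE) auto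
    then have "AE t in \<mu>. False" by (simp add: pos)
    then show False by simp
  qed
  then show ?thesis using not_gr_zero by blast
qed

end

context superharmonic_riesz
begin

text \<open>The factor decreases strictly with the norm of x, so a difference of the kernel at
  height R/2 and a multiple of the one at height R changes sign across at most one sphere.\<close>

lemma lifted_kernel_ratio:
  fixes x :: 'a
  assumes "0 < R"
  shows "lifted_kernel s (R / 2) x = (1 + 3 * R\<^sup>2 / (4 * (norm x)\<^sup>2 + R\<^sup>2)) powr (s / 2) * lifted_kernel s R x"
proof -
  define u where "u = (norm x)\<^sup>2 + (R / 2)\<^sup>2"
  define v where "v = (norm x)\<^sup>2 + R\<^sup>2"
  have uv: "0 < u" "0 < v" using assms by (auto simp: u_def v_def add_nonneg_pos)
  have e: "1 + 3 * R\<^sup>2 / (4 * (norm x)\<^sup>2 + R\<^sup>2) = v / u"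
  proof -
    have "4 * (norm x)\<^sup>2 + R\<^sup>2 = 4 * u" by (simp add: u_def power2_eq_square field_simps)
    moreover have "4 * u + 3 * R\<^sup>2 = 4 * v" by (simp add: u_def v_def power2_eq_square field_simps)
    ultimately show ?thesis using uv by (simp add: field_simps)
  qed
  show ?thesis
    unfolding lifted_kernel_def e u_def[symmetric] v_def[symmetric]
    using uv by (simp add: powr_divide powr_minus field_simps)
qed

text \<open>The difference of the lifted kernels at heights \<open>R / 2\<close> and \<open>R\<close>, weighted so as to vanish on a sphere
  slightly outside \<open>|z| = R\<close>, is positive inside it and negative outside, while its density is negative
  near the sphere. A small multiple of it therefore pushes the strict negativity of the density past \<open>|z| = R\<close>.\<close>

lemma barrier_exists:
  fixes A B a b R :: real
  assumes R: "0 < R" and ab: "0 < a" "0 < b"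
    and le: "\<And>z :: 'a. norm z \<le> R \<Longrightarrow> A * bubble s a z \<le> B * bubble s b z"
    and less: "\<And>z :: 'a. norm z < R \<Longrightarrow> A * bubble s a z < B * bubble s b z"
  obtains c C \<delta> m D where "0 < c" "0 < C" "0 < \<delta>" "0 < m" "cball 0 R \<subseteq> D"
    "D = {x :: 'a. C * lifted_kernel s R x < lifted_kernel s (R / 2) x}"
    "\<And>x z :: 'a. x \<in> D \<Longrightarrow> z \<in> ball x \<delta> \<Longrightarrow>
       A * bubble s a z + c * bubble s (R / 2) z + m \<le> B * bubble s b z + c * C * bubble s R z"
proof -
  define \<tau> where "\<tau> r = (1 + 3 * R\<^sup>2 / (4 * r\<^sup>2 + R\<^sup>2)) powr (s / 2)" for r :: real
  \<comment> \<open>With the factor C0 the weighted difference of lifted kernels vanishes on |x| =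
    R. The final factor C is slightly smaller, which moves the zero sphere outward.\<close>
  define C0 where "C0 = \<tau> R"
  have den: "0 < 4 * r\<^sup>2 + R\<^sup>2" for r using R by (simp add: add_nonneg_pos)
  have \<tau>_anti: "\<tau> r' < \<tau> r" if "0 \<le> r" "r < r'" for r r'
  proof -
    have "r\<^sup>2 < r'\<^sup>2" using that by (simp add: power_strict_mono)
    then have "3 * R\<^sup>2 / (4 * r'\<^sup>2 + R\<^sup>2) < 3 * R\<^sup>2 / (4 * r\<^sup>2 + R\<^sup>2)"
      using R den by (intro divide_strict_left_mono) auto
    then show ?thesis unfolding \<tau>_def using s_pos den[of r'] R by (intro powr_less_mono2) (auto intro!: add_nonneg_nonneg)
  qed
  have \<tau>_pos: "0 < \<tau> r" for r unfolding \<tau>_def using den[of r] R by (simp add: add_pos_nonneg less_imp_neq[symmetric])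
  have C0: "0 < C0" by (simp add: C0_def \<tau>_pos)
  define h where "h z = A * bubble s a z - B * bubble s b z" for z :: 'a
  define \<theta> where "\<theta> z = bubble s (R / 2) z - C0 * bubble s R z" for z :: 'a
  have R2: "0 < R / 2" using R by simp
  have cont: "continuous_on S h" "continuous_on S \<theta>" for S
    unfolding h_def \<theta>_def by (intro continuous_intros bubble_continuous ab R R2)+
  \<comment> \<open>8/5 is (R^2 + R^2) / (R^2 + R^2/4). On the sphere C0 = (8/5)^(s/2), while the
    quotient of the two bubbles is (8/5)^p / 2^\<alpha> = C0 * (4/5)^\<alpha>, which is less than
    C0: the potentials balance there but the densities do not.\<close>
  have \<theta>R: "\<theta> z < 0" if "norm z = R" for z
  proof -
    define \<alpha> where "\<alpha> = real DIM('a) - s"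
    define p where "p = real DIM('a) - s / 2"
    have \<alpha>: "0 < \<alpha>" using s_less by (simp add: \<alpha>_def)
    have "C0 = (8 / 5) powr (s / 2)"
      unfolding C0_def \<tau>_def using R by (simp add: field_simps)
    moreover have "1 * bubble s (R / 2) z < (8 / 5) powr (s / 2) * bubble s R z"
    proof -
      have p: "0 < p" using s_pos s_less by (simp add: p_def)
      have "(8 / 5 :: real) powr p = (8 / 5) powr (s / 2) * (8 / 5) powr \<alpha>"
        unfolding powr_add[symmetric] by (simp add: p_def \<alpha>_def field_simps)
      also have "\<dots> < (8 / 5) powr (s / 2) * 2 powr \<alpha>"
        using \<alpha> by (intro mult_strict_left_mono powr_less_mono2) auto
      finally have "((8 / 5 :: real) powr p) powr (1 / p) < ((8 / 5) powr (s / 2) * 2 powr \<alpha>) powr (1 / p)"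
        using p by (intro powr_less_mono2) auto
      then have q: "8 / 5 < ((8 / 5) powr (s / 2) * 2 powr \<alpha>) powr (1 / p)" using p by (simp add: powr_powr)
      have "R / (R / 2) = 2" using R by simp
      then show ?thesis
        using bubble_less_iff[of "R / 2" R 1 "(8 / 5) powr (s / 2)" z] R
        unfolding p_def[symmetric] \<alpha>_def[symmetric]
      proof -
        have "0 < R\<^sup>2 + (R / 2)\<^sup>2" using R by (simp add: add_pos_pos)
        then have "8 / 5 * (R\<^sup>2 + (R / 2)\<^sup>2) < ((8 / 5) powr (s / 2) * 2 powr \<alpha>) powr (1 / p) * (R\<^sup>2 + (R / 2)\<^sup>2)"
          using q by (intro mult_strict_right_mono)
        moreover have "8 / 5 * (R\<^sup>2 + (R / 2)\<^sup>2) = R\<^sup>2 + R\<^sup>2" by (simp add: power2_eq_square)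
        moreover note bubble_less_iff[of "R / 2" R 1 "(8 / 5) powr (s / 2)" z]
        ultimately show ?thesis using R \<open>R / (R / 2) = 2\<close> that
          unfolding p_def[symmetric] \<alpha>_def[symmetric] by simp
      qed
    qed
    ultimately show ?thesis by (simp add: \<theta>_def)
  qed
  obtain c where c: "0 < c" "\<And>z. z \<in> cball 0 R \<Longrightarrow> h z + c * \<theta> z < 0"
  proof (rule negative_combination_on_compact[of "cball 0 R" h \<theta>])
    show "h z \<le> 0" if "z \<in> cball 0 R" for z using le that by (simp add: h_def)
    show "\<theta> z < 0" if "z \<in> cball 0 R" "h z = 0" for z
      using less[of z] \<theta>R[of z] that by (force simp: h_def)
  qed (use cont in auto)
  obtain k m where km: "0 < k" "0 < m" "\<And>z. norm z \<le> R + k \<Longrightarrow> h z + c * \<theta> z \<le> - m"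
  proof (rule negative_near_cball[of "\<lambda>z. h z + c * \<theta> z" R])
    show "continuous_on UNIV (\<lambda>z. h z + c * \<theta> z)" using cont by (intro continuous_intros)
    show "norm z \<le> R \<Longrightarrow> h z + c * \<theta> z < 0" for z using c(2)[of z] by simp
  qed (use R in auto)
  define E where "E = c * bubble s R (0 :: 'a)"
  have E: "0 < E" using c bubble_pos[OF R] by (simp add: E_def)
  \<comment> \<open>The first entry keeps D inside the ball of radius R + k/2, so that balls of
    radius k/2 around its points stay within R + k. The second makes replacing C0 by C cost at most
    m/2, as E is the maximum of the bubble at height R times c.\<close>
  define C where "C = max (\<tau> (R + k / 2)) (C0 - m / (2 * E))"
  have "\<tau> (R + k / 2) < C0" unfolding C0_def using km R by (intro \<tau>_anti) auto
  then have C: "C < C0" "0 < C" "C0 - C \<le> m / (2 * E)" "\<tau> (R + k / 2) \<le> C"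
    using km E \<tau>_pos[of "R + k / 2"] by (auto simp: C_def less_max_iff_disj)
  define D where "D = {x :: 'a. C * lifted_kernel s R x < lifted_kernel s (R / 2) x}"
  have D: "x \<in> D \<longleftrightarrow> C < \<tau> (norm x)" for x
  proof -
    have "0 < lifted_kernel s R x" using R by (simp add: lifted_kernel_def add_nonneg_eq_0_iff)
    then show ?thesis by (simp add: D_def lifted_kernel_ratio[OF R] \<tau>_def)
  qed
  show ?thesis
  proof (rule that[OF c(1) C(2) _ _ _ D_def])
    show "0 < k / 2" "0 < m / 2" using km by simp_all
    show "cball 0 R \<subseteq> D"
    proof
      fix x :: 'a assume "x \<in> cball 0 R"
      then have "\<tau> R \<le> \<tau> (norm x)" using \<tau>_anti[of "norm x" R] by (cases "norm x = R") auto
      then show "x \<in> D" using C by (simp add: D C0_def)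
    qed
    fix x z :: 'a assume x: "x \<in> D" and z: "z \<in> ball x (k / 2)"
    have "norm x < R + k / 2"
    proof (rule ccontr)
      assume "\<not> ?thesis"
      then have "\<tau> (norm x) \<le> \<tau> (R + k / 2)"
        using \<tau>_anti[of "R + k / 2" "norm x"] R km by (cases "norm x = R + k / 2") auto
      then show False using C x by (simp add: D)
    qed
    moreover have "norm z \<le> norm x + dist x z" by (metis dist_norm norm_triangle_sub dist_commute)
    ultimately have "h z + c * \<theta> z \<le> - m" using z km by simp
    moreover have "c * (C0 - C) * bubble s R z \<le> m / 2"
    proof -
      have "c * bubble s R z \<le> E" unfolding E_def using c R by (intro mult_left_mono bubble_antimono) auto
      then have "(C0 - C) * (c * bubble s R z) \<le> m / (2 * E) * E"
        using C c E bubble_pos[OF R, of z] km by (intro mult_mono) auto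
      then show ?thesis using E by (simp add: mult_ac)
    qed
    ultimately show "A * bubble s a z + c * bubble s (R / 2) z + m / 2 \<le> B * bubble s b z + c * C * bubble s R z"
      by (simp add: h_def \<theta>_def algebra_simps)
  qed
qed

end

section \<open>Uniqueness\<close>

text \<open>The last hypothesis says that the integral of (f - g)^2 is at most 0, written without
  subtraction. Finiteness of the square integrals makes f and g real almost everywhere, where the
  square can be expanded.\<close>

lemma AE_eq_of_square_integrals:
  assumes [measurable]: "f \<in> borel_measurable M" "g \<in> borel_measurable M"
    and f: "(\<integral>\<^sup>+w. f w * f w \<partial>M) < top" and g: "(\<integral>\<^sup>+w. g w * g w \<partial>M) < top"
    and le: "(\<integral>\<^sup>+w. f w * f w \<partial>M) + (\<integral>\<^sup>+w. g w * g w \<partial>M) \<le> 2 * (\<integral>\<^sup>+w. f w * g w \<partial>M)"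
  shows "AE w in M. f w = (g w :: ennreal)"
proof -
  have fin: "AE w in M. f w \<noteq> top \<and> g w \<noteq> top"
  proof -
    have "AE w in M. f w * f w \<noteq> \<infinity>" "AE w in M. g w * g w \<noteq> \<infinity>"
      using f g by (intro nn_integral_PInf_AE; simp)+
    then show ?thesis by eventually_elim (auto simp: ennreal_mult_eq_top_iff)
  qed
  define D where "D w = ennreal ((enn2real (f w) - enn2real (g w))\<^sup>2)" for w
  have [measurable]: "D \<in> borel_measurable M" unfolding D_def by measurable
  have "AE w in M. D w + 2 * (f w * g w) = f w * f w + g w * g w"
    using fin
  proof eventually_elim
    case (elim w)
    obtain u v where uv: "f w = ennreal u" "0 \<le> u" "g w = ennreal v" "0 \<le> v"
      using elim by (metis ennreal_cases infinity_ennreal_def)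
    have "D w + 2 * (f w * g w) = ennreal ((u - v)\<^sup>2 + 2 * (u * v))"
      using uv by (simp add: D_def ennreal_mult[symmetric] ennreal_plus[symmetric] ennreal_numeral[symmetric] del: ennreal_plus ennreal_numeral)
    also have "(u - v)\<^sup>2 + 2 * (u * v) = u * u + v * v" by (simp add: power2_eq_square algebra_simps)
    finally show ?case using uv by (simp add: ennreal_mult[symmetric])
  qed
  then have "(\<integral>\<^sup>+w. D w + 2 * (f w * g w) \<partial>M) = (\<integral>\<^sup>+w. f w * f w + g w * g w \<partial>M)"
    by (rule nn_integral_cong_AE)
  then have eq: "(\<integral>\<^sup>+w. D w \<partial>M) + 2 * (\<integral>\<^sup>+w. f w * g w \<partial>M) = (\<integral>\<^sup>+w. f w * f w \<partial>M) + (\<integral>\<^sup>+w. g w * g w \<partial>M)"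
    by (simp add: nn_integral_add nn_integral_cmult)
  have "2 * (\<integral>\<^sup>+w. f w * g w \<partial>M) \<le> (\<integral>\<^sup>+w. f w * f w \<partial>M) + (\<integral>\<^sup>+w. g w * g w \<partial>M)"
    unfolding eq[symmetric] by (metis add.commute le_iff_add)
  then have "2 * (\<integral>\<^sup>+w. f w * g w \<partial>M) < top" using f g by (simp add: le_less_trans)
  moreover have "2 * (\<integral>\<^sup>+w. f w * g w \<partial>M) + (\<integral>\<^sup>+w. D w \<partial>M) \<le> 2 * (\<integral>\<^sup>+w. f w * g w \<partial>M) + 0"
    using le eq by (simp add: add.commute)
  ultimately have "(\<integral>\<^sup>+w. D w \<partial>M) = 0"
    by (metis ennreal_add_left_cancel_le infinity_ennreal_def le_zero_eq less_irrefl)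
  then have "AE w in M. D w = 0" by (subst (asm) nn_integral_0_iff_AE) auto
  with fin show ?thesis
  proof eventually_elim
    case (elim w)
    then have "(enn2real (f w) - enn2real (g w))\<^sup>2 \<le> 0" unfolding D_def by (metis ennreal_eq_0_iff)
    then have "enn2real (f w) = enn2real (g w)" by simp
    then show ?case using elim by (metis ennreal_enn2real_if)
  qed
qed

section \<open>Positive definiteness through a square root of the kernel\<close>

context riesz
begin

text \<open>Written with w = (v, z). The Gaussian exp(-v |x|^2) is (4v/pi)^(d/2) times the
  convolution of exp(-2v |x|^2) with itself, so integrating the product of the factors at x and t
  over all w gives Gamma(s/2) times the Riesz kernel.\<close>

definition kernel_factor :: "real \<times> 'a \<Rightarrow> 'a \<Rightarrow> ennreal" where
  "kernel_factor w x = ennreal (sqrt (gamma_weight (s / 2) (fst w) * (4 * fst w / pi) powr (real DIM('a) / 2))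
     * exp (- (2 * fst w * (norm (x - snd w))\<^sup>2)))"

lemma kernel_factor_measurable [measurable]:
  "case_prod kernel_factor \<in> borel_measurable ((lborel \<Otimes>\<^sub>M lborel) \<Otimes>\<^sub>M borel)"
  unfolding kernel_factor_def by measurable

lemma riesz_kernel_factorization:
  fixes x t :: 'a
  shows "ennreal (Gamma (s / 2)) * riesz_kernel s x t
    = (\<integral>\<^sup>+w. kernel_factor w x * kernel_factor w t \<partial>(lborel \<Otimes>\<^sub>M lborel))"
proof -
  have "(\<integral>\<^sup>+w. kernel_factor w x * kernel_factor w t \<partial>(lborel \<Otimes>\<^sub>M lborel))
     = (\<integral>\<^sup>+v. (\<integral>\<^sup>+z. kernel_factor (v, z) x * kernel_factor (v, z) t \<partial>lborel) \<partial>lborel)"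
    by (subst lborel.nn_integral_fst[symmetric]) measurable
  also have "\<dots> = (\<integral>\<^sup>+v. ennreal (gamma_weight (s / 2) v * exp (- (v * (norm (x - t))\<^sup>2))) \<partial>lborel)"
  proof (rule nn_integral_cong)
    fix v :: real
    show "(\<integral>\<^sup>+z. kernel_factor (v, z) x * kernel_factor (v, z) t \<partial>lborel)
       = ennreal (gamma_weight (s / 2) v * exp (- (v * (norm (x - t))\<^sup>2)))"
    proof (cases "0 < v")
      case True
      define W where "W = gamma_weight (s / 2) v * (4 * v / pi) powr (real DIM('a) / 2)"
      have W: "0 \<le> W" by (simp add: W_def)
      have v2: "0 < 2 * v" using True by simp
      have "(\<integral>\<^sup>+z. kernel_factor (v, z) x * kernel_factor (v, z) t \<partial>lborel)
        = (\<integral>\<^sup>+z. ennreal W * ennreal (exp (- (2 * v * (norm (x - z))\<^sup>2)) * exp (- (2 * v * (norm (z - t))\<^sup>2))) \<partial>lborel)"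
      proof (rule nn_integral_cong)
        fix z :: 'a
        define e1 where "e1 = exp (- (2 * v * (norm (x - z))\<^sup>2))"
        define e2 where "e2 = exp (- (2 * v * (norm (z - t))\<^sup>2))"
        have e: "0 \<le> e1" "0 \<le> e2" by (simp_all add: e1_def e2_def)
        have "sqrt W * e1 * (sqrt W * e2) = (sqrt W * sqrt W) * (e1 * e2)" by (simp only: mult_ac)
        also have "\<dots> = W * (e1 * e2)" using W by simp
        finally have "ennreal (sqrt W * e1) * ennreal (sqrt W * e2) = ennreal W * ennreal (e1 * e2)"
          using W e by (simp add: ennreal_mult[symmetric])
        then show "kernel_factor (v, z) x * kernel_factor (v, z) t
          = ennreal W * ennreal (exp (- (2 * v * (norm (x - z))\<^sup>2)) * exp (- (2 * v * (norm (z - t))\<^sup>2)))"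
          unfolding kernel_factor_def W_def[symmetric] fst_conv snd_conv norm_minus_commute[of t z]
            e1_def[symmetric] e2_def[symmetric] .
      qed
      also have "\<dots> = ennreal W * (\<integral>\<^sup>+z. ennreal (exp (- (2 * v * (norm (x - z))\<^sup>2)) * exp (- (2 * v * (norm (z - t))\<^sup>2))) \<partial>lborel)"
        by (rule nn_integral_cmult) measurable
      also have "(\<integral>\<^sup>+z. ennreal (exp (- (2 * v * (norm (x - z))\<^sup>2)) * exp (- (2 * v * (norm (z - t))\<^sup>2))) \<partial>lborel)
         = (\<integral>\<^sup>+z. ennreal (exp (- (2 * v * (norm (x - t - z))\<^sup>2)) * exp (- (2 * v * (norm z)\<^sup>2))) \<partial>lborel)"
      proof -
        let ?f = "\<lambda>z. ennreal (exp (- (2 * v * (norm (x - z))\<^sup>2)) * exp (- (2 * v * (norm (z - t))\<^sup>2)))"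
        have "(\<integral>\<^sup>+z. ?f z \<partial>lborel) = (\<integral>\<^sup>+z. ?f (z + t) \<partial>lborel)"
          by (rule nn_integral_lborel_translate[symmetric]) measurable
        moreover have "x - (z + t) = x - t - z" for z by simp
        ultimately show ?thesis by (simp only: add_diff_cancel_right')
      qed
      also have "\<dots> = ennreal ((pi / (2 * v + 2 * v)) powr (real DIM('a) / 2) * exp (- (2 * v * (2 * v) / (2 * v + 2 * v) * (norm (x - t))\<^sup>2)))"
        by (rule nn_integral_gaussian_mult[OF v2 v2])
      also have "2 * v * (2 * v) / (2 * v + 2 * v) = v" using True by (simp add: field_simps)
      also have "ennreal W * ennreal ((pi / (2 * v + 2 * v)) powr (real DIM('a) / 2) * exp (- (v * (norm (x - t))\<^sup>2)))
         = ennreal (gamma_weight (s / 2) v * exp (- (v * (norm (x - t))\<^sup>2)))"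
      proof -
        have "(4 * v / pi) powr (real DIM('a) / 2) * (pi / (2 * v + 2 * v)) powr (real DIM('a) / 2) = 1"
          using True by (simp add: powr_mult[symmetric])
        then have "W * ((pi / (2 * v + 2 * v)) powr (real DIM('a) / 2) * exp (- (v * (norm (x - t))\<^sup>2)))
          = gamma_weight (s / 2) v * exp (- (v * (norm (x - t))\<^sup>2))"
          unfolding W_def by (metis (no_types, lifting) mult.assoc mult.right_neutral)
        then show ?thesis using W by (subst ennreal_mult[symmetric]) simp_all
      qed
      finally show ?thesis .
    qed (simp add: gamma_weight_def kernel_factor_def)
  qed
  finally show ?thesis using riesz_kernel_gaussian[OF s_pos, of x t] by simp
qed

definition factor_potential :: "'a measure \<Rightarrow> real \<times> 'a \<Rightarrow> ennreal" where
  "factor_potential \<sigma> w = (\<integral>\<^sup>+x. kernel_factor w x \<partial>\<sigma>)"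

lemma factor_potential_measurable [measurable]:
  assumes "sigma_finite_measure \<sigma>" "sets \<sigma> = sets borel"
  shows "factor_potential \<sigma> \<in> borel_measurable (lborel \<Otimes>\<^sub>M lborel)"
proof -
  interpret sigma_finite_measure \<sigma> by fact
  note [measurable_cong] = assms(2)
  show ?thesis unfolding factor_potential_def[abs_def] by measurable
qed

lemma riesz_potential_factorization:
  assumes "sigma_finite_measure \<sigma>" "sets \<sigma> = sets borel"
  shows "ennreal (Gamma (s / 2)) * riesz_potential s \<sigma> x
    = (\<integral>\<^sup>+w. kernel_factor w x * factor_potential \<sigma> w \<partial>(lborel \<Otimes>\<^sub>M lborel))"
proof -
  note [measurable_cong] = assms(2)
  have sf: "sigma_finite_measure (lborel \<Otimes>\<^sub>M (lborel :: 'a measure))"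
    by (simp add: lborel_prod lborel.sigma_finite_measure_axioms)
  have "ennreal (Gamma (s / 2)) * riesz_potential s \<sigma> x
    = (\<integral>\<^sup>+t. (\<integral>\<^sup>+w. kernel_factor w x * kernel_factor w t \<partial>(lborel \<Otimes>\<^sub>M lborel)) \<partial>\<sigma>)"
    unfolding riesz_potential_def riesz_kernel_factorization[symmetric] by (rule nn_integral_cmult[symmetric]) measurable
  also have "\<dots> = (\<integral>\<^sup>+w. (\<integral>\<^sup>+t. kernel_factor w x * kernel_factor w t \<partial>\<sigma>) \<partial>(lborel \<Otimes>\<^sub>M lborel))"
    by (rule nn_integral_swap[OF assms(1) sf]) measurable
  also have "\<dots> = (\<integral>\<^sup>+w. kernel_factor w x * factor_potential \<sigma> w \<partial>(lborel \<Otimes>\<^sub>M lborel))"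
    unfolding factor_potential_def by (intro nn_integral_cong nn_integral_cmult) measurable
  finally show ?thesis .
qed

text \<open>Energies become L^2 inner products of the functions \<open>factor_potential\<close>, so
  that energy distance zero can be read as equality almost everywhere of these functions.\<close>

lemma mutual_energy_factorization:
  assumes \<sigma>: "sigma_finite_measure \<sigma>" "sets \<sigma> = sets borel" and \<mu>: "sigma_finite_measure \<mu>" "sets \<mu> = sets borel"
  shows "ennreal (Gamma (s / 2)) * (\<integral>\<^sup>+x. riesz_potential s \<sigma> x \<partial>\<mu>)
    = (\<integral>\<^sup>+w. factor_potential \<mu> w * factor_potential \<sigma> w \<partial>(lborel \<Otimes>\<^sub>M lborel))"
proof -
  note [measurable_cong] = \<sigma>(2) \<mu>(2) and [measurable] = riesz_potential_measurable[OF \<sigma>] factor_potential_measurable[OF \<sigma>]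
  have sf: "sigma_finite_measure (lborel \<Otimes>\<^sub>M (lborel :: 'a measure))"
    by (simp add: lborel_prod lborel.sigma_finite_measure_axioms)
  have "ennreal (Gamma (s / 2)) * (\<integral>\<^sup>+x. riesz_potential s \<sigma> x \<partial>\<mu>)
    = (\<integral>\<^sup>+x. (\<integral>\<^sup>+w. kernel_factor w x * factor_potential \<sigma> w \<partial>(lborel \<Otimes>\<^sub>M lborel)) \<partial>\<mu>)"
    unfolding riesz_potential_factorization[OF \<sigma>, symmetric] by (rule nn_integral_cmult[symmetric]) measurable
  also have "\<dots> = (\<integral>\<^sup>+w. (\<integral>\<^sup>+x. kernel_factor w x * factor_potential \<sigma> w \<partial>\<mu>) \<partial>(lborel \<Otimes>\<^sub>M lborel))"
    by (rule nn_integral_swap[OF \<mu>(1) sf]) measurable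
  also have "\<dots> = (\<integral>\<^sup>+w. factor_potential \<mu> w * factor_potential \<sigma> w \<partial>(lborel \<Otimes>\<^sub>M lborel))"
    unfolding factor_potential_def[of \<mu>] by (intro nn_integral_cong nn_integral_multc) measurable
  finally show ?thesis .
qed

text \<open>Strict positive definiteness of the energy, in the form that two measures at energy distance zero
  have the same potential.\<close>

lemma potentials_eq_of_energy:
  assumes \<sigma>: "sigma_finite_measure \<sigma>" "sets \<sigma> = sets borel" and \<mu>: "sigma_finite_measure \<mu>" "sets \<mu> = sets (borel :: 'a measure)"
    and fin: "riesz_energy s \<sigma> < top" "riesz_energy s \<mu> < top"
    and le: "riesz_energy s \<mu> + riesz_energy s \<sigma> \<le> 2 * (\<integral>\<^sup>+x. riesz_potential s \<sigma> x \<partial>\<mu>)"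
  shows "riesz_potential s \<mu> = riesz_potential s \<sigma>"
proof
  fix x
  let ?M = "lborel \<Otimes>\<^sub>M (lborel :: 'a measure)"
  let ?G = "ennreal (Gamma (s / 2))"
  have G: "0 < Gamma (s / 2)" using s_pos by simp
  note e = mutual_energy_factorization
  note [measurable] = factor_potential_measurable[OF \<sigma>] factor_potential_measurable[OF \<mu>]
  have "AE w in ?M. factor_potential \<mu> w = factor_potential \<sigma> w"
  proof (rule AE_eq_of_square_integrals)
    show "(\<integral>\<^sup>+w. factor_potential \<mu> w * factor_potential \<mu> w \<partial>?M) < top"
      unfolding e[OF \<mu> \<mu>, symmetric] riesz_energy_eq[symmetric] using fin(2) by (simp add: ennreal_mult_less_top)
    show "(\<integral>\<^sup>+w. factor_potential \<sigma> w * factor_potential \<sigma> w \<partial>?M) < top"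
      unfolding e[OF \<sigma> \<sigma>, symmetric] riesz_energy_eq[symmetric] using fin(1) by (simp add: ennreal_mult_less_top)
    show "(\<integral>\<^sup>+w. factor_potential \<mu> w * factor_potential \<mu> w \<partial>?M) + (\<integral>\<^sup>+w. factor_potential \<sigma> w * factor_potential \<sigma> w \<partial>?M)
      \<le> 2 * (\<integral>\<^sup>+w. factor_potential \<mu> w * factor_potential \<sigma> w \<partial>?M)"
      unfolding e[OF \<sigma> \<sigma>, symmetric] e[OF \<mu> \<mu>, symmetric] e[OF \<sigma> \<mu>, symmetric] riesz_energy_eq[symmetric]
      using mult_left_mono[OF le, of ?G] by (simp add: distrib_left mult.left_commute)
  qed measurable
  \<comment> \<open>The potential at each single x is an integral against
    \<open>factor_potential\<close>, so equality almost everywhere of the latter gives equality of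
    potentials everywhere.\<close>
  then have "?G * riesz_potential s \<mu> x = ?G * riesz_potential s \<sigma> x"
    unfolding riesz_potential_factorization[OF \<mu>] riesz_potential_factorization[OF \<sigma>]
    by (intro nn_integral_cong_AE) (auto elim: eventually_mono)
  then show "riesz_potential s \<mu> x = riesz_potential s \<sigma> x"
    using G by (simp add: ennreal_mult_cancel_left)
qed

end

section \<open>Recovering a measure from its potential\<close>

context superharmonic_riesz
begin

text \<open>Since \<open>U\<^sup>\<mu> - k * U\<^sup>\<mu> = gap * \<mu>\<close> and the normalised gap kernels form an approximate identity,
  the potential determines the measure.\<close>

lemma compact_le_of_potentials_eq:
  assumes \<mu>: "finite_measure \<mu>" "sets \<mu> = sets borel" and \<sigma>: "finite_measure \<sigma>" "sets \<sigma> = sets (borel :: 'a measure)"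
    and eq: "riesz_potential s \<mu> = riesz_potential s \<sigma>" and fin: "\<And>x. riesz_potential s \<sigma> x < top"
    and C: "compact C" and U: "open U" "C \<subseteq> U"
  shows "emeasure \<mu> C \<le> emeasure \<sigma> U"
proof -
  interpret \<mu>: finite_measure \<mu> by fact
  interpret \<sigma>: finite_measure \<sigma> by fact
  note [measurable_cong] = \<mu>(2) \<sigma>(2)
  have sp: "space \<mu> = UNIV" "space \<sigma> = UNIV" 
    using sets_eq_imp_space_eq[OF \<mu>(2)] sets_eq_imp_space_eq[OF \<sigma>(2)] by simp_all
  obtain e where e: "0 < e" "(\<Union>x\<in>C. ball x e) \<subseteq> U"
    using compact_subset_open_imp_ball_epsilon_subset[OF C U] by blast
  \<comment> \<open>V is the r-neighbourhood of C, and any point within r of V is within e of C and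
    so lies in U.\<close>
  define r where "r = e / 2"
  have r: "0 < r" using e by (simp add: r_def)
  define V where "V = (\<Union>x\<in>C. ball x r)"
  have V: "open V" unfolding V_def by auto
  have "bounded V"
  proof -
    obtain N where N: "\<And>x. x \<in> C \<Longrightarrow> norm x \<le> N" using compact_imp_bounded[OF C] by (auto simp: bounded_iff)
    have "V \<subseteq> ball 0 (N + r)"
    proof
      fix x assume "x \<in> V"
      then obtain c where "c \<in> C" "dist c x < r" by (auto simp: V_def)
      then show "x \<in> ball 0 (N + r)" using N[of c] dist_triangle[of 0 x c] by simp
    qed
    then show ?thesis using bounded_ball bounded_subset by blast
  qed
  then have "emeasure lborel V < top" using emeasure_bounded_finite by (simp add: less_top)
  then obtain v where v: "emeasure lborel V = ennreal v" "0 \<le> v" by (metis ennreal_cases less_irrefl)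
  have [measurable]: "V \<in> sets borel" "U \<in> sets borel" "C \<in> sets borel"
    using V U C by (auto intro: borel_compact)
  \<comment> \<open>Equal potentials have equal bubble averages, and these are finite; cancelling
    them shows that both measures have the same gap integral.\<close>
  define q where "q y x = (\<integral>\<^sup>+t. kernel_gap s y (x - t) \<partial>\<mu>)" for y and x :: 'a
  have q: "q y x = (\<integral>\<^sup>+t. kernel_gap s y (x - t) \<partial>\<sigma>)" if y: "0 < y" for y x
  proof -
    have l: "lifted_potential s y \<mu> x = lifted_potential s y \<sigma> x"
      using nn_integral_potential_bubble_measure[OF \<mu>.sigma_finite_measure_axioms \<mu>(2) y, of x]
        nn_integral_potential_bubble_measure[OF \<sigma>.sigma_finite_measure_axioms \<sigma>(2) y, of x] eq by simp
    have "lifted_potential s y \<sigma> x \<noteq> top" using lifted_potential_le[of y \<sigma> x] fin[of x] by auto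
    moreover have "lifted_potential s y \<sigma> x + q y x = lifted_potential s y \<sigma> x + (\<integral>\<^sup>+t. kernel_gap s y (x - t) \<partial>\<sigma>)"
      using riesz_potential_split[OF \<mu>(2), of x y] riesz_potential_split[OF \<sigma>(2), of x y] eq l by (metis q_def)
    ultimately show ?thesis by (simp add: ennreal_add_left_cancel)
  qed
  \<comment> \<open>Integrate q over V in two ways. Each point of C contributes at least the full
    gap mass, through the ball of radius r around it. For the other measure only points of U can
    contribute near mass, and the far part is O(y^2) times the volume v of V.\<close>
  have main: "emeasure \<mu> C * gap_mass y r \<le> emeasure \<sigma> U * gap_mass y r
      + ennreal (s / 2 * y\<^sup>2 * r powr (- s - 2)) * ennreal v * emeasure \<sigma> UNIV" if y: "0 < y" for y
  proof -
    let ?K = "ennreal (s / 2 * y\<^sup>2 * r powr (- s - 2))"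
    have ball: "(\<integral>\<^sup>+x. kernel_gap s y (x - t) * indicator (ball t r) x \<partial>lborel) = gap_mass y r" for t :: 'a
    proof -
      have "gap_mass y r = (\<integral>\<^sup>+x. kernel_gap s y (x + - t) * indicator (ball 0 r) (x + - t) \<partial>lborel)"
        unfolding gap_mass_def by (rule nn_integral_lborel_translate[symmetric]) measurable
      then show ?thesis by (simp add: indicator_def dist_norm norm_minus_commute)
    qed
    have "emeasure \<mu> C * gap_mass y r = (\<integral>\<^sup>+t. indicator C t * gap_mass y r \<partial>\<mu>)"
      by (simp add: nn_integral_multc)
    also have "\<dots> \<le> (\<integral>\<^sup>+t. (\<integral>\<^sup>+x. kernel_gap s y (x - t) * indicator V x \<partial>lborel) \<partial>\<mu>)"
    proof (rule nn_integral_mono)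
      fix t
      show "indicator C t * gap_mass y r \<le> (\<integral>\<^sup>+x. kernel_gap s y (x - t) * indicator V x \<partial>lborel)"
      proof (cases "t \<in> C")
        case True
        then have "ball t r \<subseteq> V" by (auto simp: V_def)
        then show ?thesis using True unfolding ball[of t, symmetric]
          by (auto intro!: nn_integral_mono simp: indicator_def)
      qed simp
    qed
    also have "\<dots> = (\<integral>\<^sup>+x. q y x * indicator V x \<partial>lborel)"
      unfolding q_def
      by (subst nn_integral_swap[OF \<mu>.sigma_finite_measure_axioms lborel.sigma_finite_measure_axioms])
        (auto intro!: nn_integral_cong nn_integral_multc)
    also have "\<dots> = (\<integral>\<^sup>+t. (\<integral>\<^sup>+x. kernel_gap s y (x - t) * indicator V x \<partial>lborel) \<partial>\<sigma>)"
      unfolding q[OF y]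
      by (subst nn_integral_swap[OF \<sigma>.sigma_finite_measure_axioms lborel.sigma_finite_measure_axioms])
        (auto intro!: nn_integral_cong nn_integral_multc[symmetric])
    also have "\<dots> \<le> (\<integral>\<^sup>+t. indicator U t * gap_mass y r + ?K * ennreal v \<partial>\<sigma>)"
    proof (rule nn_integral_mono)
      fix t
      have "(\<integral>\<^sup>+x. kernel_gap s y (x - t) * indicator V x \<partial>lborel)
        \<le> (\<integral>\<^sup>+x. indicator U t * (kernel_gap s y (x - t) * indicator (ball t r) x) + ?K * indicator V x \<partial>lborel)"
      proof (rule nn_integral_mono)
        fix x
        show "kernel_gap s y (x - t) * indicator V x
          \<le> indicator U t * (kernel_gap s y (x - t) * indicator (ball t r) x) + ?K * indicator V x"
        proof (cases "x \<in> V")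
          case x: True
          show ?thesis
          proof (cases "x \<in> ball t r")
            case True
            obtain c where "c \<in> C" "dist c x < r" using x by (auto simp: V_def)
            then have "dist c t < e" using True dist_triangle[of c t x] by (auto simp: r_def dist_commute)
            then have "t \<in> U" using e(2) \<open>c \<in> C\<close> by (auto simp: subset_eq)
            then show ?thesis using x True by simp
          next
            case False
            then have "kernel_gap s y (x - t) \<le> ?K"
              by (intro kernel_gap_le_far r y) (auto simp: dist_norm norm_minus_commute)
            then show ?thesis using x by (simp add: add_increasing)
          qed
        qed simp
      qed
      also have "\<dots> = indicator U t * gap_mass y r + ?K * ennreal v"
        unfolding ball[of t, symmetric] v(1)[symmetric] by (subst nn_integral_add) (simp_all add: nn_integral_cmult)
      finally show "(\<integral>\<^sup>+x. kernel_gap s y (x - t) * indicator V x \<partial>lborel) \<le> indicator U t * gap_mass y r + ?K * ennreal v" .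
    qed
    also have "\<dots> = emeasure \<sigma> U * gap_mass y r + ?K * ennreal v * emeasure \<sigma> UNIV"
      by (subst nn_integral_add) (simp_all add: nn_integral_multc sp)
    finally show ?thesis .
  qed
  define mc where "mc = measure \<mu> C"
  define su where "su = measure \<sigma> U"
  define sv where "sv = measure \<sigma> UNIV"
  have em: "emeasure \<mu> C = ennreal mc" "emeasure \<sigma> U = ennreal su" "emeasure \<sigma> UNIV = ennreal sv"
    by (simp_all add: mc_def su_def sv_def \<mu>.emeasure_eq_measure \<sigma>.emeasure_eq_measure)
  have nn: "0 \<le> mc" "0 \<le> su" "0 \<le> sv" by (simp_all add: mc_def su_def sv_def)
  define B where "B = s / 2 * r powr (- s - 2) * v * sv"
  have B: "0 \<le> B" using s_pos v nn by (simp add: B_def)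
  have "mc \<le> su + \<kappa>" if \<kappa>: "0 < \<kappa>" for \<kappa>
  proof -
    \<comment> \<open>At this height the far error B * y^2 is below \<kappa> times the gap mass G,
      so dividing the estimate by G leaves an error of at most \<kappa>.\<close>
    obtain y where y: "0 < y" "ennreal (B / \<kappa> * y\<^sup>2) < gap_mass y r" using gap_mass_dominates[OF r] by blast
    define G where "G = enn2real (gap_mass y r)"
    have G: "gap_mass y r = ennreal G" "0 \<le> G" using gap_mass_finite by (simp_all add: G_def)
    have "B / \<kappa> * y\<^sup>2 < G" using y(2) B \<kappa> unfolding G(1) by (simp add: ennreal_less_iff)
    then have BG: "B * y\<^sup>2 < \<kappa> * G" using \<kappa> by (simp add: field_simps)
    then have "0 < G" using B \<kappa> by (smt (verit) mult_nonneg_nonneg zero_le_power2 zero_less_mult_pos)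
    have "ennreal (s / 2 * y\<^sup>2 * r powr (- s - 2)) * ennreal v * ennreal sv = ennreal (B * y\<^sup>2)"
      using s_pos v nn by (simp add: ennreal_mult[symmetric] B_def mult_ac)
    then have "ennreal (mc * G) \<le> ennreal (su * G + B * y\<^sup>2)"
      using main[OF y(1)] nn G B unfolding em G(1)
      by (simp add: ennreal_mult[symmetric] ennreal_plus[symmetric] del: ennreal_plus)
    then have "mc * G \<le> su * G + B * y\<^sup>2" using nn G B by (simp del: ennreal_plus)
    then have "mc * G \<le> (su + \<kappa>) * G" using BG by (simp add: distrib_right)
    then show ?thesis using \<open>0 < G\<close> by simp
  qed
  then have "mc \<le> su" by (rule field_le_epsilon)
  then show ?thesis by (simp add: em ennreal_leI)
qed

text \<open>Inner regularity of one measure and outer regularity of the other extend the comparison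
  from compact inside open sets to all Borel sets; exchanging the measures gives equality.\<close>

lemma measure_eq_of_potentials_eq:
  assumes \<mu>: "finite_measure \<mu>" "sets \<mu> = sets borel" and \<sigma>: "finite_measure \<sigma>" "sets \<sigma> = sets (borel :: 'a measure)"
    and eq: "riesz_potential s \<mu> = riesz_potential s \<sigma>" and fin: "\<And>x. riesz_potential s \<sigma> x < top"
  shows "\<mu> = \<sigma>"
proof -
  have le: "emeasure \<mu>' A \<le> emeasure \<sigma>' A"
    if f: "finite_measure \<mu>'" "sets \<mu>' = sets borel" "finite_measure \<sigma>'" "sets \<sigma>' = sets borel"
      "riesz_potential s \<mu>' = riesz_potential s \<sigma>'" "\<And>x. riesz_potential s \<sigma>' x < top" and A: "A \<in> sets borel"
    for \<mu>' \<sigma>' :: "'a measure" and A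
  proof -
    have m: "emeasure \<mu>' (space \<mu>') \<noteq> \<infinity>" "emeasure \<sigma>' (space \<sigma>') \<noteq> \<infinity>"
      using finite_measure.emeasure_finite[OF f(1)] finite_measure.emeasure_finite[OF f(3)] by auto
    have "emeasure \<mu>' C \<le> emeasure \<sigma>' A" if C: "C \<subseteq> A" "compact C" for C
    proof -
      have "emeasure \<mu>' C \<le> (INF U \<in> {U. A \<subseteq> U \<and> open U}. emeasure \<sigma>' U)"
        using C by (intro INF_greatest compact_le_of_potentials_eq[OF f C(2)]) auto
      also have "\<dots> = emeasure \<sigma>' A" using outer_regular[OF f(4) m(2) A] by simp
      finally show ?thesis .
    qed
    then show ?thesis unfolding inner_regular[OF f(2) m(1) A] by (intro SUP_least) auto
  qed
  show ?thesis
  proof (rule measure_eqI)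
    show "sets \<mu> = sets \<sigma>" using \<mu> \<sigma> by simp
    fix A assume "A \<in> sets \<mu>"
    then have "A \<in> sets borel" using \<mu> by simp
    then show "emeasure \<mu> A = emeasure \<sigma> A"
      using le[OF \<mu> \<sigma> eq fin] le[OF \<sigma> \<mu> eq[symmetric]] fin eq by (intro antisym) auto
  qed
qed

end

section \<open>Support of the equilibrium measure\<close>

lemma lifted_kernel_continuous: "0 < y \<Longrightarrow> continuous_on S (lifted_kernel s y)"
  unfolding lifted_kernel_def by (intro continuous_intros) (auto simp: add_nonneg_eq_0_iff)

context riesz
begin

text \<open>The negation of the strict version with the two bubbles exchanged; the root occurring
  there is the reciprocal of the one here.\<close>

lemma bubble_le_iff:
  fixes z :: 'a
  assumes pos: "0 < y" "0 < y'" "0 < A" "0 < B"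
  shows "A * bubble s y z \<le> B * bubble s y' z \<longleftrightarrow>
    (norm z)\<^sup>2 + y'\<^sup>2 \<le> (B / A * (y' / y) powr (real DIM('a) - s)) powr (1 / (real DIM('a) - s / 2)) * ((norm z)\<^sup>2 + y\<^sup>2)"
proof -
  define q where "q = B / A * (y' / y) powr (real DIM('a) - s)"
  define q' where "q' = A / B * (y / y') powr (real DIM('a) - s)"
  define k where "k = 1 / (real DIM('a) - s / 2)"
  have q: "0 < q" "0 < q'" using pos by (simp_all add: q_def q'_def)
  have "(y' / y) powr (real DIM('a) - s) * (y / y') powr (real DIM('a) - s) = 1"
    using pos by (simp add: powr_mult[symmetric])
  then have "q * q' = 1" using pos by (simp add: q_def q'_def)
  then have "q powr k * q' powr k = 1" using q by (simp add: powr_mult[symmetric])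
  then have q'k: "q' powr k = 1 / q powr k" using q by (simp add: field_simps)
  have "A * bubble s y z \<le> B * bubble s y' z \<longleftrightarrow> \<not> B * bubble s y' z < A * bubble s y z"
    by (simp only: not_less)
  also have "\<dots> \<longleftrightarrow> \<not> (norm z)\<^sup>2 + y\<^sup>2 < q' powr k * ((norm z)\<^sup>2 + y'\<^sup>2)"
    unfolding bubble_less_iff[OF pos(2,1,4,3)] q'_def k_def ..
  also have "\<dots> \<longleftrightarrow> (norm z)\<^sup>2 + y'\<^sup>2 \<le> q powr k * ((norm z)\<^sup>2 + y\<^sup>2)"
    unfolding q'k using q by (simp add: not_less field_simps)
  finally show ?thesis by (simp add: q_def k_def)
qed

end

context superharmonic_riesz
begin

context
  fixes \<mu> :: "'a measure" and Q :: "'a \<Rightarrow> real" and A B a b :: real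
  assumes eq: "riesz_equilibrium s Q \<mu>"
    and pos: "0 < A" "0 < B" "0 < a" "0 < b"
    and Q: "Q = (\<lambda>x. B * lifted_kernel s b x - A * lifted_kernel s a x)"
begin

text \<open>Written with a second bubble of coefficient 0, so that
  \<open>bounded_potential_two_bubbles\<close> applies verbatim to a single charge.\<close>

private abbreviation "P \<equiv> density lborel (\<lambda>z :: 'a. ennreal (A * bubble s a z + 0 * bubble s a z))"
private abbreviation "N \<equiv> density lborel (\<lambda>z :: 'a. ennreal (B * bubble s b z + 0 * bubble s b z))"
private abbreviation "up \<equiv> \<lambda>x :: 'a. A * lifted_kernel s a x + 0 * lifted_kernel s a x"
private abbreviation "un \<equiv> \<lambda>x :: 'a. B * lifted_kernel s b x + 0 * lifted_kernel s b x"

lemma two_bubble_PN: "bounded_potential P up" "bounded_potential N un"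
  by (rule bounded_potential_two_bubbles; use pos in simp)+

lemma Q_eq: "Q = (\<lambda>x. un x - up x)"
  by (simp add: Q)

private definition "F = enn2real (riesz_energy s \<mu>) + (\<integral>x. Q x \<partial>\<mu>)"

lemma contact_point:
  assumes "x0 \<in> msupport \<mu>" "open S" "x0 \<in> S"
  obtains x where "x \<in> S" "riesz_potential s \<mu> x = ennreal (F + A * lifted_kernel s a x - B * lifted_kernel s b x)"
    "0 < F + A * lifted_kernel s a x - B * lifted_kernel s b x"
proof -
  obtain x where x: "x \<in> S" "riesz_potential s \<mu> x = ennreal (F + up x - un x)"
    using msupport_contact[OF eq two_bubble_PN Q_eq F_def assms] .
  moreover have "0 < riesz_potential s \<mu> x"
    using borel_probD[OF equilibrium_prob[OF eq two_bubble_PN Q_eq F_def]] by (intro riesz_potential_pos) auto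
  ultimately show ?thesis using that by simp
qed

lemma potential_ge: "ennreal (F + A * lifted_kernel s a x - B * lifted_kernel s b x) \<le> riesz_potential s \<mu> x"
  using equilibrium_potential_ge[OF eq two_bubble_PN Q_eq F_def, of x] by simp

lemma finite_equilibrium: "finite_measure \<mu>" "sets \<mu> = sets borel"
  using borel_probD eq by (auto simp: riesz_equilibrium_def)

lemma bubble_nonneg: "0 < y \<Longrightarrow> 0 \<le> bubble s y (z :: 'a)"
  using bubble_pos less_imp_le by blast

text \<open>A contact point within \<delta> of x0 would, by \<open>potential_improvement\<close>,
  have a potential exceeding its contact value by e. The radius 2\<delta> leaves room for a ball of
  radius \<delta> around that contact point.\<close>

lemma not_in_support_if_negative:
  assumes \<delta>: "0 < \<delta>" and less: "\<And>z. z \<in> cball x0 (2 * \<delta>) \<Longrightarrow> A * bubble s a z < B * bubble s b z"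
  shows "x0 \<notin> msupport \<mu>"
proof
  assume x0: "x0 \<in> msupport \<mu>"
  have cont: "continuous_on (cball x0 (2 * \<delta>)) (\<lambda>z. B * bubble s b z - A * bubble s a z)"
    by (intro continuous_intros bubble_continuous pos)
  have "cball x0 (2 * \<delta>) \<noteq> {}" using \<delta> by simp
  then obtain w where w: "w \<in> cball x0 (2 * \<delta>)"
    "\<And>z. z \<in> cball x0 (2 * \<delta>) \<Longrightarrow> B * bubble s b w - A * bubble s a w \<le> B * bubble s b z - A * bubble s a z"
    using continuous_attains_inf[OF compact_cball _ cont] by blast
  define m where "m = B * bubble s b w - A * bubble s a w"
  have m: "0 < m" using less w(1) by (simp add: m_def)
  have nn: "0 \<le> A * bubble s a z + 0 * bubble s a z" "0 \<le> B * bubble s b z + 0 * bubble s b z" for z :: 'a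
    using pos bubble_nonneg by simp_all
  obtain e where e: "0 < e" and improve:
    "\<And>F x. (\<And>z. ennreal (F + up z - un z) \<le> riesz_potential s \<mu> z) \<Longrightarrow>
       (\<And>z. z \<in> ball x \<delta> \<Longrightarrow> (A * bubble s a z + 0 * bubble s a z) + m \<le> B * bubble s b z + 0 * bubble s b z) \<Longrightarrow>
       ennreal (F + up x - un x + e) \<le> riesz_potential s \<mu> x"
    by (rule potential_improvement[OF _ _ nn two_bubble_PN finite_equilibrium \<delta> m]) auto
  obtain x where x: "x \<in> ball x0 \<delta>" "riesz_potential s \<mu> x = ennreal (F + A * lifted_kernel s a x - B * lifted_kernel s b x)"
    "0 < F + A * lifted_kernel s a x - B * lifted_kernel s b x"
    by (rule contact_point[OF x0, of "ball x0 \<delta>"]) (use \<delta> in auto)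
  have "ennreal (F + up x - un x + e) \<le> riesz_potential s \<mu> x"
  proof (rule improve)
    show "ennreal (F + up z - un z) \<le> riesz_potential s \<mu> z" for z using potential_ge[of z] by simp
    fix z assume "z \<in> ball x \<delta>"
    then have "z \<in> cball x0 (2 * \<delta>)" using x(1) dist_triangle[of x0 z x] by simp
    from w(2)[OF this] show "(A * bubble s a z + 0 * bubble s a z) + m \<le> B * bubble s b z + 0 * bubble s b z"
      by (simp add: m_def)
  qed
  then show False using x e by simp
qed

lemma support_subset_cball:
  assumes less: "\<And>z :: 'a. R < norm z \<Longrightarrow> A * bubble s a z < B * bubble s b z"
  shows "msupport \<mu> \<subseteq> cball 0 R"
proof (rule ccontr)
  assume "\<not> ?thesis"
  then obtain x0 where "x0 \<in> msupport \<mu>" "x0 \<notin> cball 0 R" by blast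
  then have x0: "x0 \<in> msupport \<mu>" "R < norm x0" by simp_all
  define \<delta> where "\<delta> = (norm x0 - R) / 3"
  have \<delta>: "0 < \<delta>" using x0 by (simp add: \<delta>_def)
  have "x0 \<notin> msupport \<mu>"
  proof (rule not_in_support_if_negative[OF \<delta>])
    fix z assume "z \<in> cball x0 (2 * \<delta>)"
    then have "norm x0 - norm z \<le> 2 * \<delta>" using norm_triangle_ineq2[of x0 z] by (simp add: dist_norm)
    then show "A * bubble s a z < B * bubble s b z" using x0 by (intro less) (simp add: \<delta>_def field_simps)
  qed
  then show False using x0 by simp
qed

text \<open>The barrier raises the comparison potential on the open set D, which contains the closed
  ball, and does not raise it outside D. By the minimum principle the raised function still lies
  below the potential of \<mu>, so D has no contact point. Strictness is assumed only in the open
  ball, since the density may vanish on the sphere.\<close>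

lemma support_avoids_cball:
  assumes R: "0 < R" and le: "\<And>z :: 'a. norm z \<le> R \<Longrightarrow> A * bubble s a z \<le> B * bubble s b z"
    and less: "\<And>z :: 'a. norm z < R \<Longrightarrow> A * bubble s a z < B * bubble s b z"
  shows "msupport \<mu> \<subseteq> - cball 0 R"
proof (rule ccontr)
  assume "\<not> ?thesis"
  then obtain x0 where x0: "x0 \<in> msupport \<mu>" "x0 \<in> cball 0 R" by blast
  obtain c C \<delta> m D where b: "0 < c" "0 < C" "0 < \<delta>" "0 < m" "cball 0 R \<subseteq> D"
    and D: "D = {x :: 'a. C * lifted_kernel s R x < lifted_kernel s (R / 2) x}"
    and src: "\<And>x z :: 'a. x \<in> D \<Longrightarrow> z \<in> ball x \<delta> \<Longrightarrow>
       A * bubble s a z + c * bubble s (R / 2) z + m \<le> B * bubble s b z + c * C * bubble s R z"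
    using barrier_exists[OF R pos(3,4) le less] by blast
  have R2: "0 < R / 2" using R by simp
  have cC: "0 < c * C" using b by simp
  define p where "p z = A * bubble s a z + c * bubble s (R / 2) z" for z :: 'a
  define n where "n z = B * bubble s b z + c * C * bubble s R z" for z :: 'a
  define up' where "up' x = A * lifted_kernel s a x + c * lifted_kernel s (R / 2) x" for x :: 'a
  define un' where "un' x = B * lifted_kernel s b x + c * C * lifted_kernel s R x" for x :: 'a
  have pn: "bounded_potential (density lborel p) up'" "bounded_potential (density lborel n) un'"
    unfolding p_def n_def up'_def un'_def using pos b cC R R2
    by (auto intro!: bounded_potential_two_bubbles)
  have nn: "0 \<le> p z" "0 \<le> n z" for z
    unfolding p_def n_def using pos b cC R R2 bubble_nonneg
    by (auto intro!: add_nonneg_nonneg mult_nonneg_nonneg)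
  have [measurable]: "p \<in> borel_measurable borel" "n \<in> borel_measurable borel"
    unfolding p_def[abs_def] n_def[abs_def] by measurable
  have ge: "ennreal (F + up' x - un' x) \<le> riesz_potential s \<mu> x" for x
  proof (rule minimum_principle[OF _ _ nn pn finite_equilibrium b(3,4)])
    show "p z + m \<le> n z" if "x \<in> D" "z \<in> ball x \<delta>" for x z using src[OF that] by (simp add: p_def n_def)
    fix x assume "x \<notin> D"
    then have "c * lifted_kernel s (R / 2) x \<le> c * (C * lifted_kernel s R x)" using b by (simp add: D not_less)
    then have "ennreal (F + up' x - un' x) \<le> ennreal (F + A * lifted_kernel s a x - B * lifted_kernel s b x)"
      by (intro ennreal_leI) (simp add: up'_def un'_def)
    also have "\<dots> \<le> riesz_potential s \<mu> x" by (rule potential_ge)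
    finally show "ennreal (F + up' x - un' x) \<le> riesz_potential s \<mu> x" .
  qed measurable
  have "open D" unfolding D
    by (intro open_Collect_less continuous_intros lifted_kernel_continuous R R2)
  then obtain x where x: "x \<in> D" "riesz_potential s \<mu> x = ennreal (F + A * lifted_kernel s a x - B * lifted_kernel s b x)"
    "0 < F + A * lifted_kernel s a x - B * lifted_kernel s b x"
    using contact_point[OF x0(1)] x0(2) b(5) by blast
  have "c * (C * lifted_kernel s R x) < c * lifted_kernel s (R / 2) x" using x(1) b by (simp add: D)
  then show False using ge[of x] x by (simp add: up'_def un'_def)
qed

text \<open>The density integrates to A - B = 1, so \<eta> is itself an admissible competitor. Since
  Q is minus the potential of \<eta>, minimality against it reads I(\<mu>) + I(\<eta>) <= 2 *
  (mutual energy), the hypothesis of \<open>potentials_eq_of_energy\<close>; bounded potentials then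
  determine the measure.\<close>

lemma equilibrium_is_balanced:
  assumes AB: "A - B = 1" and le: "\<And>z :: 'a. B * bubble s b z \<le> A * bubble s a z"
  shows "\<mu> = density lborel (\<lambda>z. ennreal (A * bubble s a z - B * bubble s b z))"
    and "riesz_potential s \<mu> x = ennreal (A * lifted_kernel s a x - B * lifted_kernel s b x)"
    and "0 \<le> A * lifted_kernel s a x - B * lifted_kernel s b x"
proof -
  define h where "h z = A * bubble s a z - B * bubble s b z" for z :: 'a
  define u where "u x = A * lifted_kernel s a x - B * lifted_kernel s b x" for x :: 'a
  define \<eta> where "\<eta> = density lborel (\<lambda>z. ennreal (h z))"
  have [measurable]: "h \<in> borel_measurable borel" "u \<in> borel_measurable borel"
    unfolding h_def[abs_def] u_def[abs_def] by measurable
  \<comment> \<open>The second bubble is added back rather than subtracted: mass and potential of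
    \<eta> come from additive identities in \<open>ennreal\<close>, and \<open>cancel\<close> undoes
    the addition at the end.\<close>
  have split: "ennreal (h z) + ennreal B * ennreal (bubble s b z) = ennreal A * ennreal (bubble s a z)" for z
    using le[of z] pos bubble_nonneg[of b z] bubble_nonneg[of a z]
    by (simp add: h_def ennreal_mult[symmetric] ennreal_plus[symmetric] del: ennreal_plus)
  have cancel: "i = ennreal (v - w) \<and> 0 \<le> v - w" if "i + ennreal w = ennreal v" "0 \<le> w" "0 \<le> v" for i v w
    using that by (cases i) (auto simp: ennreal_plus[symmetric] simp del: ennreal_plus)
  have "(\<integral>\<^sup>+z. ennreal (h z) \<partial>lborel) + ennreal B = ennreal A"
  proof -
    have "(\<integral>\<^sup>+z. ennreal (h z) + ennreal B * ennreal (bubble s b z) \<partial>lborel) = (\<integral>\<^sup>+z. ennreal A * ennreal (bubble s a (z :: 'a)) \<partial>lborel)"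
      by (simp only: split)
    then show ?thesis
      using nn_integral_bubble[OF s_pos s_less pos(3), of 0] nn_integral_bubble[OF s_pos s_less pos(4), of 0]
      by (simp add: nn_integral_add nn_integral_cmult)
  qed
  then have "(\<integral>\<^sup>+z. ennreal (h z) \<partial>lborel) = 1" using cancel pos AB by fastforce
  then have prob: "borel_prob \<eta>"
    by (auto simp: \<eta>_def borel_prob_def emeasure_density intro!: prob_spaceI)
  have U: "riesz_potential s \<eta> x = ennreal (u x) \<and> 0 \<le> u x" for x
  proof -
    have "(\<integral>\<^sup>+z. ennreal (h z) * riesz_kernel s x z + ennreal B * (riesz_kernel s x z * ennreal (bubble s b (z - 0))) \<partial>lborel)
       = (\<integral>\<^sup>+z. ennreal A * (riesz_kernel s x z * ennreal (bubble s a (z - 0))) \<partial>lborel)"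
    proof (rule nn_integral_cong)
      fix z
      have "ennreal (h z) * riesz_kernel s x z + ennreal B * (riesz_kernel s x z * ennreal (bubble s b (z - 0)))
        = (ennreal (h z) + ennreal B * ennreal (bubble s b z)) * riesz_kernel s x z" by (simp add: distrib_right distrib_left mult_ac)
      then show "ennreal (h z) * riesz_kernel s x z + ennreal B * (riesz_kernel s x z * ennreal (bubble s b (z - 0)))
        = ennreal A * (riesz_kernel s x z * ennreal (bubble s a (z - 0)))" unfolding split by (simp add: mult_ac)
    qed
    then have "(\<integral>\<^sup>+z. ennreal (h z) * riesz_kernel s x z \<partial>lborel) + ennreal B * ennreal (lifted_kernel s b (x - 0))
      = ennreal A * ennreal (lifted_kernel s a (x - 0))"
      using nn_integral_riesz_kernel_bubble[OF pos(3), of x 0] nn_integral_riesz_kernel_bubble[OF pos(4), of x 0]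
      by (simp add: nn_integral_add nn_integral_cmult)
    moreover have "riesz_potential s \<eta> x = (\<integral>\<^sup>+z. ennreal (h z) * riesz_kernel s x z \<partial>lborel)"
      unfolding riesz_potential_def \<eta>_def by (subst nn_integral_density) auto
    ultimately have "riesz_potential s \<eta> x + ennreal (B * lifted_kernel s b x) = ennreal (A * lifted_kernel s a x)"
      using pos by (simp add: ennreal_mult)
    then show ?thesis unfolding u_def using pos by (intro cancel) auto
  qed
  have bp: "bounded_potential \<eta> u"
  proof -
    have "u x \<le> A * a powr (- s)" for x
    proof -
      have "A * lifted_kernel s a x \<le> A * a powr (- s)"
        using pos by (intro mult_left_mono lifted_kernel_bound) auto
      moreover have "0 \<le> B * lifted_kernel s b x" using pos by simp
      ultimately show ?thesis by (simp add: u_def)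
    qed
    then show ?thesis using borel_probD[OF prob] U unfolding bounded_potential_def by auto
  qed
  have \<mu>: "borel_prob \<mu>" using eq by (simp add: riesz_equilibrium_def)
  note mu = borel_probD[OF \<mu>] and et = borel_probD[OF prob]
  have mut: "(\<integral>\<^sup>+x. riesz_potential s \<eta> x \<partial>\<tau>) = ennreal (\<integral>x. u x \<partial>\<tau>)" if "borel_prob \<tau>" for \<tau>
    using bounded_potential_integrable[OF bp borel_probD(1,2)[OF that]] U
    by (simp add: nn_integral_eq_integral)
  have Ie: "riesz_energy s \<eta> = ennreal (\<integral>x. u x \<partial>\<eta>)" using mut[OF prob] by (simp add: riesz_energy_eq)
  have finm: "riesz_energy s \<mu> < top" by (rule equilibrium_energy_finite[OF eq])
  define Im where "Im = enn2real (riesz_energy s \<mu>)"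
  have Im: "riesz_energy s \<mu> = ennreal Im" "0 \<le> Im" using finm by (simp_all add: Im_def)
  have nn: "0 \<le> (\<integral>x. u x \<partial>\<tau>)" for \<tau> using bounded_potential_integral_nonneg[OF bp] .
  have Qu: "Q = (\<lambda>x. - u x)" by (simp add: Q u_def)
  have "weighted_energy s Q \<mu> \<le> weighted_energy s Q \<eta>" using eq prob by (simp add: riesz_equilibrium_def)
  then have "Im + (\<integral>x. u x \<partial>\<eta>) \<le> 2 * (\<integral>x. u x \<partial>\<mu>)"
    unfolding weighted_energy_def Ie Im(1) Qu using Im(2) nn by (simp add: enn2ereal_ennreal)
  then have "ennreal (Im + (\<integral>x. u x \<partial>\<eta>)) \<le> ennreal (2 * (\<integral>x. u x \<partial>\<mu>))" by (rule ennreal_leI)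
  then have "riesz_energy s \<mu> + riesz_energy s \<eta> \<le> 2 * (\<integral>\<^sup>+x. riesz_potential s \<eta> x \<partial>\<mu>)"
    unfolding Ie Im(1) mut[OF \<mu>] using Im(2) nn by (simp add: ennreal_mult)
  then have peq: "riesz_potential s \<mu> = riesz_potential s \<eta>"
    using mu et finm Ie by (intro potentials_eq_of_energy) auto
  then show "\<mu> = density lborel (\<lambda>z. ennreal (A * bubble s a z - B * bubble s b z))"
    using measure_eq_of_potentials_eq[OF mu(3,2) et(3,2) peq] U unfolding \<eta>_def h_def by simp
  show "riesz_potential s \<mu> x = ennreal (A * lifted_kernel s a x - B * lifted_kernel s b x)"
    and "0 \<le> A * lifted_kernel s a x - B * lifted_kernel s b x"
    using peq U[of x] by (simp_all add: u_def)
qed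

text \<open>The potential of \<mu> is exactly -Q at every point, so the constant is 0 and the
  exceptional set is empty; as \<mu> is positive, the negative part is the null measure.\<close>

lemma signed_equilibrium_of_balanced:
  assumes "A - B = 1" and "\<And>z :: 'a. B * bubble s b z \<le> A * bubble s a z"
  shows "signed_equilibrium s Q \<mu> (null_measure borel)"
proof -
  have \<mu>: "borel_prob \<mu>" using eq by (simp add: riesz_equilibrium_def)
  have "finite_measure (null_measure (borel :: 'a measure))" by (rule finite_measureI) simp
  moreover have "measure \<mu> UNIV = 1" using borel_probD(5)[OF \<mu>] by (simp add: measure_def)
  moreover have "cap_zero s ({} :: 'a set)" by (simp add: cap_zero_def)
  moreover have "riesz_potential s (null_measure borel) x = 0" for x :: 'a
    unfolding riesz_potential_def by (simp add: nn_integral_null_measure)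
  moreover have "riesz_energy s (null_measure (borel :: 'a measure)) = 0"
    unfolding riesz_energy_def by (simp add: nn_integral_null_measure)
  ultimately show ?thesis
    using borel_probD[OF \<mu>] equilibrium_energy_finite[OF eq] equilibrium_is_balanced(2,3)[OF assms]
    unfolding signed_equilibrium_def qe_on_def
    by (auto intro!: exI[of _ "0 :: real"] exI[of _ "{} :: 'a set"] simp: Q)
qed

text \<open>The density is nonnegative and vanishes on no ball: equality of the bubbles on points of
  two different norms, inserted in a relation linear in the squared norm, forces \<rho> = 1, hence a
  = b, which contradicts A > B.\<close>

lemma support_UNIV_of_balanced:
  assumes AB: "A - B = 1" and le: "\<And>z :: 'a. B * bubble s b z \<le> A * bubble s a z"
  shows "msupport \<mu> = UNIV"
proof -
  have dense: "\<exists>z\<in>ball x e. B * bubble s b z < A * bubble s a z" if e: "0 < e" for x :: 'a and e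
  proof (rule ccontr)
    assume "\<not> ?thesis"
    then have ge: "\<And>z. z \<in> ball x e \<Longrightarrow> A * bubble s a z \<le> B * bubble s b z" by (auto simp: not_less)
    define \<rho> where "\<rho> = (A / B * (a / b) powr (real DIM('a) - s)) powr (1 / (real DIM('a) - s / 2))"
    have eqz: "(norm z)\<^sup>2 + a\<^sup>2 = \<rho> * ((norm z)\<^sup>2 + b\<^sup>2)" if "z \<in> ball x e" for z
      using bubble_le_iff[OF pos(4,3,2,1), of z] bubble_less_iff[OF pos(4,3,2,1), of z] le[of z] ge[OF that]
      unfolding \<rho>_def by linarith
    obtain z where z: "z \<in> ball x e" "norm z \<noteq> norm x"
    proof (cases "x = 0")
      case True
      obtain w :: 'a where "norm w = e / 2" using vector_choose_size[of "e / 2"] e by auto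
      moreover from this have "w \<noteq> 0" using e by auto
      ultimately show ?thesis using that[of w] True e by simp
    next
      case False
      define k where "k = e / (2 * norm x)"
      have k: "0 < k" "k * norm x = e / 2" using False e by (simp_all add: k_def)
      have "x - (1 + k) *\<^sub>R x = - k *\<^sub>R x" by (simp add: algebra_simps)
      then have "dist x ((1 + k) *\<^sub>R x) = k * norm x" using k by (simp add: dist_norm)
      moreover have "norm ((1 + k) *\<^sub>R x) = norm x + k * norm x" using k by (simp add: distrib_right)
      ultimately show ?thesis using that[of "(1 + k) *\<^sub>R x"] k e by simp
    qed
    have "(norm z)\<^sup>2 - (norm x)\<^sup>2 = \<rho> * ((norm z)\<^sup>2 - (norm x)\<^sup>2)"
      using eqz[OF z(1)] eqz[of x] e by (simp add: algebra_simps)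
    moreover have "(norm z)\<^sup>2 \<noteq> (norm x)\<^sup>2" using z(2) by (simp add: power2_eq_iff_nonneg)
    ultimately have "\<rho> = 1" by simp
    then have "a\<^sup>2 = b\<^sup>2" using eqz[OF z(1)] by simp
    then have "a = b" using pos by (simp add: power2_eq_iff_nonneg)
    then have "A * bubble s a x \<le> B * bubble s a x" using ge[of x] e by simp
    then show False using AB bubble_pos[OF pos(3), of x] by simp
  qed
  have "0 < emeasure \<mu> (ball x e)" if e: "0 < e" for x e
  proof -
    define S where "S = ball x e \<inter> {z. B * bubble s b z < A * bubble s a z}"
    have "open {z :: 'a. B * bubble s b z < A * bubble s a z}"
      by (intro open_Collect_less continuous_intros bubble_continuous pos)
    then have S: "open S" unfolding S_def by auto
    then have [measurable]: "S \<in> sets borel" by simp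
    have "S \<noteq> {}" using dense[OF e, of x] by (auto simp: S_def)
    then have lS: "0 < emeasure lborel S" using emeasure_lborel_open_pos[OF S] by blast
    have "emeasure \<mu> S = (\<integral>\<^sup>+z. ennreal (A * bubble s a z - B * bubble s b z) * indicator S z \<partial>lborel)"
      by (subst equilibrium_is_balanced(1)[OF assms]) (simp add: emeasure_density)
    moreover have "\<dots> \<noteq> 0"
    proof
      assume "(\<integral>\<^sup>+z. ennreal (A * bubble s a z - B * bubble s b z) * indicator S z \<partial>lborel) = 0"
      then have "AE z in lborel. ennreal (A * bubble s a z - B * bubble s b z) * indicator S z = 0"
        by (subst (asm) nn_integral_0_iff_AE) auto
      then have "AE z in lborel. z \<notin> S"
        by eventually_elim (auto simp: S_def indicator_def ennreal_eq_0_iff split: if_splits)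
      then have "emeasure lborel S = 0" by (subst (asm) AE_iff_measurable[of S]) auto
      then show False using lS by simp
    qed
    ultimately have "0 < emeasure \<mu> S" by (simp only: zero_less_iff_neq_zero not_False_eq_True)
    also have "\<dots> \<le> emeasure \<mu> (ball x e)"
      by (intro emeasure_mono) (auto simp: S_def finite_equilibrium)
    finally show ?thesis .
  qed
  then show ?thesis by (auto simp: msupport_def)
qed

end

end

text \<open>Take logarithms. With t = b/a, the condition \<rho> <= 1 decides the sign of the density
  at infinity and \<rho> <= t^2 its sign at the origin; this is where the two powers of g that
  separate the regimes come from.\<close>

lemma rho_thresholds:
  fixes g t d \<alpha> p :: real
  assumes "0 < g" "0 < t" "0 < d" "0 < \<alpha>" "0 < p" "2 * p = d + \<alpha>"
  shows "(g * t powr \<alpha>) powr (1 / p) \<le> 1 \<longleftrightarrow> t \<le> g powr (- 1 / \<alpha>)"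
    and "(g * t powr \<alpha>) powr (1 / p) \<le> t\<^sup>2 \<longleftrightarrow> g powr (1 / d) \<le> t"
proof -
  define \<rho> where "\<rho> = (g * t powr \<alpha>) powr (1 / p)"
  have \<rho>: "0 < \<rho>" using assms by (simp add: \<rho>_def)
  have ln\<rho>: "ln \<rho> = (ln g + \<alpha> * ln t) / p"
    using assms by (simp add: \<rho>_def ln_powr ln_mult)
  have "\<rho> \<le> 1 \<longleftrightarrow> ln g + \<alpha> * ln t \<le> 0"
    using \<rho> assms(5) ln_le_cancel_iff[of \<rho> 1] by (simp add: ln\<rho> divide_le_0_iff)
  also have "\<dots> \<longleftrightarrow> ln t \<le> - 1 / \<alpha> * ln g"
  proof -
    have "ln t \<le> - 1 / \<alpha> * ln g \<longleftrightarrow> \<alpha> * ln t \<le> - ln g" using assms(4) by (simp add: field_simps)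
    then show ?thesis by linarith
  qed
  also have "\<dots> \<longleftrightarrow> t \<le> g powr (- 1 / \<alpha>)"
    using assms ln_le_cancel_iff[of t "g powr (- 1 / \<alpha>)"] by (simp add: ln_powr)
  finally show "(g * t powr \<alpha>) powr (1 / p) \<le> 1 \<longleftrightarrow> t \<le> g powr (- 1 / \<alpha>)" by (simp only: \<rho>_def)
  have "\<rho> \<le> t\<^sup>2 \<longleftrightarrow> ln \<rho> \<le> 2 * ln t"
    using \<rho> assms(2) ln_le_cancel_iff[of \<rho> "t\<^sup>2"] by (simp add: ln_realpow)
  also have "\<dots> \<longleftrightarrow> ln g + \<alpha> * ln t \<le> (2 * p) * ln t" unfolding ln\<rho> using assms(5) by (simp add: field_simps)
  also have "\<dots> \<longleftrightarrow> 1 / d * ln g \<le> ln t" unfolding assms(6) using assms(3) by (simp add: field_simps)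
  also have "\<dots> \<longleftrightarrow> g powr (1 / d) \<le> t"
    using assms ln_le_cancel_iff[of "g powr (1 / d)" t] by (simp add: ln_powr)
  finally show "(g * t powr \<alpha>) powr (1 / p) \<le> t\<^sup>2 \<longleftrightarrow> g powr (1 / d) \<le> t" by (simp only: \<rho>_def)
qed

theorem theorem4p5:
  fixes s \<gamma> a b :: real and Q :: "real^'n \<Rightarrow> real" and \<mu> :: "(real^'n) measure"
    and d \<alpha> g \<rho> R :: real
  assumes "CARD('n) \<ge> 2"
    and "real CARD('n) - 2 \<le> s" and "s < real CARD('n)" and "0 < s"
    and "a > 0" and "b > 0" and "\<gamma> > 0"
    and "Q = (\<lambda>x. - (1 + \<gamma>) / (norm x ^ 2 + a ^ 2) powr (s / 2) + \<gamma> / (norm x ^ 2 + b ^ 2) powr (s / 2))"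
    and "riesz_equilibrium s Q \<mu>"
    and "d = real CARD('n)"
    and "\<alpha> = d - s"
    and "g = \<gamma> / (1 + \<gamma>)"
    and "\<rho> = (g * (b / a) powr \<alpha>) powr (2 / (2 * d - s))"
    and "R = sqrt ((\<rho> * a ^ 2 - b ^ 2) / (1 - \<rho>))"
  shows "(b / a < g powr (1 / d) \<longrightarrow> msupport \<mu> \<subseteq> - cball 0 R)
       \<and> (g powr (1 / d) \<le> b / a \<and> b / a \<le> g powr (- 1 / \<alpha>) \<longrightarrow>
            msupport \<mu> = UNIV \<and> signed_equilibrium s Q \<mu> (null_measure borel))
       \<and> (g powr (- 1 / \<alpha>) < b / a \<longrightarrow> msupport \<mu> \<subseteq> cball 0 R)"
proof -
  interpret superharmonic_riesz s "TYPE(real^'n)"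
    by unfold_locales (use assms in auto)
  have pos: "0 < 1 + \<gamma>" "0 < \<gamma>" "0 < a" "0 < b" using assms by auto
  have Q: "Q = (\<lambda>x. \<gamma> * lifted_kernel s b x - (1 + \<gamma>) * lifted_kernel s a x)"
    by (simp add: assms(8) lifted_kernel_def powr_minus_divide fun_eq_iff diff_divide_distrib add_divide_distrib)
  note eq = assms(9)
  define p where "p = d - s / 2"
  have p: "0 < p" "2 / (2 * d - s) = 1 / p" using assms by (auto simp: p_def field_simps)
  have \<alpha>: "0 < \<alpha>" "0 < d" "2 * p = d + \<alpha>" using assms by (auto simp: p_def)
  have g: "0 < g" "g < 1" unfolding assms(12) using assms(7) by (simp_all add: divide_less_eq)
  have t: "0 < b / a" using pos by simp
  have \<rho>: "\<rho> = (g * (b / a) powr \<alpha>) powr (1 / p)" using assms(13) p by simp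
  note th = rho_thresholds[OF g(1) t \<alpha>(2,1) p(1) \<alpha>(3), folded \<rho>]
  have \<rho>': "\<rho> = (\<gamma> / (1 + \<gamma>) * (b / a) powr (real DIM(real^'n) - s)) powr (1 / (real DIM(real^'n) - s / 2))"
    unfolding \<rho> p_def assms(10,11,12) by simp
  have less_iff: "(1 + \<gamma>) * bubble s a z < \<gamma> * bubble s b z \<longleftrightarrow> b\<^sup>2 - \<rho> * a\<^sup>2 < (\<rho> - 1) * (norm z)\<^sup>2" for z :: "real^'n"
    unfolding bubble_less_iff[OF pos(3,4,1,2)] \<rho>'[symmetric] by (auto simp: algebra_simps)
  have le_iff: "(1 + \<gamma>) * bubble s a z \<le> \<gamma> * bubble s b z \<longleftrightarrow> b\<^sup>2 - \<rho> * a\<^sup>2 \<le> (\<rho> - 1) * (norm z)\<^sup>2" for z :: "real^'n"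
    unfolding bubble_le_iff[OF pos(3,4,1,2)] \<rho>'[symmetric] by (auto simp: algebra_simps)
  have b2: "(b / a)\<^sup>2 = b\<^sup>2 / a\<^sup>2" "0 < a\<^sup>2" using pos by (simp_all add: power_divide)
  have gd: "g powr (1 / d) < 1" "1 < g powr (- 1 / \<alpha>)"
    using g \<alpha> powr_less_mono'[of g 0 "1 / d"] powr_less_mono'[of g "- 1 / \<alpha>" 0] by auto
  have 1: "msupport \<mu> \<subseteq> - cball 0 R" if "b / a < g powr (1 / d)"
  proof -
    have "(b / a)\<^sup>2 < \<rho>" using th(2) that by (simp add: not_le[symmetric])
    then have ba: "b\<^sup>2 < \<rho> * a\<^sup>2" using b2 by (simp add: field_simps)
    \<comment> \<open>The threshold lemma gives only \<rho> <= 1. Here g < 1 and b/a < g^(1/d) < 1,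
      so g * (b/a)^\<alpha> < 1, whereas \<rho> = 1 would make it equal to 1.\<close>
    have "\<rho> \<noteq> 1"
    proof
      assume "\<rho> = 1"
      then have "b\<^sup>2 < a\<^sup>2" "(b / a)\<^sup>2 < 1" using ba b2 by auto
      moreover have "(g * (b / a) powr \<alpha>) = 1"
      proof -
        have "\<rho> powr p = g * (b / a) powr \<alpha>"
          unfolding \<rho> powr_powr using p(1) g(1) pos by simp
        then show ?thesis using \<open>\<rho> = 1\<close> by simp
      qed
      moreover have "b / a < 1" using that gd by simp
      then have "(b / a) powr \<alpha> < 1" using t \<alpha> powr_less_mono2[of \<alpha> "b / a" 1] by (metis less_imp_le powr_one_eq_one)
      then have "g * (b / a) powr \<alpha> < 1 * 1" using g t by (intro mult_strict_mono) auto
      ultimately show False by simp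
    qed
    then have \<rho>1: "\<rho> < 1" using th(1) that gd by simp
    have R: "0 < R" "R\<^sup>2 = (\<rho> * a\<^sup>2 - b\<^sup>2) / (1 - \<rho>)" using ba \<rho>1 unfolding assms(14) by simp_all
    \<comment> \<open>This identifies |z| = R as the zero sphere of the density: at z with this norm
      both sides of \<open>le_iff\<close> coincide.\<close>
    then have RR: "(\<rho> - 1) * R\<^sup>2 = b\<^sup>2 - \<rho> * a\<^sup>2" using \<rho>1 by (simp add: field_simps)
    show ?thesis
    proof (rule support_avoids_cball[OF eq pos Q R(1)])
      fix z :: "real^'n"
      assume "norm z \<le> R"
      then have "(norm z)\<^sup>2 \<le> R\<^sup>2" by (simp add: power_mono)
      then have "(\<rho> - 1) * R\<^sup>2 \<le> (\<rho> - 1) * (norm z)\<^sup>2" using \<rho>1 by (intro mult_left_mono_neg) auto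
      then show "(1 + \<gamma>) * bubble s a z \<le> \<gamma> * bubble s b z" unfolding le_iff RR .
    next
      fix z :: "real^'n"
      assume "norm z < R"
      then have "(norm z)\<^sup>2 < R\<^sup>2" by (simp add: power_strict_mono)
      then have "(\<rho> - 1) * R\<^sup>2 < (\<rho> - 1) * (norm z)\<^sup>2" using \<rho>1 by (intro mult_strict_left_mono_neg) auto
      then show "(1 + \<gamma>) * bubble s a z < \<gamma> * bubble s b z" unfolding less_iff RR .
    qed
  qed
  have 2: "msupport \<mu> = UNIV \<and> signed_equilibrium s Q \<mu> (null_measure borel)"
    if "g powr (1 / d) \<le> b / a" "b / a \<le> g powr (- 1 / \<alpha>)"
  proof -
    have \<rho>1: "\<rho> \<le> 1" and "\<rho> \<le> (b / a)\<^sup>2" using th that by simp_all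
    then have ba: "\<rho> * a\<^sup>2 \<le> b\<^sup>2" using b2 by (simp add: field_simps)
    have le: "\<gamma> * bubble s b z \<le> (1 + \<gamma>) * bubble s a z" for z :: "real^'n"
    proof -
      have "(\<rho> - 1) * (norm z)\<^sup>2 \<le> 0" using \<rho>1 by (simp add: mult_nonpos_nonneg)
      then have "\<not> b\<^sup>2 - \<rho> * a\<^sup>2 < (\<rho> - 1) * (norm z)\<^sup>2" using ba by linarith
      then show ?thesis unfolding less_iff[symmetric] by simp
    qed
    then show ?thesis
      using support_UNIV_of_balanced[OF eq pos Q _ le] signed_equilibrium_of_balanced[OF eq pos Q _ le] by simp
  qed
  have 3: "msupport \<mu> \<subseteq> cball 0 R" if "g powr (- 1 / \<alpha>) < b / a"
  proof (rule support_subset_cball[OF eq pos Q])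
    have \<rho>1: "1 < \<rho>" using th(1) that by (simp add: not_le[symmetric])
    fix z :: "real^'n"
    assume z: "R < norm z"
    have "(\<rho> * a\<^sup>2 - b\<^sup>2) / (1 - \<rho>) < (norm z)\<^sup>2"
    proof (rule ccontr)
      assume "\<not> ?thesis"
      then have "norm z \<le> R" unfolding assms(14) by (intro real_le_rsqrt) simp
      then show False using z by simp
    qed
    then show "(1 + \<gamma>) * bubble s a z < \<gamma> * bubble s b z"
      unfolding less_iff using \<rho>1 by (simp add: field_simps)
  qed
  show ?thesis using 1 2 3 by blast
qed

end
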